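(* Let $A$ be a derived $p$-complete $\delta$-Cartier ring if $p>2$, and a derived $2$-complete $\delta$-$\widetilde{\mathrm C}$artier ring if $p=2$. Let $\widehat A_{\tilde V}=\varprojlim_nA/\tilde V^n(A)$ and $C_A=\widehat A_{\tilde V}/\mathrm{im}(A\to\widehat A_{\tilde V})$. The operator $\tilde V$ is an isomorphism on $C_A$; consider $C_A$ as a Frobenius $A$-module via the map $\tilde V^{-1}:C_A\to C_A$. Then the Frobenius $A$-module structure on $C_A$ extends uniquely to a Frobenius $\widehat A_{\tilde V}$-module structure, and with respect to this structure the quotient map $$d_A:\widehat A_{\tilde V}\longrightarrow C_A$$ is a taut derivation of the $\delta$-ring $\widehat A_{\tilde V}$.
   Context: All rings are commutative with unit; $p$ is a prime. A $\delta$-ring is a ring $A$ with a map $\delta:A\to A$ such that $\delta(0)=\delta(1)=0$, $\delta(x+y)=\delta(x)+\delta(y)-\sum_{i=1}^{p-1}\frac1p\binom pi x^iy^{p-i}$ and $\delta(xy)=x^p\delta(y)+y^p\delta(x)+p\delta(x)\delta(y)$; its Frobenius is $F(a)=a^p+p\delta(a)$. Convention: if $p>2$ one considers $\delta$-Cartier rings, i.e. $\delta$-rings $A$ with an additive map $V:A\to A$ such that $F(V(a))=pa$, $aV(b)=V(F(a)b)$, $\delta(V(a))=a-p^{p-2}V(a^p)$ for all $a,b$, and writes $\tilde V=V$. If $p=2$ one considers $\delta$-$\widetilde{\mathrm C}$artier rings, i.e. $\delta$-rings $A$ with an additive map $\tilde V:A\to A$ such that, with $\tilde 2:=F(\tilde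 V(1))$, one has $\tilde 2^2=4$, $\delta(\tilde 2)=-1$, $F(\tilde V(a))=\tilde 2a$, $a\tilde V(b)=\tilde V(F(a)b)$, $\delta(\tilde V(a))=-a+\tilde V(\tilde 2\delta(a))$ for all $a,b$. In both cases $\tilde V$ is injective, $\delta$ carries elements congruent modulo $\tilde V^i(A)$ to elements congruent modulo $\tilde V^{i-1}(A)$, and the completion $\widehat A_{\tilde V}$ inherits the same kind of structure from $A$. A Frobenius module over a $\delta$-ring $B$ is a $B$-module $M$ with an additive map $F_M:M\to M$ satisfying $F_M(bm)=F(b)F_M(m)$. It is perfect if $F_M$ is bijective. A $\delta$-derivation $d:B\to M$ into a Frobenius module is a derivation (additive, satisfying the Leibniz rule) such that $d(\delta(b))=F_M(d(b))-b^{p-1}d(b)$ for all $b\in B$. It is taut if $M$ is perfect as a Frobenius module and derived $p$-complete. *)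

theory Defs
  imports "HOL-Computational_Algebra.Primes" "HOL-Algebra.QuotRing" "HOL-Algebra.Module"
begin

section \<open>Delta-rings and Cartier structures\<close>

text \<open>The division in the addition formula is exact when \<open>p\<close> is prime and \<open>0 < i < p\<close>.
  Primality of \<open>p\<close> is not part of the locale.\<close>

locale delta_ring = cring R for R (structure) +
  fixes p :: nat and \<delta> :: "'a \<Rightarrow> 'a"
  assumes delta_closed: "\<delta> \<in> carrier R \<rightarrow> carrier R"
    and delta_zero: "\<delta> \<zero> = \<zero>"
    and delta_one: "\<delta> \<one> = \<zero>"
    and delta_add: "\<lbrakk>x \<in> carrier R; y \<in> carrier R\<rbrakk> \<Longrightarrow>
      \<delta> (x \<oplus> y) = \<delta> x \<oplus> \<delta> y \<ominus>
        (\<Oplus>i\<in>{1..p - 1}. [((p choose i) div p)] \<cdot> (x [^] i \<otimes> y [^] (p - i)))"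
    and delta_mult: "\<lbrakk>x \<in> carrier R; y \<in> carrier R\<rbrakk> \<Longrightarrow>
      \<delta> (x \<otimes> y) = x [^] p \<otimes> \<delta> y \<oplus> y [^] p \<otimes> \<delta> x \<oplus> [p] \<cdot> (\<delta> x \<otimes> \<delta> y)"

definition frob :: "('a, 'm) ring_scheme \<Rightarrow> nat \<Rightarrow> ('a \<Rightarrow> 'a) \<Rightarrow> 'a \<Rightarrow> 'a" where
  "frob R p \<delta> a = a [^]\<^bsub>R\<^esub> p \<oplus>\<^bsub>R\<^esub> [p] \<cdot>\<^bsub>R\<^esub> \<delta> a"

locale delta_cartier_ring = delta_ring +
  fixes V :: "'a \<Rightarrow> 'a"
  assumes V_additive: "V \<in> hom (add_monoid R) (add_monoid R)"
    and frob_V: "a \<in> carrier R \<Longrightarrow> frob R p \<delta> (V a) = [p] \<cdot> a"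
    and V_linear: "\<lbrakk>a \<in> carrier R; b \<in> carrier R\<rbrakk> \<Longrightarrow>
      a \<otimes> V b = V (frob R p \<delta> a \<otimes> b)"
    and delta_V: "a \<in> carrier R \<Longrightarrow>
      \<delta> (V a) = a \<ominus> [(p ^ (p - 2))] \<cdot> V (a [^] p)"

definition tilde_two :: "('a, 'm) ring_scheme \<Rightarrow> ('a \<Rightarrow> 'a) \<Rightarrow> ('a \<Rightarrow> 'a) \<Rightarrow> 'a" where
  "tilde_two R \<delta> V = frob R 2 \<delta> (V \<one>\<^bsub>R\<^esub>)"

locale delta_tilde_cartier_ring = delta_ring R 2 \<delta> for R (structure) and \<delta> +
  fixes V :: "'a \<Rightarrow> 'a"
  assumes V_additive: "V \<in> hom (add_monoid R) (add_monoid R)"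
    and tilde_two_sq: "tilde_two R \<delta> V [^] (2::nat) = [(4::nat)] \<cdot> \<one>"
    and delta_tilde_two: "\<delta> (tilde_two R \<delta> V) = \<ominus> \<one>"
    and frob_V: "a \<in> carrier R \<Longrightarrow> frob R 2 \<delta> (V a) = tilde_two R \<delta> V \<otimes> a"
    and V_linear: "\<lbrakk>a \<in> carrier R; b \<in> carrier R\<rbrakk> \<Longrightarrow>
      a \<otimes> V b = V (frob R 2 \<delta> a \<otimes> b)"
    and delta_V: "a \<in> carrier R \<Longrightarrow>
      \<delta> (V a) = \<ominus> a \<oplus> V (tilde_two R \<delta> V \<otimes> \<delta> a)"


section \<open>Derived completeness\<close>

text \<open>A module \<open>M\<close> is derived \<open>p\<close>-complete if the derived limit \<open>Rlim\<close> of the tower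
  \<open>\<dots> \<rightarrow> M \<rightarrow> M \<rightarrow> M\<close>, all of whose transition maps are multiplication by \<open>p\<close>, vanishes.
  This derived limit is computed by the two-term complex
  \<open>\<Prod>\<^sub>n M \<rightarrow> \<Prod>\<^sub>n M\<close>, \<open>(x\<^sub>n) \<mapsto> (x\<^sub>n - p x\<^sub>n\<^sub>+\<^sub>1)\<close>; its kernel is \<open>lim\<close>
  (that is, \<open>Hom(Z[1/p], M)\<close>) and its cokernel is \<open>lim\<^sup>1\<close> (that is, \<open>Ext\<^sup>1(Z[1/p], M)\<close>).
  Only the additive group of \<open>M\<close> enters.\<close>

definition derived_complete :: "nat \<Rightarrow> ('a, 'm) ring_scheme \<Rightarrow> bool" where
  "derived_complete p M \<longleftrightarrow>
    (\<forall>x \<in> UNIV \<rightarrow> carrier M.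
       (\<forall>n::nat. x n \<ominus>\<^bsub>M\<^esub> [p] \<cdot>\<^bsub>M\<^esub> x (Suc n) = \<zero>\<^bsub>M\<^esub>) \<longrightarrow> (\<forall>n. x n = \<zero>\<^bsub>M\<^esub>)) \<and>
    (\<forall>y \<in> UNIV \<rightarrow> carrier M.
       \<exists>x \<in> UNIV \<rightarrow> carrier M. \<forall>n::nat. x n \<ominus>\<^bsub>M\<^esub> [p] \<cdot>\<^bsub>M\<^esub> x (Suc n) = y n)"


section \<open>Frobenius modules and delta-derivations\<close>

locale frobenius_module = delta_ring R p \<delta> + module R M
  for R (structure) and p \<delta> and M (structure) +
  fixes \<phi> :: "'c \<Rightarrow> 'c"
  assumes phi_additive: "\<phi> \<in> hom (add_monoid M) (add_monoid M)"
    and phi_semilinear: "\<lbrakk>b \<in> carrier R; m \<in> carrier M\<rbrakk> \<Longrightarrow>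
      \<phi> (b \<odot>\<^bsub>M\<^esub> m) = frob R p \<delta> b \<odot>\<^bsub>M\<^esub> \<phi> m"

locale delta_derivation = frobenius_module +
  fixes d :: "'a \<Rightarrow> 'c"
  assumes d_additive: "d \<in> hom (add_monoid R) (add_monoid M)"
    and d_leibniz: "\<lbrakk>x \<in> carrier R; y \<in> carrier R\<rbrakk> \<Longrightarrow>
      d (x \<otimes>\<^bsub>R\<^esub> y) = x \<odot>\<^bsub>M\<^esub> d y \<oplus>\<^bsub>M\<^esub> y \<odot>\<^bsub>M\<^esub> d x"
    and d_delta: "b \<in> carrier R \<Longrightarrow>
      d (\<delta> b) = \<phi> (d b) \<ominus>\<^bsub>M\<^esub> (b [^]\<^bsub>R\<^esub> (p - 1)) \<odot>\<^bsub>M\<^esub> d b"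

locale taut_derivation = delta_derivation +
  assumes perfect: "bij_betw \<phi> (carrier M) (carrier M)"
    and target_derived_complete: "derived_complete p M"


section \<open>The completion and its cokernel\<close>

definition V_ideal :: "('a, 'm) ring_scheme \<Rightarrow> ('a \<Rightarrow> 'a) \<Rightarrow> nat \<Rightarrow> 'a set" where
  "V_ideal A V n = (V ^^ n) ` carrier A"

text \<open>The inverse limit of the rings \<open>A / V\<^sup>n A\<close>, as compatible sequences of cosets.
  A coset of \<open>V\<^sup>n\<^sup>+\<^sup>1 A\<close> is mapped to a coset of \<open>V\<^sup>n A\<close> by the projection iff it is
  contained in it.\<close>

definition completion :: "('a, 'm) ring_scheme \<Rightarrow> ('a \<Rightarrow> 'a) \<Rightarrow> (nat \<Rightarrow> 'a set) ring" where
  "completion A V =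
    \<lparr>carrier = {x. (\<forall>n. x n \<in> carrier (A Quot V_ideal A V n)) \<and> (\<forall>n. x (Suc n) \<subseteq> x n)},
     mult = (\<lambda>x y n. x n \<otimes>\<^bsub>A Quot V_ideal A V n\<^esub> y n),
     one = (\<lambda>n. \<one>\<^bsub>A Quot V_ideal A V n\<^esub>),
     zero = (\<lambda>n. \<zero>\<^bsub>A Quot V_ideal A V n\<^esub>),
     add = (\<lambda>x y n. x n \<oplus>\<^bsub>A Quot V_ideal A V n\<^esub> y n)\<rparr>"

definition completion_map ::
    "('a, 'm) ring_scheme \<Rightarrow> ('a \<Rightarrow> 'a) \<Rightarrow> 'a \<Rightarrow> (nat \<Rightarrow> 'a set)" where
  "completion_map A V a = (\<lambda>n. V_ideal A V n +>\<^bsub>A\<^esub> a)"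

text \<open>Maps induced on quotients are written, as in \<^const>\<open>rcoset_mult\<close>, as the union over
  all representatives of the resulting cosets; for a well-defined map these cosets coincide.
  Since \<open>\<delta>\<close> induces maps \<open>A / V\<^sup>n\<^sup>+\<^sup>1 A \<rightarrow> A / V\<^sup>n A\<close>, the component \<open>n\<close> of \<open>\<delta> x\<close> is
  computed from the component \<open>n + 1\<close> of \<open>x\<close>.\<close>

definition completion_delta ::
    "('a, 'm) ring_scheme \<Rightarrow> ('a \<Rightarrow> 'a) \<Rightarrow> ('a \<Rightarrow> 'a) \<Rightarrow> (nat \<Rightarrow> 'a set) \<Rightarrow> (nat \<Rightarrow> 'a set)"
  where "completion_delta A V \<delta> x = (\<lambda>n. \<Union>a\<in>x (Suc n). V_ideal A V n +>\<^bsub>A\<^esub> \<delta> a)"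

definition completion_V ::
    "('a, 'm) ring_scheme \<Rightarrow> ('a \<Rightarrow> 'a) \<Rightarrow> (nat \<Rightarrow> 'a set) \<Rightarrow> (nat \<Rightarrow> 'a set)" where
  "completion_V A V x = (\<lambda>n. \<Union>a\<in>x n. V_ideal A V n +>\<^bsub>A\<^esub> V a)"

definition completion_image ::
    "('a, 'm) ring_scheme \<Rightarrow> ('a \<Rightarrow> 'a) \<Rightarrow> (nat \<Rightarrow> 'a set) set" where
  "completion_image A V = completion_map A V ` carrier A"

text \<open>The quotient \<open>C\<^sub>A\<close> of additive groups, equipped with a scalar
  multiplication \<open>sm\<close> by some ring. The fields \<open>mult\<close> and \<open>one\<close> of a module
  record are irrelevant.\<close>

definition coker_module :: "('a, 'm) ring_scheme \<Rightarrow> ('a \<Rightarrow> 'a) \<Rightarrow>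
    ('r \<Rightarrow> (nat \<Rightarrow> 'a set) set \<Rightarrow> (nat \<Rightarrow> 'a set) set) \<Rightarrow> ('r, (nat \<Rightarrow> 'a set) set) module"
  where "coker_module A V sm =
    \<lparr>carrier = a_rcosets\<^bsub>completion A V\<^esub> (completion_image A V),
     mult = undefined, one = undefined,
     zero = completion_image A V, add = set_add (completion A V),
     smult = sm\<rparr>"

abbreviation coker_carrier ::
    "('a, 'm) ring_scheme \<Rightarrow> ('a \<Rightarrow> 'a) \<Rightarrow> (nat \<Rightarrow> 'a set) set set" where
  "coker_carrier A V \<equiv> a_rcosets\<^bsub>completion A V\<^esub> (completion_image A V)"

definition coker_proj ::
    "('a, 'm) ring_scheme \<Rightarrow> ('a \<Rightarrow> 'a) \<Rightarrow> (nat \<Rightarrow> 'a set) \<Rightarrow> (nat \<Rightarrow> 'a set) set" where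
  "coker_proj A V x = completion_image A V +>\<^bsub>completion A V\<^esub> x"

definition coker_smult :: "('a, 'm) ring_scheme \<Rightarrow> ('a \<Rightarrow> 'a) \<Rightarrow>
    'a \<Rightarrow> (nat \<Rightarrow> 'a set) set \<Rightarrow> (nat \<Rightarrow> 'a set) set" where
  "coker_smult A V a X =
    (\<Union>x\<in>X. coker_proj A V (completion_map A V a \<otimes>\<^bsub>completion A V\<^esub> x))"

definition coker_V :: "('a, 'm) ring_scheme \<Rightarrow> ('a \<Rightarrow> 'a) \<Rightarrow>
    (nat \<Rightarrow> 'a set) set \<Rightarrow> (nat \<Rightarrow> 'a set) set" where
  "coker_V A V X = (\<Union>x\<in>X. coker_proj A V (completion_V A V x))"

definition coker_frob :: "('a, 'm) ring_scheme \<Rightarrow> ('a \<Rightarrow> 'a) \<Rightarrow>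
    (nat \<Rightarrow> 'a set) set \<Rightarrow> (nat \<Rightarrow> 'a set) set" where
  "coker_frob A V = inv_into (coker_carrier A V) (coker_V A V)"

text \<open>A Frobenius module structure over the completion that extends the one over \<open>A\<close> has the
  same additive group and the same Frobenius map, and its scalar multiplication restricts to the
  given one along \<open>A \<rightarrow> completion A V\<close>. Being extensional makes the scalar
  multiplication determined by its values on the carriers.\<close>

definition extends_coker_structure :: "('a, 'm) ring_scheme \<Rightarrow> nat \<Rightarrow> ('a \<Rightarrow> 'a) \<Rightarrow> ('a \<Rightarrow> 'a) \<Rightarrow>
    ((nat \<Rightarrow> 'a set) \<Rightarrow> (nat \<Rightarrow> 'a set) set \<Rightarrow> (nat \<Rightarrow> 'a set) set) \<Rightarrow> bool" where
  "extends_coker_structure A p \<delta> V sm \<longleftrightarrow>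
    sm \<in> carrier (completion A V) \<rightarrow>\<^sub>E (coker_carrier A V \<rightarrow>\<^sub>E coker_carrier A V) \<and>
    frobenius_module (completion A V) p (completion_delta A V \<delta>)
      (coker_module A V sm) (coker_frob A V) \<and>
    (\<forall>a\<in>carrier A. \<forall>m\<in>coker_carrier A V.
       sm (completion_map A V a) m = coker_smult A V a m)"

end

theory Submission
  imports Defs
begin

text \<open>The two kinds of rings are treated at once. Put \<open>\<pi> = F (V 1)\<close>, which is \<open>p\<close> for odd \<open>p\<close>. In both
  cases \<open>V\<close> is injective, \<open>F (V a) = \<pi> a\<close>, \<open>a V b = V (F a b)\<close> and \<open>F \<pi> = p\<close>; hence \<open>\<pi>\<close> acts as
  \<open>p\<close> on everything in the image of \<open>V\<close>. These properties are the locale \<open>cartier_ring\<close>, and the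
  completion \<open>B\<close> of a Cartier ring \<open>A\<close> is again one.

  Write \<open>d : B \<rightarrow> C\<close> for the quotient map. The argument rests on one fact: every element of \<open>B\<close> has
  the form \<open>a + V y\<close> with \<open>a\<close> from \<open>A\<close>. Since \<open>d (a + V y) = V (d y)\<close>, the operator \<open>V\<close> is
  surjective on \<open>C\<close>; it is injective because \<open>y\<close> comes from \<open>A\<close> whenever \<open>V y\<close> does. Let \<open>\<phi>\<close> be its inverse and let \<open>T = p V\<close> on \<open>C\<close>. In a Frobenius module structure over \<open>B\<close>
  extending the one over \<open>A\<close> one has \<open>\<phi> (V y \<cdot> m) = \<pi> y \<cdot> \<phi> m\<close>, so its scalar multiplication
  satisfies the recursion

  \<open>(a + V y) \<cdot> m = a m + T (y \<cdot> \<phi> m)\<close>.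

  This recursion has exactly one solution, because \<open>T\<close> behaves like a contraction: \<open>C\<close> is the cokernel of
  a map between derived \<open>p\<close>-complete groups, hence derived \<open>p\<close>-complete, so sequences with
  \<open>w\<^sub>n - p w\<^sub>n\<^sub>+\<^sub>1 = y\<^sub>n\<close> exist and are unique (lemma \<open>corecursion\<close>). For the same reason two families
  of elements of \<open>C\<close> that satisfy the same recursion \<open>u = c + k T u'\<close> are equal (lemma
  \<open>bisimulation\<close>). The module axioms and the Leibniz rule follow by showing that both sides obey the
  same recursion.

  It remains to compute \<open>d (\<delta> x)\<close>. The expression \<open>u x = d (\<delta> x) + x\<^sup>p\<^sup>-\<^sup>1 d x\<close> is additive in \<open>x\<close>,
  because the derivative of the polynomial in the addition formula for \<open>\<delta>\<close> cancels the change of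
  \<open>x\<^sup>p\<^sup>-\<^sup>1 d x\<close>, and it vanishes on \<open>A\<close>; so \<open>u (a + V y) = u (V y)\<close>. The formula for \<open>\<delta> (V y)\<close> gives
  \<open>u (V y) = d y\<close> for odd \<open>p\<close>, and \<open>u (V y) = - d y + T (u y)\<close> for \<open>p = 2\<close>. In the first case
  \<open>u x = \<phi> (d x)\<close> at once, and in the second both sides satisfy the same recursion.\<close>

section \<open>Additive maps\<close>

lemma (in abelian_group_hom) hom_minus:
  "\<lbrakk>x \<in> carrier G; y \<in> carrier G\<rbrakk> \<Longrightarrow> h (x \<ominus>\<^bsub>G\<^esub> y) = h x \<ominus>\<^bsub>H\<^esub> h y"
  by (simp add: a_minus_def)

lemma (in abelian_group_hom) hom_add_pow:
  "x \<in> carrier G \<Longrightarrow> h ([(n::nat)] \<cdot>\<^bsub>G\<^esub> x) = [n] \<cdot>\<^bsub>H\<^esub> h x"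
  by (induction n) (simp_all add: G.add.nat_pow_Suc H.add.nat_pow_Suc)

lemma (in abelian_group_hom) hom_add_sum:
  assumes "finite I" and "f \<in> I \<rightarrow> carrier G"
  shows "h (\<Oplus>\<^bsub>G\<^esub>i\<in>I. f i) = (\<Oplus>\<^bsub>H\<^esub>i\<in>I. h (f i))"
  using assms
proof (induction I)
  case (insert i I)
  moreover from insert.prems have "(\<lambda>i. h (f i)) \<in> I \<rightarrow> carrier H"
    by (auto simp: Pi_iff)
  ultimately show ?case
    by (simp add: G.finsum_insert H.finsum_insert G.finsum_closed Pi_def)
qed simp

lemma (in abelian_group_hom) inj_onI_kernel:
  assumes "\<And>x. \<lbrakk>x \<in> carrier G; h x = \<zero>\<^bsub>H\<^esub>\<rbrakk> \<Longrightarrow> x = \<zero>\<^bsub>G\<^esub>"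
  shows "inj_on h (carrier G)"
proof (rule inj_onI)
  fix x y assume xy: "x \<in> carrier G" "y \<in> carrier G" "h x = h y"
  then have "h (x \<ominus>\<^bsub>G\<^esub> y) = \<zero>\<^bsub>H\<^esub>"
    by (simp add: hom_minus a_minus_def H.r_neg)
  then have "x \<oplus>\<^bsub>G\<^esub> \<ominus>\<^bsub>G\<^esub> y = \<zero>\<^bsub>G\<^esub>"
    using assms[of "x \<ominus>\<^bsub>G\<^esub> y"] xy by (simp add: a_minus_def)
  then show "x = y"
    using xy G.minus_equality[of x "\<ominus>\<^bsub>G\<^esub> y"] by simp
qed

lemma abelian_group_homI_hom:
  assumes "abelian_group G" "abelian_group H" "h \<in> hom (add_monoid G) (add_monoid H)"
  shows "abelian_group_hom G H h"
  using assms
  by (intro abelian_group_homI group_hom.intro group_hom_axioms.intro abelian_group.a_group)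

lemma (in abelian_group) minus_eq_zeroD:
  "\<lbrakk>a \<ominus> b = \<zero>; a \<in> carrier G; b \<in> carrier G\<rbrakk> \<Longrightarrow> a = b"
  using minus_equality[of a "\<ominus> b"] by (simp add: a_minus_def)

lemma (in abelian_group) eq_minusI:
  assumes "a = b \<oplus> c" "b \<in> carrier G" "c \<in> carrier G"
  shows "c = a \<ominus> b"
proof -
  have "a \<ominus> b = c \<oplus> (b \<ominus> b)"
    using assms by (simp add: a_minus_def a_ac)
  then show ?thesis using assms by (simp add: a_minus_def r_neg)
qed

lemma (in abelian_group) add_pow_two: "x \<in> carrier G \<Longrightarrow> [(2::nat)] \<cdot> x = x \<oplus> x"
  using add.nat_pow_Suc[of 1 x] by (simp add: numeral_2_eq_2)

lemma (in monoid) nat_pow_two: "x \<in> carrier G \<Longrightarrow> x [^] (2::nat) = x \<otimes> x"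
  using nat_pow_Suc[of x 1] by (simp add: numeral_2_eq_2)

section \<open>Binomials\<close>

context cring
begin

lemma binomial:
  assumes "x \<in> carrier R" "y \<in> carrier R"
  shows "(x \<oplus> y) [^] n = (\<Oplus>k\<in>{..n}. [(n choose k)] \<cdot> (x [^] k \<otimes> y [^] (n - k)))"
proof (induction n)
  case 0
  then show ?case using assms by simp
next
  case (Suc n)
  let ?t = "\<lambda>n k. [(n choose k)] \<cdot> (x [^] k \<otimes> y [^] (n - k))"
  have "x \<otimes> (\<Oplus>k\<in>{..n}. ?t n k) = (\<Oplus>k\<in>{..n}. [(n choose k)] \<cdot> (x [^] Suc k \<otimes> y [^] (n - k)))"
    using assms
    by (simp add: finsum_rdistr Pi_def add_pow_rdistr m_ac)
  moreover have "y \<otimes> (\<Oplus>k\<in>{..n}. ?t n k) = (\<Oplus>k\<in>{..Suc n}. [(n choose k)] \<cdot> (x [^] k \<otimes> y [^] (Suc n - k)))"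
  proof -
    have "y \<otimes> ?t n k = [(n choose k)] \<cdot> (x [^] k \<otimes> y [^] (Suc n - k))" if "k \<le> n" for k
      using that assms by (simp add: add_pow_rdistr m_ac Suc_diff_le)
    then show ?thesis
      using assms by (auto simp: finsum_rdistr Pi_def finsum_Suc binomial_eq_0 intro!: finsum_cong')
  qed
  moreover have "\<dots> = (\<Oplus>k\<in>{..n}. [(n choose Suc k)] \<cdot> (x [^] Suc k \<otimes> y [^] (n - k))) \<oplus> y [^] Suc n"
    using assms by (subst finsum_Suc2) (auto simp: Pi_def)
  moreover have "(\<Oplus>k\<in>{..Suc n}. ?t (Suc n) k)
      = (\<Oplus>k\<in>{..n}. [(n choose k)] \<cdot> (x [^] Suc k \<otimes> y [^] (n - k)) \<oplus>
           [(n choose Suc k)] \<cdot> (x [^] Suc k \<otimes> y [^] (n - k))) \<oplus> y [^] Suc n"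
    using assms by (subst finsum_Suc2) (auto simp: Pi_def add.nat_pow_mult)
  moreover have "(x \<oplus> y) [^] Suc n = x \<otimes> (\<Oplus>k\<in>{..n}. ?t n k) \<oplus> y \<otimes> (\<Oplus>k\<in>{..n}. ?t n k)"
    using assms Suc by (simp add: l_distr m_comm Pi_def)
  ultimately show ?case
    using assms by (simp add: finsum_addf Pi_def a_assoc)
qed

lemma binomial_without_first:
  assumes "x \<in> carrier R" "y \<in> carrier R"
  shows "(\<Oplus>k\<in>{1..n}. [(n choose k)] \<cdot> (x [^] k \<otimes> y [^] (n - k))) = (x \<oplus> y) [^] n \<ominus> y [^] n"
proof -
  have "{..n} = insert 0 {1..n}" by auto
  then have "(x \<oplus> y) [^] n = y [^] n \<oplus> (\<Oplus>k\<in>{1..n}. [(n choose k)] \<cdot> (x [^] k \<otimes> y [^] (n - k)))"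
    unfolding binomial[OF assms] using assms by (simp add: finsum_insert Pi_def)
  then show ?thesis
    using assms by (intro eq_minusI finsum_closed) (auto simp: Pi_def)
qed

lemma binomial_without_last:
  assumes "x \<in> carrier R" "y \<in> carrier R"
  shows "(\<Oplus>k\<in>{1..n}. [(n choose (k - 1))] \<cdot> (x [^] (k - 1) \<otimes> y [^] (n - (k - 1))))
    = (x \<oplus> y) [^] n \<ominus> x [^] n"
proof -
  let ?f = "\<lambda>k. [(n choose k)] \<cdot> (x [^] k \<otimes> y [^] (n - k))"
  have "{..n} = insert n {..<n}" by auto
  then have "(x \<oplus> y) [^] n = x [^] n \<oplus> (\<Oplus>k\<in>{..<n}. ?f k)"
    unfolding binomial[OF assms] using assms by (simp add: finsum_insert Pi_def)
  moreover have "(\<Oplus>k\<in>{..<n}. ?f k) = (\<Oplus>k\<in>{1..n}. ?f (k - 1))"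
  proof -
    have "(\<lambda>k. k - 1) ` {1..n} = {..<n}"
    proof (intro equalityI subsetI)
      fix i assume "i \<in> {..<n}"
      then show "i \<in> (\<lambda>k. k - 1) ` {1..n}" by (intro image_eqI[of _ _ "Suc i"]) auto
    qed auto
    moreover have "inj_on (\<lambda>k::nat. k - 1) {1..n}" by (auto simp: inj_on_def)
    ultimately show ?thesis
      using assms finsum_reindex[of ?f "\<lambda>k. k - 1" "{1..n}"] by (simp add: Pi_def)
  qed
  ultimately have "(x \<oplus> y) [^] n = x [^] n \<oplus> (\<Oplus>k\<in>{1..n}. ?f (k - 1))"
    by simp
  then show ?thesis
    using assms by (intro eq_minusI finsum_closed) (auto simp: Pi_def)
qed

text \<open>Divided by \<open>p\<close> for \<open>n = p\<close>, the left-hand side is the polynomial in the addition formula for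
  \<open>\<delta>\<close>; this is what makes the Frobenius lift additive.\<close>

lemma binomial_inner:
  assumes "x \<in> carrier R" "y \<in> carrier R" "n > 0"
  shows "(\<Oplus>k\<in>{1..n - 1}. [(n choose k)] \<cdot> (x [^] k \<otimes> y [^] (n - k))) = (x \<oplus> y) [^] n \<ominus> x [^] n \<ominus> y [^] n"
proof -
  have "{1..n} = insert n {1..n - 1}" using assms by auto
  moreover have "n \<notin> {1..n - 1}" using assms by auto
  ultimately have "(x \<oplus> y) [^] n \<ominus> y [^] n = x [^] n \<oplus> (\<Oplus>k\<in>{1..n - 1}. [(n choose k)] \<cdot> (x [^] k \<otimes> y [^] (n - k)))"
    unfolding binomial_without_first[OF assms(1,2), symmetric]
    using assms by (simp add: finsum_insert Pi_def)
  then have "(\<Oplus>k\<in>{1..n - 1}. [(n choose k)] \<cdot> (x [^] k \<otimes> y [^] (n - k))) = (x \<oplus> y) [^] n \<ominus> y [^] n \<ominus> x [^] n"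
    using assms by (intro eq_minusI finsum_closed) (auto simp: Pi_def)
  also have "\<dots> = (x \<oplus> y) [^] n \<ominus> x [^] n \<ominus> y [^] n"
    using assms by (simp add: a_minus_def a_ac)
  finally show ?thesis .
qed

end

section \<open>The Frobenius lift of a delta-ring\<close>

locale prime_delta_ring = delta_ring +
  assumes prime_p: "Factorial_Ring.prime p"
begin

abbreviation F where "F \<equiv> frob R p \<delta>"

lemma p_pos: "p > 0"
  using prime_p prime_gt_0_nat by blast

lemma delta_in [simp, intro]: "a \<in> carrier R \<Longrightarrow> \<delta> a \<in> carrier R"
  using delta_closed by blast

lemma frob_in [simp, intro]: "a \<in> carrier R \<Longrightarrow> F a \<in> carrier R"
  by (simp add: frob_def)

lemma p_mult_choose_div: "i \<in> {1..p - 1} \<Longrightarrow> (p choose i) div p * p = (p choose i)"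
  using dvd_choose_prime[of i p] prime_p p_pos by auto

lemma frob_add:
  assumes [simp]: "x \<in> carrier R" "y \<in> carrier R"
  shows "F (x \<oplus> y) = F x \<oplus> F y"
proof -
  let ?S = "\<Oplus>i\<in>{1..p - 1}. [((p choose i) div p)] \<cdot> (x [^] i \<otimes> y [^] (p - i))"
  have S [simp]: "?S \<in> carrier R" by (auto intro!: finsum_closed)
  interpret m: abelian_group_hom R R "\<lambda>x. [p] \<cdot> x"
    by (rule abelian_group_homI_hom) (auto simp: hom_def add.nat_pow_distrib intro: is_abelian_group)
  have "[p] \<cdot> ?S = (\<Oplus>i\<in>{1..p - 1}. [(p choose i)] \<cdot> (x [^] i \<otimes> y [^] (p - i)))"
    by (auto simp: m.hom_add_sum add.nat_pow_pow p_mult_choose_div intro!: finsum_cong')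
  also have "\<dots> = (x \<oplus> y) [^] p \<ominus> x [^] p \<ominus> y [^] p"
    by (rule binomial_inner) (simp_all add: p_pos)
  finally have "[p] \<cdot> \<delta> (x \<oplus> y) = [p] \<cdot> \<delta> x \<oplus> [p] \<cdot> \<delta> y \<ominus> ((x \<oplus> y) [^] p \<ominus> x [^] p \<ominus> y [^] p)"
    by (simp add: delta_add m.hom_minus)
  moreover have "c \<oplus> (a \<oplus> b \<ominus> (c \<ominus> a' \<ominus> b')) = a' \<oplus> a \<oplus> (b' \<oplus> b)"
    if "a \<in> carrier R" "b \<in> carrier R" "c \<in> carrier R" "a' \<in> carrier R" "b' \<in> carrier R" for a b c a' b'
    using that by algebra
  ultimately show ?thesis
    by (simp add: frob_def)
qed

lemma frob_mult:
  assumes [simp]: "x \<in> carrier R" "y \<in> carrier R"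
  shows "F (x \<otimes> y) = F x \<otimes> F y"
proof -
  have "F (x \<otimes> y) = x [^] p \<otimes> y [^] p \<oplus> [p] \<cdot> (x [^] p \<otimes> \<delta> y \<oplus> y [^] p \<otimes> \<delta> x \<oplus> [p] \<cdot> (\<delta> x \<otimes> \<delta> y))"
    by (simp add: frob_def delta_mult nat_pow_distrib)
  also have "\<dots> = x [^] p \<otimes> y [^] p \<oplus> (x [^] p \<otimes> [p] \<cdot> \<delta> y \<oplus> y [^] p \<otimes> [p] \<cdot> \<delta> x \<oplus> [p] \<cdot> \<delta> x \<otimes> [p] \<cdot> \<delta> y)"
    by (simp add: add.nat_pow_distrib add_pow_rdistr add_pow_ldistr)
  also have "\<dots> = (x [^] p \<oplus> [p] \<cdot> \<delta> x) \<otimes> (y [^] p \<oplus> [p] \<cdot> \<delta> y)"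
    by (simp add: l_distr r_distr a_ac m_comm)
  finally show ?thesis by (simp add: frob_def)
qed

lemma frob_one [simp]: "F \<one> = \<one>"
  by (simp add: frob_def delta_one)

sublocale frob_hom: ring_hom_cring R R F
  by (intro ring_hom_cringI ring_hom_ringI cring_axioms ring_axioms) (auto simp: frob_add frob_mult)


lemma frob_nat [simp]: "F ([(n::nat)] \<cdot> \<one>) = [n] \<cdot> \<one>"
  by (simp add: frob_hom.ring.hom_add_pow)

end

section \<open>Derivations and the addition formula\<close>

lemma (in module) smult_hom_left: "m \<in> carrier M \<Longrightarrow> (\<lambda>a. a \<odot>\<^bsub>M\<^esub> m) \<in> hom (add_monoid R) (add_monoid M)"
  by (auto simp: hom_def smult_l_distr)

lemma (in module) smult_hom_right: "a \<in> carrier R \<Longrightarrow> (\<lambda>m. a \<odot>\<^bsub>M\<^esub> m) \<in> hom (add_monoid M) (add_monoid M)"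
  by (auto simp: hom_def smult_r_distr)

lemma (in module) smult_add_pow_left:
  "\<lbrakk>a \<in> carrier R; m \<in> carrier M\<rbrakk> \<Longrightarrow> ([(n::nat)] \<cdot> a) \<odot>\<^bsub>M\<^esub> m = [n] \<cdot>\<^bsub>M\<^esub> (a \<odot>\<^bsub>M\<^esub> m)"
  using abelian_group_hom.hom_add_pow[OF abelian_group_homI_hom[OF _ _ smult_hom_left]]
  using M.abelian_group_axioms R.is_abelian_group by blast

lemma (in module) smult_add_pow_right:
  "\<lbrakk>a \<in> carrier R; m \<in> carrier M\<rbrakk> \<Longrightarrow> a \<odot>\<^bsub>M\<^esub> ([(n::nat)] \<cdot>\<^bsub>M\<^esub> m) = [n] \<cdot>\<^bsub>M\<^esub> (a \<odot>\<^bsub>M\<^esub> m)"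
  using abelian_group_hom.hom_add_pow[OF abelian_group_homI_hom[OF _ _ smult_hom_right]]
  using M.abelian_group_axioms by blast

lemma (in module) smult_sum_left:
  assumes "finite I" "m \<in> carrier M" "f \<in> I \<rightarrow> carrier R"
  shows "(\<Oplus>i\<in>I. f i) \<odot>\<^bsub>M\<^esub> m = (\<Oplus>\<^bsub>M\<^esub>i\<in>I. f i \<odot>\<^bsub>M\<^esub> m)"
  using abelian_group_hom.hom_add_sum[OF abelian_group_homI_hom[OF _ _ smult_hom_left]]
  using M.abelian_group_axioms R.is_abelian_group assms by blast

locale derivation = module +
  fixes d
  assumes d_hom: "d \<in> hom (add_monoid R) (add_monoid M)"
    and leibniz: "\<lbrakk>x \<in> carrier R; y \<in> carrier R\<rbrakk> \<Longrightarrow>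
      d (x \<otimes>\<^bsub>R\<^esub> y) = x \<odot>\<^bsub>M\<^esub> d y \<oplus>\<^bsub>M\<^esub> y \<odot>\<^bsub>M\<^esub> d x"
begin

sublocale d: abelian_group_hom R M d
  by (intro abelian_group_homI_hom R.is_abelian_group M.abelian_group_axioms d_hom)

lemma d_one: "d \<one> = \<zero>\<^bsub>M\<^esub>"
proof -
  have "d \<one> = d \<one> \<oplus>\<^bsub>M\<^esub> d \<one>"
    using leibniz[of \<one> \<one>] by simp
  then show ?thesis by simp
qed

lemma d_pow:
  assumes [simp]: "x \<in> carrier R"
  shows "d (x [^] (n::nat)) = [n] \<cdot>\<^bsub>M\<^esub> (x [^] (n - 1) \<odot>\<^bsub>M\<^esub> d x)"
proof (induction n)
  case (Suc n)
  have "x \<odot>\<^bsub>M\<^esub> (x [^] (n - 1) \<odot>\<^bsub>M\<^esub> d x) = x [^] n \<odot>\<^bsub>M\<^esub> d x" if "n > 0"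
    using that by (simp add: smult_assoc1[symmetric] m_comm[of x] nat_pow_Suc[symmetric] del: nat_pow_Suc)
  with Suc show ?case
    by (cases n) (simp_all add: leibniz smult_add_pow_right d_one M.add.nat_pow_Suc M.a_ac smult_r_distr)
qed (simp add: d_one)

text \<open>For \<open>0 < i < p\<close> the coefficient \<open>c = (p choose i) div p\<close> satisfies \<open>c i = (p - 1 choose i - 1)\<close> and
  \<open>c (p - i) = (p - 1 choose i)\<close>. Differentiating termwise therefore produces two binomial sums with exponent
  \<open>p - 1\<close>, each lacking one of its outer terms.\<close>

lemma d_addition_polynomial:
  assumes p: "Factorial_Ring.prime p" and [simp]: "x \<in> carrier R" "y \<in> carrier R"
  shows "d (\<Oplus>i\<in>{1..p - 1}. [((p choose i) div p)] \<cdot> (x [^] i \<otimes> y [^] (p - i)))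
    = ((x \<oplus> y) [^] (p - 1) \<ominus> x [^] (p - 1)) \<odot>\<^bsub>M\<^esub> d x \<oplus>\<^bsub>M\<^esub> ((x \<oplus> y) [^] (p - 1) \<ominus> y [^] (p - 1)) \<odot>\<^bsub>M\<^esub> d y"
proof -
  define q where "q = p - 1"
  have q: "p = Suc q" using p prime_gt_0_nat[of p] by (simp add: q_def)
  have "d ([((p choose i) div p)] \<cdot> (x [^] i \<otimes> y [^] (p - i)))
      = ([(q choose (i - 1))] \<cdot> (x [^] (i - 1) \<otimes> y [^] (q - (i - 1)))) \<odot>\<^bsub>M\<^esub> d x \<oplus>\<^bsub>M\<^esub>
        ([(q choose i)] \<cdot> (x [^] i \<otimes> y [^] (q - i))) \<odot>\<^bsub>M\<^esub> d y" (is "?l = ?r") if i: "i \<in> {1..q}" for i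
  proof -
    define c where "c = (p choose i) div p"
    have c: "c * p = p choose i"
    proof -
      have "p dvd (p choose i)"
        using i q by (intro dvd_choose_prime p) auto
      then show ?thesis by (simp add: c_def)
    qed
    obtain j where j: "i = Suc j" using i by (cases i) auto
    have "p * (q choose j) = (p choose i) * i"
      unfolding q j by (rule Suc_times_binomial_eq)
    then have "p * (q choose j) = p * (c * i)" using c by (simp add: ac_simps)
    then have c1: "c * i = q choose (i - 1)" using p prime_gt_0_nat[of p] j by simp
    have "(p choose i) * (p - i) = p * (q choose i)"
      unfolding q using binomial_absorb_comp[of "Suc q" i] by (simp add: mult.commute)
    then have "p * (q choose i) = p * (c * (p - i))" unfolding c[symmetric] by (simp only: ac_simps)
    then have c2: "c * (p - i) = q choose i" using p prime_gt_0_nat[of p] by simp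
    have e: "p - i - 1 = q - i" "p - i = q - (i - 1)" using i q by auto
    have comm: "y [^] (p - i) \<odot>\<^bsub>M\<^esub> (x [^] (i - 1) \<odot>\<^bsub>M\<^esub> d x) = x [^] (i - 1) \<odot>\<^bsub>M\<^esub> (y [^] (p - i) \<odot>\<^bsub>M\<^esub> d x)"
      by (simp add: smult_assoc1[symmetric] m_comm)
    have "?l = [c] \<cdot>\<^bsub>M\<^esub> ([(p - i)] \<cdot>\<^bsub>M\<^esub> ((x [^] i \<otimes> y [^] (p - i - 1)) \<odot>\<^bsub>M\<^esub> d y)
        \<oplus>\<^bsub>M\<^esub> [i] \<cdot>\<^bsub>M\<^esub> ((x [^] (i - 1) \<otimes> y [^] (p - i)) \<odot>\<^bsub>M\<^esub> d x))"
      by (simp add: c_def[symmetric] d.hom_add_pow leibniz d_pow smult_add_pow_right smult_assoc1 comm del: One_nat_def)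
    also have "\<dots> = [(c * i)] \<cdot>\<^bsub>M\<^esub> ((x [^] (i - 1) \<otimes> y [^] (p - i)) \<odot>\<^bsub>M\<^esub> d x) \<oplus>\<^bsub>M\<^esub>
        [(c * (p - i))] \<cdot>\<^bsub>M\<^esub> ((x [^] i \<otimes> y [^] (q - i)) \<odot>\<^bsub>M\<^esub> d y)"
      unfolding e(1)
      by (simp add: M.add.nat_pow_distrib M.add.nat_pow_pow M.a_comm mult.commute)
    also have "\<dots> = ?r"
      unfolding c1 c2 unfolding e(2) by (simp add: smult_add_pow_left)
    finally show ?thesis .
  qed
  then have "(\<Oplus>\<^bsub>M\<^esub>i\<in>{1..q}. d ([((p choose i) div p)] \<cdot> (x [^] i \<otimes> y [^] (p - i))))
     = (\<Oplus>\<^bsub>M\<^esub>i\<in>{1..q}. ([(q choose (i - 1))] \<cdot> (x [^] (i - 1) \<otimes> y [^] (q - (i - 1)))) \<odot>\<^bsub>M\<^esub> d x \<oplus>\<^bsub>M\<^esub>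
        ([(q choose i)] \<cdot> (x [^] i \<otimes> y [^] (q - i))) \<odot>\<^bsub>M\<^esub> d y)"
    by (intro M.finsum_cong') (auto simp del: One_nat_def)
  also have "\<dots> = (\<Oplus>\<^bsub>M\<^esub>i\<in>{1..q}. ([(q choose (i - 1))] \<cdot> (x [^] (i - 1) \<otimes> y [^] (q - (i - 1)))) \<odot>\<^bsub>M\<^esub> d x) \<oplus>\<^bsub>M\<^esub>
       (\<Oplus>\<^bsub>M\<^esub>i\<in>{1..q}. ([(q choose i)] \<cdot> (x [^] i \<otimes> y [^] (q - i))) \<odot>\<^bsub>M\<^esub> d y)"
    by (rule M.finsum_addf) auto
  also have "\<dots> = ((x \<oplus> y) [^] q \<ominus> x [^] q) \<odot>\<^bsub>M\<^esub> d x \<oplus>\<^bsub>M\<^esub> ((x \<oplus> y) [^] q \<ominus> y [^] q) \<odot>\<^bsub>M\<^esub> d y"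
    unfolding binomial_without_first[OF assms(2,3), symmetric] binomial_without_last[OF assms(2,3), symmetric]
    by (intro arg_cong2[of _ _ _ _ "add M"] smult_sum_left[symmetric]) (auto simp del: One_nat_def)
  finally show ?thesis
    unfolding q_def[symmetric] by (subst d.hom_add_sum) auto
qed

end

section \<open>Cartier rings, uniformly in the prime\<close>

text \<open>The common structure of the rings for odd \<open>p\<close> and for \<open>p = 2\<close>. The element \<open>F (V 1)\<close> is \<open>p\<close> in
  the first case and the element \<open>tilde_two\<close> in the second.\<close>

locale cartier_ring = prime_delta_ring +
  fixes V :: "'a \<Rightarrow> 'a"
  assumes V_hom: "V \<in> hom (add_monoid R) (add_monoid R)"
    and V_inj: "inj_on V (carrier R)"
    and frob_V: "a \<in> carrier R \<Longrightarrow> frob R p \<delta> (V a) = frob R p \<delta> (V \<one>) \<otimes> a"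
    and frob_frob_V_one: "frob R p \<delta> (frob R p \<delta> (V \<one>)) = [p] \<cdot> \<one>"
    and V_linear: "\<lbrakk>a \<in> carrier R; b \<in> carrier R\<rbrakk> \<Longrightarrow>
      a \<otimes> V b = V (frob R p \<delta> a \<otimes> b)"
    and delta_V: "a \<in> carrier R \<Longrightarrow> \<delta> (V a) =
      (if p = 2 then \<ominus> a \<oplus> V (frob R p \<delta> (V \<one>) \<otimes> \<delta> a)
       else a \<ominus> [(p ^ (p - 2))] \<cdot> V (a [^] p))"
begin

abbreviation frob_V_one ("\<pi>") where "\<pi> \<equiv> F (V \<one>)"

sublocale V: abelian_group_hom R R V
  by (intro abelian_group_homI_hom is_abelian_group V_hom)

text \<open>Linearity turns \<open>V a V b\<close> into \<open>V (F (V a) b)\<close>, and \<open>F (V a) = \<pi> a\<close>. On the cokernel the factor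
  \<open>\<pi>\<close> acts as \<open>p\<close>.\<close>

lemma V_mult_V:
  "\<lbrakk>a \<in> carrier R; b \<in> carrier R\<rbrakk> \<Longrightarrow> V a \<otimes> V b = V (\<pi> \<otimes> (a \<otimes> b))"
  by (simp add: V_linear frob_V[of a] m_assoc)

lemma funpow_V_in [simp]: "a \<in> carrier R \<Longrightarrow> (V ^^ n) a \<in> carrier R"
  by (induction n) auto

lemma funpow_frob_in [simp]: "a \<in> carrier R \<Longrightarrow> (F ^^ n) a \<in> carrier R"
  by (induction n) auto

lemma funpow_V_hom: "(V ^^ n) \<in> hom (add_monoid R) (add_monoid R)"
  by (induction n) (auto simp: hom_def)

lemma funpow_V_linear:
  "\<lbrakk>a \<in> carrier R; b \<in> carrier R\<rbrakk> \<Longrightarrow> a \<otimes> (V ^^ n) b = (V ^^ n) ((F ^^ n) a \<otimes> b)"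
  by (induction n arbitrary: a) (simp_all add: V_linear funpow_swap1[of F])

abbreviation I where "I n \<equiv> V_ideal R V n"

lemma V_ideal_0 [simp]: "I 0 = carrier R"
  by (simp add: V_ideal_def)

lemma V_ideal_Suc: "I (Suc n) = V ` I n"
  by (auto simp: V_ideal_def)

lemma V_ideal_in: "a \<in> I n \<Longrightarrow> a \<in> carrier R"
  by (auto simp: V_ideal_def)

lemma V_ideal_ideal: "ideal (I n) R"
proof -
  interpret Vn: abelian_group_hom R R "V ^^ n"
    by (intro abelian_group_homI_hom is_abelian_group funpow_V_hom)
  show ?thesis
  proof (rule idealI[OF ring_axioms])
    show "subgroup (I n) (add_monoid R)"
    proof (rule add.subgroupI)
      fix a b assume "a \<in> I n" "b \<in> I n"
      then show "a \<oplus> b \<in> I n"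
        unfolding V_ideal_def by (auto simp: Vn.hom_add[symmetric] simp del: Vn.hom_add)
    next
      fix a assume "a \<in> I n"
      then show "\<ominus> a \<in> I n"
        unfolding V_ideal_def by (auto simp: Vn.hom_a_inv[symmetric] simp del: Vn.hom_a_inv)
    qed (auto simp: V_ideal_def)
    fix a x assume "a \<in> I n" and x: "x \<in> carrier R"
    then obtain b where b: "b \<in> carrier R" "a = (V ^^ n) b" by (auto simp: V_ideal_def)
    then show "x \<otimes> a \<in> I n"
      using x by (auto simp: V_ideal_def funpow_V_linear)
    then show "a \<otimes> x \<in> I n"
      using x b by (simp add: m_comm)
  qed
qed

sublocale I: ideal "I n" R for n
  by (rule V_ideal_ideal)

lemma V_ideal_antimono_Suc: "I (Suc n) \<subseteq> I n"
  by (auto simp: V_ideal_def funpow_swap1)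

lemma V_in_V_ideal: "a \<in> I n \<Longrightarrow> V a \<in> I (Suc n)"
  by (auto simp: V_ideal_Suc)

lemma V_in_V_idealD: "\<lbrakk>V a \<in> I (Suc n); a \<in> carrier R\<rbrakk> \<Longrightarrow> a \<in> I n"
  using V_inj by (auto simp: V_ideal_Suc inj_on_def dest: V_ideal_in)

lemma V_ideal_pow: "\<lbrakk>a \<in> I n; k > 0\<rbrakk> \<Longrightarrow> a [^] (k::nat) \<in> I n"
  by (cases k) (auto simp: V_ideal_in intro: I.I_l_closed)

lemma V_ideal_add_pow: "a \<in> I n \<Longrightarrow> [(k::nat)] \<cdot> a \<in> I n"
  by (induction k) (auto simp: add.nat_pow_Suc)

lemma V_ideal_minus: "\<lbrakk>a \<in> I n; b \<in> I n\<rbrakk> \<Longrightarrow> a \<ominus> b \<in> I n"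
  by (auto simp: a_minus_def)

lemma V_ideal_finsum: "\<lbrakk>finite S; \<And>i. i \<in> S \<Longrightarrow> f i \<in> I n\<rbrakk> \<Longrightarrow> (\<Oplus>i\<in>S. f i) \<in> I n"
proof (induction S rule: finite_induct)
  case (insert i S)
  then have "f \<in> S \<rightarrow> carrier R" "f i \<in> carrier R"
    using V_ideal_in by blast+
  with insert show ?case by (simp add: finsum_insert)
qed simp

text \<open>For odd \<open>p\<close> the formula for \<open>\<delta> (V b)\<close> contains \<open>b\<close> and a power of it only. For \<open>p = 2\<close> it contains
  \<open>V (\<pi> (\<delta> b))\<close>, where the induction hypothesis and the additional \<open>V\<close> compensate for the step lost
  by \<open>\<delta>\<close>.\<close>

lemma delta_V_ideal: "a \<in> I (Suc n) \<Longrightarrow> \<delta> a \<in> I n"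
proof (induction n arbitrary: a)
  case (Suc n)
  then obtain b where b: "b \<in> I (Suc n)" "a = V b" by (auto simp: V_ideal_Suc[of "Suc n"])
  then have [simp]: "b \<in> carrier R" by (rule_tac V_ideal_in)
  show ?case
  proof (cases "p = 2")
    case True
    have "\<pi> \<otimes> \<delta> b \<in> I n"
      using Suc.IH[OF b(1)] by (simp add: I.I_l_closed)
    then show ?thesis
      using b True by (simp add: delta_V V_in_V_ideal)
  next
    case False
    have "V (b [^] p) \<in> I (Suc n)"
      using V_ideal_pow[OF b(1) p_pos] V_ideal_antimono_Suc V_in_V_ideal by blast
    then show ?thesis
      using b False by (simp add: delta_V V_ideal_minus V_ideal_add_pow)
  qed
qed (auto dest: V_ideal_in)

text \<open>This congruence makes \<open>\<delta>\<close> descend to maps from the quotient modulo \<open>V\<^sup>n\<^sup>+\<^sup>1\<close> to the quotient modulo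
  \<open>V\<^sup>n\<close>: every term of the addition polynomial of \<open>c = a - b\<close> and \<open>b\<close> is divisible by \<open>c\<close>.\<close>

lemma delta_cong:
  assumes "a \<in> carrier R" "b \<in> carrier R" "a \<ominus> b \<in> I (Suc n)"
  shows "\<delta> a \<ominus> \<delta> b \<in> I n"
proof -
  define c where "c = a \<ominus> b"
  have [simp]: "a \<in> carrier R" "b \<in> carrier R" "c \<in> carrier R"
    using assms by (auto simp: c_def)
  let ?S = "\<Oplus>i\<in>{1..p - 1}. [((p choose i) div p)] \<cdot> (c [^] i \<otimes> b [^] (p - i))"
  have c: "c \<in> I (Suc n)" using assms by (simp add: c_def)
  then have "c \<in> I n" using V_ideal_antimono_Suc by blast
  then have S: "?S \<in> I n"
    by (intro V_ideal_finsum V_ideal_add_pow I.I_r_closed V_ideal_pow) auto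
  have [simp]: "?S \<in> carrier R" using V_ideal_in[OF S] .
  have "a = c \<oplus> b" unfolding c_def by (simp add: a_minus_def a_assoc l_neg)
  then have "\<delta> a = \<delta> c \<oplus> \<delta> b \<ominus> ?S" by (simp add: delta_add)
  moreover have "u \<oplus> v \<ominus> w \<ominus> v = u \<ominus> w"
    if "u \<in> carrier R" "v \<in> carrier R" "w \<in> carrier R" for u v w
    using that by algebra
  ultimately have "\<delta> a \<ominus> \<delta> b = \<delta> c \<ominus> ?S"
    by simp
  then show ?thesis
    using delta_V_ideal[OF c] S by (simp add: V_ideal_minus)
qed

end

text \<open>If \<open>V a = 0\<close>, then \<open>p a = F (V a) = 0\<close>, so the second term of
  \<open>0 = \<delta> (V a) = a - p\<^sup>p\<^sup>-\<^sup>2 V (a\<^sup>p)\<close> vanishes as well, since \<open>p - 2 > 0\<close>.\<close>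

lemma (in delta_cartier_ring) cartier_ring:
  assumes p: "Factorial_Ring.prime p" and p2: "p > 2"
  shows "cartier_ring R p \<delta> V"
proof -
  interpret prime_delta_ring R p \<delta>
    by unfold_locales (rule p)
  interpret V: abelian_group_hom R R V
    by (intro abelian_group_homI_hom is_abelian_group V_additive)
  have one: "F (V \<one>) = [p] \<cdot> \<one>" by (simp add: frob_V)
  have "a = \<zero>" if a: "a \<in> carrier R" "V a = \<zero>" for a
  proof -
    have pa: "[p] \<cdot> a = \<zero>"
      using frob_V[of a] a by (simp add: frob_hom.hom_zero)
    have "[p] \<cdot> (a [^] p) = [p] \<cdot> a \<otimes> a [^] (p - 1)"
      using a p_pos nat_pow_Suc2[of a "p - 1"] by (simp add: add_pow_ldistr del: nat_pow_Suc)
    then have "[p] \<cdot> (a [^] p) = \<zero>" using a by (simp add: pa)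
    then have "[p] \<cdot> V (a [^] p) = \<zero>"
      using a V.hom_add_pow[of "a [^] p" p] by simp
    moreover have "p ^ (p - 2) = p * p ^ (p - 3)"
    proof -
      have "p - 2 = Suc (p - 3)" using p2 by simp
      then show ?thesis by simp
    qed
    ultimately have "[(p ^ (p - 2))] \<cdot> V (a [^] p) = \<zero>"
      using a by (simp add: add.nat_pow_pow[symmetric])
    then show ?thesis
      using delta_V[of a] a by (simp add: delta_zero a_minus_def)
  qed
  then have "inj_on V (carrier R)"
    by (rule V.inj_onI_kernel)
  then show ?thesis
  proof unfold_locales
    show "F (V a) = F (V \<one>) \<otimes> a" if "a \<in> carrier R" for a
      unfolding one using that by (simp add: frob_V add_pow_ldistr)
    show "F (F (V \<one>)) = [p] \<cdot> \<one>"
      unfolding one by simp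
    show "\<delta> (V a) = (if p = 2 then \<ominus> a \<oplus> V (F (V \<one>) \<otimes> \<delta> a) else a \<ominus> [(p ^ (p - 2))] \<cdot> V (a [^] p))"
      if "a \<in> carrier R" for a
      using p2 delta_V[OF that] by simp
  qed (rule V_additive V_linear, assumption?)+
qed

text \<open>Injectivity of \<open>V\<close> takes more steps here. Let \<open>t = \<pi>\<close>, so \<open>t\<^sup>2 = 4\<close>, \<open>F t = 4 - 2 = 2\<close>, and \<open>t\<close> acts as
  \<open>2\<close> on the image of \<open>V\<close>. If \<open>V a = 0\<close>, then \<open>t a = 0\<close> and \<open>a = V (t (\<delta> a))\<close>; hence \<open>2 a = t a = 0\<close>.
  Whenever \<open>2 b = 0\<close>, the formula for \<open>\<delta> (b + b)\<close> gives \<open>2 \<delta> b = b\<^sup>2\<close>, and then \<open>\<delta> (t b) = 0\<close>. For \<open>b = a\<close>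
  this yields \<open>F a = 2 a\<^sup>2 = 0\<close>, so \<open>a\<^sup>2 = a V (t (\<delta> a)) = 0\<close> and \<open>2 \<delta> a = 0\<close>; for \<open>b = \<delta> a\<close> it yields
  \<open>\<delta> (t (\<delta> a)) = 0\<close>. Applying \<open>\<delta>\<close> to \<open>a = V (t (\<delta> a))\<close> now gives \<open>\<delta> a = - t (\<delta> a)\<close>, so
  \<open>t (\<delta> a) = - 4 \<delta> a = 0\<close> and \<open>a = 0\<close>.\<close>

lemma (in delta_tilde_cartier_ring) cartier_ring: "cartier_ring R 2 \<delta> V"
proof -
  interpret prime_delta_ring R 2 \<delta>
    by unfold_locales simp
  interpret V: abelian_group_hom R R V
    by (intro abelian_group_homI_hom is_abelian_group V_additive)
  define t where "t = tilde_two R \<delta> V"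
  have t: "t = F (V \<one>)" by (simp add: t_def tilde_two_def)
  have [simp]: "t \<in> carrier R" by (simp add: t)
  have tt: "t \<otimes> t = [(4::nat)] \<cdot> \<one>"
    using tilde_two_sq by (simp add: t_def[symmetric] nat_pow_two)
  have Ft: "F t = [(2::nat)] \<cdot> \<one>"
  proof -
    have "F t \<oplus> [(2::nat)] \<cdot> \<one> = [(4::nat)] \<cdot> \<one>"
      using tilde_two_sq delta_tilde_two
      by (simp add: frob_def t_def[symmetric] add.nat_pow_inv a_assoc l_neg)
    also have "\<dots> = [(2::nat)] \<cdot> \<one> \<oplus> [(2::nat)] \<cdot> \<one>"
      by (simp add: add.nat_pow_mult)
    finally show ?thesis by simp
  qed
  have tV: "t \<otimes> V b = V ([(2::nat)] \<cdot> b)" if "b \<in> carrier R" for b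
    using that by (simp add: V_linear Ft add_pow_ldistr)
  have two: "[(2::nat)] \<cdot> \<delta> b = b [^] (2::nat)" if b: "b \<in> carrier R" "[(2::nat)] \<cdot> b = \<zero>" for b
  proof -
    have "\<delta> (b \<oplus> b) = \<zero>"
      using b by (simp add: add_pow_two delta_zero)
    moreover have "{1..2 - 1} = {1::nat}" by auto
    ultimately have "\<delta> b \<oplus> \<delta> b \<ominus> b [^] (2::nat) = \<zero>"
      using b by (simp add: delta_add finsum_insert nat_pow_two)
    then have "\<delta> b \<oplus> \<delta> b = b [^] (2::nat)"
      by (rule minus_eq_zeroD) (use b in auto)
    then show ?thesis
      using b by (simp add: add_pow_two)
  qed
  have delta_t: "\<delta> (t \<otimes> b) = \<zero>" if b: "b \<in> carrier R" "[(2::nat)] \<cdot> b = \<zero>" for b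
  proof -
    have "\<delta> (t \<otimes> b) = [(4::nat)] \<cdot> \<delta> b \<oplus> \<ominus> (b [^] (2::nat)) \<oplus> \<ominus> ([(2::nat)] \<cdot> \<delta> b)"
    proof -
      have "\<delta> (t \<otimes> b) = t [^] (2::nat) \<otimes> \<delta> b \<oplus> b [^] (2::nat) \<otimes> \<delta> t \<oplus> [(2::nat)] \<cdot> (\<delta> t \<otimes> \<delta> b)"
        using b by (intro delta_mult) auto
      also have "t [^] (2::nat) \<otimes> \<delta> b = [(4::nat)] \<cdot> \<delta> b"
        using b tilde_two_sq by (simp add: t_def add_pow_ldistr)
      also have "b [^] (2::nat) \<otimes> \<delta> t = \<ominus> (b [^] (2::nat))"
        using b delta_tilde_two by (simp add: t_def r_minus)
      also have "[(2::nat)] \<cdot> (\<delta> t \<otimes> \<delta> b) = \<ominus> ([(2::nat)] \<cdot> \<delta> b)"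
        using b delta_tilde_two by (simp add: t_def l_minus add.nat_pow_inv)
      finally show ?thesis .
    qed
    moreover have "[(4::nat)] \<cdot> \<delta> b = [(2::nat)] \<cdot> \<delta> b \<oplus> [(2::nat)] \<cdot> \<delta> b"
      using b by (simp add: add.nat_pow_mult)
    ultimately show ?thesis
      using b two[OF b] by (simp add: a_assoc r_neg)
  qed
  have "a = \<zero>" if a: "a \<in> carrier R" "V a = \<zero>" for a
  proof -
    have ta: "t \<otimes> a = \<zero>"
      using frob_V[of a] a by (simp add: t_def[symmetric])
    have aV: "a = V (t \<otimes> \<delta> a)"
    proof -
      have "\<ominus> a \<oplus> V (t \<otimes> \<delta> a) = \<zero>"
        using delta_V[of a] a by (simp add: delta_zero t_def)
      then have "V (t \<otimes> \<delta> a) \<ominus> a = \<zero>"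
        using a by (simp add: a_minus_def a_comm[of _ "\<ominus> a"])
      then have "V (t \<otimes> \<delta> a) = a"
        by (rule minus_eq_zeroD) (use a in auto)
      then show ?thesis ..
    qed
    have a2: "[(2::nat)] \<cdot> a = \<zero>"
    proof -
      have "t \<otimes> a = [(2::nat)] \<cdot> a"
        using a tV[of "t \<otimes> \<delta> a"] by (simp add: V.hom_add_pow aV[symmetric])
      then show ?thesis using ta by simp
    qed
    have "a \<otimes> a = \<zero>"
    proof -
      have "F a = [(2::nat)] \<cdot> (a [^] (2::nat))"
        using a two[OF a(1) a2] by (simp add: frob_def add_pow_two)
      also have "\<dots> = [(2::nat)] \<cdot> a \<otimes> a"
        using a by (simp add: nat_pow_two add_pow_ldistr)
      finally have "F a = \<zero>" using a a2 by simp
      have "a \<otimes> V (t \<otimes> \<delta> a) = V (F a \<otimes> (t \<otimes> \<delta> a))"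
        using a by (intro V_linear) auto
      then show ?thesis using \<open>F a = \<zero>\<close> a by (simp add: aV[symmetric])
    qed
    then have "[(2::nat)] \<cdot> \<delta> a = \<zero>"
      using two[OF a(1) a2] a by (simp add: nat_pow_two)
    then have "\<delta> (t \<otimes> \<delta> a) = \<zero>" using a by (simp add: delta_t)
    then have "\<delta> a = \<ominus> (t \<otimes> \<delta> a)"
      using delta_V[of "t \<otimes> \<delta> a"] a by (simp add: t_def[symmetric] aV[symmetric])
    then have "t \<otimes> \<delta> a = \<ominus> (t \<otimes> (t \<otimes> \<delta> a))"
      using a by (metis \<open>t \<in> carrier R\<close> delta_in m_closed r_minus)
    also have "t \<otimes> (t \<otimes> \<delta> a) = [(2::nat)] \<cdot> ([(2::nat)] \<cdot> \<delta> a)"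
      using a by (simp add: m_assoc[symmetric] tt add_pow_ldistr add.nat_pow_pow)
    also have "\<dots> = \<zero>" using \<open>[(2::nat)] \<cdot> \<delta> a = \<zero>\<close> by simp
    finally show ?thesis using aV by simp
  qed
  then have "inj_on V (carrier R)"
    by (rule V.inj_onI_kernel)
  then show ?thesis
  proof unfold_locales
    show "F (V a) = F (V \<one>) \<otimes> a" if "a \<in> carrier R" for a
      using frob_V[OF that] unfolding t_def[symmetric] t .
    show "F (F (V \<one>)) = [(2::nat)] \<cdot> \<one>"
      using Ft unfolding t .
    show "\<delta> (V a) = (if (2::nat) = 2 then \<ominus> a \<oplus> V (F (V \<one>) \<otimes> \<delta> a) else a \<ominus> [((2::nat) ^ (2 - 2))] \<cdot> V (a [^] (2::nat)))"
      if "a \<in> carrier R" for a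
      using delta_V[OF that] unfolding t_def[symmetric] t by simp
  qed (rule V_additive V_linear, assumption?)+
qed

section \<open>The completion\<close>

context cartier_ring
begin

abbreviation Rh where "Rh \<equiv> completion R V"
abbreviation dh where "dh \<equiv> completion_delta R V \<delta>"
abbreviation Vh where "Vh \<equiv> completion_V R V"
abbreviation \<iota> where "\<iota> \<equiv> completion_map R V"

text \<open>Identities in the completion are checked one component at a time on common representatives. The
  representative may have to be taken at a higher level than the component, because \<open>\<delta>\<close> loses
  one level and a representative at level \<open>n + 1\<close> is also one at level \<open>n\<close>.\<close>

definition rep :: "(nat \<Rightarrow> 'a set) \<Rightarrow> nat \<Rightarrow> 'a \<Rightarrow> bool" where
  "rep x n a \<longleftrightarrow> a \<in> carrier R \<and> x n = I n +> a"

lemma coset_eq_iff: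
  assumes "a \<in> carrier R" "b \<in> carrier R"
  shows "I n +> a = I n +> b \<longleftrightarrow> a \<ominus> b \<in> I n"
proof -
  have "I n +> a = I n +> b \<longleftrightarrow> a \<in> I n +> b"
    using assms I.a_repr_independence' I.a_rcos_self by metis
  also have "\<dots> \<longleftrightarrow> a \<ominus> b \<in> I n"
    using assms I.a_rcos_module_minus[OF ring_axioms] by blast
  finally show ?thesis .
qed

lemma rep_carrier: "rep x n a \<Longrightarrow> a \<in> carrier R"
  by (simp add: rep_def)

lemma rep_unique: "\<lbrakk>rep x n a; rep x n b\<rbrakk> \<Longrightarrow> a \<ominus> b \<in> I n"
  using coset_eq_iff by (auto simp: rep_def)

lemma rep_cong: "\<lbrakk>rep x n a; b \<in> carrier R; b \<ominus> a \<in> I n\<rbrakk> \<Longrightarrow> rep x n b"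
  using coset_eq_iff[of b a n] by (auto simp: rep_def)

lemma rep_mem_iff: "rep x n a \<Longrightarrow> b \<in> x n \<longleftrightarrow> rep x n b"
  unfolding rep_def using I.a_elemrcos_carrier I.a_rcos_self I.a_repr_independence' by metis

lemma completion_eqI: "(\<And>n. \<exists>a. rep x n a \<and> rep y n a) \<Longrightarrow> x = y"
  by (rule ext) (metis rep_def)

lemma coset_Suc_subset: "I (Suc n) +> a \<subseteq> I n +> a"
  using V_ideal_antimono_Suc[of n] by (auto simp: a_r_coset_def')

lemma completion_carrier_iff:
  "x \<in> carrier Rh \<longleftrightarrow> (\<forall>n. \<exists>a. rep x n a \<and> rep x (Suc n) a)"
proof
  assume x: "x \<in> carrier Rh"
  then have ex: "\<exists>a. rep x n a" for n
    by (simp add: completion_def FactRing_def A_RCOSETS_def' rep_def Bex_def)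
  show "\<forall>n. \<exists>a. rep x n a \<and> rep x (Suc n) a"
  proof
    fix n
    obtain a b where ab: "rep x (Suc n) a" "rep x n b" using ex by metis
    have "x (Suc n) \<subseteq> x n" using x by (simp add: completion_def)
    then have "a \<in> x n" using ab(1) rep_mem_iff by blast
    then show "\<exists>a. rep x n a \<and> rep x (Suc n) a"
      using ab rep_mem_iff by blast
  qed
next
  assume *: "\<forall>n. \<exists>a. rep x n a \<and> rep x (Suc n) a"
  have "x n \<in> carrier (R Quot I n)" for n
    using *[rule_format, of n] by (auto simp: FactRing_def A_RCOSETS_def' rep_def)
  moreover have "x (Suc n) \<subseteq> x n" for n
    using *[rule_format, of n] coset_Suc_subset[of n] by (auto simp: rep_def)
  ultimately show "x \<in> carrier Rh"
    by (simp add: completion_def)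
qed

lemma rep_ex:
  assumes "x \<in> carrier Rh" obtains a where "rep x n a"
  using assms completion_carrier_iff by blast

lemma rep_down:
  assumes a: "rep x (Suc n) a" and x: "x \<in> carrier Rh"
  shows "rep x n a"
proof -
  obtain b where b: "rep x n b" "rep x (Suc n) b"
    using x completion_carrier_iff by blast
  have "a \<ominus> b \<in> I n"
    using rep_unique[OF a b(2)] V_ideal_antimono_Suc[of n] by blast
  then show ?thesis
    by (rule rep_cong[OF b(1) rep_carrier[OF a]])
qed

lemma completionI: "(\<And>n. \<exists>a. rep x n a \<and> rep x (Suc n) a) \<Longrightarrow> x \<in> carrier Rh"
  using completion_carrier_iff by blast

lemma rep_zero: "rep \<zero>\<^bsub>Rh\<^esub> n \<zero>"
  by (simp add: rep_def completion_def FactRing_def I.a_rcos_const)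

lemma rep_one: "rep \<one>\<^bsub>Rh\<^esub> n \<one>"
  by (simp add: rep_def completion_def FactRing_def)

lemma rep_add: "\<lbrakk>rep x n a; rep y n b\<rbrakk> \<Longrightarrow> rep (x \<oplus>\<^bsub>Rh\<^esub> y) n (a \<oplus> b)"
  by (simp add: rep_def completion_def FactRing_def I.a_rcos_sum)

lemma rep_mult: "\<lbrakk>rep x n a; rep y n b\<rbrakk> \<Longrightarrow> rep (x \<otimes>\<^bsub>Rh\<^esub> y) n (a \<otimes> b)"
  by (simp add: rep_def completion_def FactRing_def I.rcoset_mult_add)

lemma rep_iota: "a \<in> carrier R \<Longrightarrow> rep (\<iota> a) n a"
  by (simp add: rep_def completion_map_def)

text \<open>The maps on the completion are unions over all representatives of a component. When the map on
  representatives respects the ideals, one representative determines the union.\<close>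

lemma rep_UN:
  assumes "rep x k a" "f a \<in> carrier R"
    and "\<And>b. rep x k b \<Longrightarrow> f b \<in> carrier R \<and> f b \<ominus> f a \<in> I n"
    and "y n = (\<Union>b\<in>x k. I n +> f b)"
  shows "rep y n (f a)"
proof -
  have "I n +> f b = I n +> f a" if "b \<in> x k" for b
    using assms(2,3) that rep_mem_iff[OF assms(1)] coset_eq_iff by blast
  moreover have "a \<in> x k" using assms(1) rep_mem_iff by blast
  ultimately have "y n = I n +> f a" unfolding assms(4) by blast
  then show ?thesis using assms(2) by (simp add: rep_def)
qed

lemma rep_delta: "rep x (Suc n) a \<Longrightarrow> rep (dh x) n (\<delta> a)"
  by (rule rep_UN[of x "Suc n" a \<delta>])
     (auto simp: completion_delta_def intro: rep_unique delta_cong dest: rep_carrier)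

lemma V_cong: "\<lbrakk>rep x n a; rep x n b\<rbrakk> \<Longrightarrow> V a \<ominus> V b \<in> I (Suc n)"
  using V_in_V_ideal[OF rep_unique[of x n a b]] by (simp add: V.hom_minus rep_carrier)

lemma rep_V:
  assumes a: "rep x n a"
  shows "rep (Vh x) n (V a)"
proof (rule rep_UN[of x n a V])
  fix b assume b: "rep x n b"
  then show "V b \<in> carrier R \<and> V b \<ominus> V a \<in> I n"
    using V_cong[OF b a] V_ideal_antimono_Suc[of n] rep_carrier[OF b] by auto
qed (use a rep_carrier[OF a] in \<open>simp_all add: completion_V_def\<close>)

lemma rep_V_Suc:
  assumes x: "x \<in> carrier Rh" and a: "rep x n a"
  shows "rep (Vh x) (Suc n) (V a)"
proof -
  obtain b where b: "rep x (Suc n) b" using rep_ex x by blast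
  show ?thesis
    using rep_cong[OF rep_V[OF b] _ V_cong[OF a rep_down[OF b x]]] rep_carrier[OF a] by simp
qed

lemma completion_closed:
  assumes x: "x \<in> carrier Rh" and y: "y \<in> carrier Rh"
  shows "x \<oplus>\<^bsub>Rh\<^esub> y \<in> carrier Rh" "x \<otimes>\<^bsub>Rh\<^esub> y \<in> carrier Rh"
    "dh x \<in> carrier Rh" "Vh x \<in> carrier Rh"
proof -
  have "\<exists>c. rep (x \<oplus>\<^bsub>Rh\<^esub> y) n c \<and> rep (x \<oplus>\<^bsub>Rh\<^esub> y) (Suc n) c"
    "\<exists>c. rep (x \<otimes>\<^bsub>Rh\<^esub> y) n c \<and> rep (x \<otimes>\<^bsub>Rh\<^esub> y) (Suc n) c"
    "\<exists>c. rep (Vh x) n c \<and> rep (Vh x) (Suc n) c"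
    "\<exists>c. rep (dh x) n c \<and> rep (dh x) (Suc n) c" for n
  proof -
    obtain a b c where abc: "rep x (Suc n) a" "rep y (Suc n) b" "rep x (Suc (Suc n)) c"
      using rep_ex x y by metis
    note abc' = abc(1)[THEN rep_down, OF x] abc(2)[THEN rep_down, OF y] abc(3)[THEN rep_down, OF x]
    show "\<exists>c. rep (x \<oplus>\<^bsub>Rh\<^esub> y) n c \<and> rep (x \<oplus>\<^bsub>Rh\<^esub> y) (Suc n) c"
      using rep_add[OF abc(1,2)] rep_add[OF abc'(1,2)] by blast
    show "\<exists>c. rep (x \<otimes>\<^bsub>Rh\<^esub> y) n c \<and> rep (x \<otimes>\<^bsub>Rh\<^esub> y) (Suc n) c"
      using rep_mult[OF abc(1,2)] rep_mult[OF abc'(1,2)] by blast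
    show "\<exists>c. rep (Vh x) n c \<and> rep (Vh x) (Suc n) c"
      using rep_V[OF abc(1)] rep_V[OF abc'(1)] by blast
    show "\<exists>c. rep (dh x) n c \<and> rep (dh x) (Suc n) c"
      using rep_delta[OF abc(3)] rep_delta[OF abc'(3)] by blast
  qed
  then show "x \<oplus>\<^bsub>Rh\<^esub> y \<in> carrier Rh" "x \<otimes>\<^bsub>Rh\<^esub> y \<in> carrier Rh"
    "dh x \<in> carrier Rh" "Vh x \<in> carrier Rh"
    by (auto intro: completionI)
qed

lemma iota_closed: "a \<in> carrier R \<Longrightarrow> \<iota> a \<in> carrier Rh"
  by (rule completionI) (blast intro: rep_iota)

lemma completion_cring: "cring Rh"
proof (rule cringI)
  show "abelian_group Rh"
  proof (rule abelian_groupI)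
    show "\<zero>\<^bsub>Rh\<^esub> \<in> carrier Rh" by (rule completionI) (blast intro: rep_zero)
    fix x assume x: "x \<in> carrier Rh"
    show "\<zero>\<^bsub>Rh\<^esub> \<oplus>\<^bsub>Rh\<^esub> x = x"
    proof (rule completion_eqI)
      fix n obtain a where a: "rep x n a" using rep_ex x by blast
      show "\<exists>c. rep (\<zero>\<^bsub>Rh\<^esub> \<oplus>\<^bsub>Rh\<^esub> x) n c \<and> rep x n c"
        using rep_add[OF rep_zero a] a rep_carrier[OF a] by auto
    qed
    \<comment> \<open>The product with \<open>\<iota> (- 1)\<close> is a negative in the completion without choosing
      representatives.\<close>
    show "\<exists>y\<in>carrier Rh. y \<oplus>\<^bsub>Rh\<^esub> x = \<zero>\<^bsub>Rh\<^esub>"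
    proof (rule bexI[of _ "\<iota> (\<ominus> \<one>) \<otimes>\<^bsub>Rh\<^esub> x"])
      show "\<iota> (\<ominus> \<one>) \<otimes>\<^bsub>Rh\<^esub> x \<in> carrier Rh"
        by (simp add: completion_closed iota_closed x)
      show "\<iota> (\<ominus> \<one>) \<otimes>\<^bsub>Rh\<^esub> x \<oplus>\<^bsub>Rh\<^esub> x = \<zero>\<^bsub>Rh\<^esub>"
      proof (rule completion_eqI)
        fix n obtain a where a: "rep x n a" using rep_ex x by blast
        have "rep (\<iota> (\<ominus> \<one>) \<otimes>\<^bsub>Rh\<^esub> x \<oplus>\<^bsub>Rh\<^esub> x) n (\<ominus> \<one> \<otimes> a \<oplus> a)"
          by (intro rep_add rep_mult rep_iota a) auto
        then show "\<exists>c. rep (\<iota> (\<ominus> \<one>) \<otimes>\<^bsub>Rh\<^esub> x \<oplus>\<^bsub>Rh\<^esub> x) n c \<and> rep \<zero>\<^bsub>Rh\<^esub> n c"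
          using rep_carrier[OF a] rep_zero by (auto simp: l_minus l_neg)
      qed
    qed
    fix y assume y: "y \<in> carrier Rh"
    show "x \<oplus>\<^bsub>Rh\<^esub> y \<in> carrier Rh" using x y by (rule completion_closed)
    show "x \<oplus>\<^bsub>Rh\<^esub> y = y \<oplus>\<^bsub>Rh\<^esub> x"
    proof (rule completion_eqI)
      fix n obtain a b where ab: "rep x n a" "rep y n b" using rep_ex x y by metis
      show "\<exists>c. rep (x \<oplus>\<^bsub>Rh\<^esub> y) n c \<and> rep (y \<oplus>\<^bsub>Rh\<^esub> x) n c"
        using rep_add[OF ab] rep_add[OF ab(2,1)] rep_carrier[OF ab(1)] rep_carrier[OF ab(2)]
        by (auto simp: a_comm)
    qed
    fix z assume z: "z \<in> carrier Rh"
    show "x \<oplus>\<^bsub>Rh\<^esub> y \<oplus>\<^bsub>Rh\<^esub> z = x \<oplus>\<^bsub>Rh\<^esub> (y \<oplus>\<^bsub>Rh\<^esub> z)"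
    proof (rule completion_eqI)
      fix n obtain a b c where abc: "rep x n a" "rep y n b" "rep z n c" using rep_ex x y z by metis
      show "\<exists>c. rep (x \<oplus>\<^bsub>Rh\<^esub> y \<oplus>\<^bsub>Rh\<^esub> z) n c \<and> rep (x \<oplus>\<^bsub>Rh\<^esub> (y \<oplus>\<^bsub>Rh\<^esub> z)) n c"
        using rep_add[OF rep_add[OF abc(1,2)] abc(3)] rep_add[OF abc(1) rep_add[OF abc(2,3)]]
          abc[THEN rep_carrier]
        by (auto simp: a_assoc)
    qed
  qed
  show "comm_monoid Rh"
  proof (rule comm_monoidI)
    show "\<one>\<^bsub>Rh\<^esub> \<in> carrier Rh" by (rule completionI) (blast intro: rep_one)
    fix x assume x: "x \<in> carrier Rh"
    show "\<one>\<^bsub>Rh\<^esub> \<otimes>\<^bsub>Rh\<^esub> x = x"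
    proof (rule completion_eqI)
      fix n obtain a where a: "rep x n a" using rep_ex x by blast
      show "\<exists>c. rep (\<one>\<^bsub>Rh\<^esub> \<otimes>\<^bsub>Rh\<^esub> x) n c \<and> rep x n c"
        using rep_mult[OF rep_one a] a rep_carrier[OF a] by auto
    qed
    fix y assume y: "y \<in> carrier Rh"
    show "x \<otimes>\<^bsub>Rh\<^esub> y \<in> carrier Rh" using x y by (rule completion_closed)
    show "x \<otimes>\<^bsub>Rh\<^esub> y = y \<otimes>\<^bsub>Rh\<^esub> x"
    proof (rule completion_eqI)
      fix n obtain a b where ab: "rep x n a" "rep y n b" using rep_ex x y by metis
      show "\<exists>c. rep (x \<otimes>\<^bsub>Rh\<^esub> y) n c \<and> rep (y \<otimes>\<^bsub>Rh\<^esub> x) n c"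
        using rep_mult[OF ab] rep_mult[OF ab(2,1)] rep_carrier[OF ab(1)] rep_carrier[OF ab(2)]
        by (auto simp: m_comm)
    qed
    fix z assume z: "z \<in> carrier Rh"
    show "x \<otimes>\<^bsub>Rh\<^esub> y \<otimes>\<^bsub>Rh\<^esub> z = x \<otimes>\<^bsub>Rh\<^esub> (y \<otimes>\<^bsub>Rh\<^esub> z)"
    proof (rule completion_eqI)
      fix n obtain a b c where abc: "rep x n a" "rep y n b" "rep z n c" using rep_ex x y z by metis
      show "\<exists>c. rep (x \<otimes>\<^bsub>Rh\<^esub> y \<otimes>\<^bsub>Rh\<^esub> z) n c \<and> rep (x \<otimes>\<^bsub>Rh\<^esub> (y \<otimes>\<^bsub>Rh\<^esub> z)) n c"
        using rep_mult[OF rep_mult[OF abc(1,2)] abc(3)] rep_mult[OF abc(1) rep_mult[OF abc(2,3)]]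
          abc[THEN rep_carrier]
        by (auto simp: m_assoc)
    qed
  qed
  fix x y z assume xyz: "x \<in> carrier Rh" "y \<in> carrier Rh" "z \<in> carrier Rh"
  show "(x \<oplus>\<^bsub>Rh\<^esub> y) \<otimes>\<^bsub>Rh\<^esub> z = x \<otimes>\<^bsub>Rh\<^esub> z \<oplus>\<^bsub>Rh\<^esub> y \<otimes>\<^bsub>Rh\<^esub> z"
  proof (rule completion_eqI)
    fix n obtain a b c where abc: "rep x n a" "rep y n b" "rep z n c" using rep_ex xyz by metis
    show "\<exists>c. rep ((x \<oplus>\<^bsub>Rh\<^esub> y) \<otimes>\<^bsub>Rh\<^esub> z) n c \<and> rep (x \<otimes>\<^bsub>Rh\<^esub> z \<oplus>\<^bsub>Rh\<^esub> y \<otimes>\<^bsub>Rh\<^esub> z) n c"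
      using rep_mult[OF rep_add[OF abc(1,2)] abc(3)] rep_add[OF rep_mult[OF abc(1,3)] rep_mult[OF abc(2,3)]]
        abc[THEN rep_carrier]
      by (auto simp: l_distr)
  qed
qed

sublocale Rh: cring Rh
  by (rule completion_cring)

lemma completion_delta_closed [simp, intro]: "x \<in> carrier Rh \<Longrightarrow> dh x \<in> carrier Rh"
  by (rule completion_closed)

lemma completion_V_closed [simp, intro]: "x \<in> carrier Rh \<Longrightarrow> Vh x \<in> carrier Rh"
  by (rule completion_closed)

lemma iota_hom: "\<iota> \<in> ring_hom R Rh"
proof (rule ring_hom_memI)
  show "\<iota> \<one> = \<one>\<^bsub>Rh\<^esub>"
    by (rule completion_eqI) (blast intro: rep_iota rep_one)
  fix x y assume "x \<in> carrier R" "y \<in> carrier R"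
  then show "\<iota> (x \<otimes> y) = \<iota> x \<otimes>\<^bsub>Rh\<^esub> \<iota> y" "\<iota> (x \<oplus> y) = \<iota> x \<oplus>\<^bsub>Rh\<^esub> \<iota> y"
    by (rule_tac completion_eqI; blast intro: rep_iota rep_add rep_mult)+
qed (rule iota_closed)

sublocale iota: ring_hom_cring R Rh \<iota>
  by unfold_locales (rule iota_hom)

lemma iota_V: "a \<in> carrier R \<Longrightarrow> \<iota> (V a) = Vh (\<iota> a)"
  by (rule completion_eqI) (blast intro: rep_iota rep_V V.hom_closed)

lemma iota_delta: "a \<in> carrier R \<Longrightarrow> \<iota> (\<delta> a) = dh (\<iota> a)"
  by (rule completion_eqI) (blast intro: rep_iota rep_delta delta_in)

lemma rep_pow: "rep x n a \<Longrightarrow> rep (x [^]\<^bsub>Rh\<^esub> (k::nat)) n (a [^] k)"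
  by (induction k) (auto intro: rep_one rep_mult)

lemma rep_add_pow: "rep x n a \<Longrightarrow> rep ([(k::nat)] \<cdot>\<^bsub>Rh\<^esub> x) n ([k] \<cdot> a)"
  by (induction k) (auto simp: Rh.add.nat_pow_Suc add.nat_pow_Suc intro: rep_zero rep_add)

lemma rep_inv:
  assumes x: "x \<in> carrier Rh" and a: "rep x n a"
  shows "rep (\<ominus>\<^bsub>Rh\<^esub> x) n (\<ominus> a)"
proof -
  obtain b where b: "rep (\<ominus>\<^bsub>Rh\<^esub> x) n b"
    using rep_ex Rh.a_inv_closed[OF x] by blast
  have c: "a \<in> carrier R" "b \<in> carrier R" using a b rep_carrier by auto
  have "rep \<zero>\<^bsub>Rh\<^esub> n (a \<oplus> b)"
    using rep_add[OF a b] x by (simp add: Rh.r_neg)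
  then have "\<zero> \<ominus> (a \<oplus> b) \<in> I n"
    by (rule rep_unique[OF rep_zero])
  moreover have "\<zero> \<ominus> (a \<oplus> b) = \<ominus> a \<ominus> b"
    using c by (simp add: a_minus_def minus_add)
  ultimately show ?thesis
    using c rep_cong[OF b, of "\<ominus> a"] by simp
qed

lemma rep_minus:
  "\<lbrakk>rep x n a; rep y n b; y \<in> carrier Rh\<rbrakk> \<Longrightarrow> rep (x \<ominus>\<^bsub>Rh\<^esub> y) n (a \<ominus> b)"
  by (simp add: a_minus_def rep_add rep_inv)

lemma rep_finsum:
  assumes "finite S" "\<And>i. i \<in> S \<Longrightarrow> f i \<in> carrier Rh" "\<And>i. i \<in> S \<Longrightarrow> rep (f i) n (g i)"
  shows "rep (\<Oplus>\<^bsub>Rh\<^esub>i\<in>S. f i) n (\<Oplus>i\<in>S. g i)"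
  using assms
proof (induction S rule: finite_induct)
  case (insert i S)
  then have "g \<in> S \<rightarrow> carrier R" "g i \<in> carrier R"
    using rep_carrier by blast+
  with insert show ?case
    by (simp add: Rh.finsum_insert finsum_insert Pi_def rep_add)
qed (simp add: rep_zero)

lemma completion_delta_ring: "prime_delta_ring Rh p dh"
proof unfold_locales
  show "dh \<in> carrier Rh \<rightarrow> carrier Rh" by auto
  show "dh \<zero>\<^bsub>Rh\<^esub> = \<zero>\<^bsub>Rh\<^esub>"
    by (rule completion_eqI) (metis rep_zero rep_delta delta_zero)
  show "dh \<one>\<^bsub>Rh\<^esub> = \<zero>\<^bsub>Rh\<^esub>"
    by (rule completion_eqI) (metis rep_zero rep_one rep_delta delta_one)
  fix x y assume x: "x \<in> carrier Rh" and y: "y \<in> carrier Rh"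
  show "dh (x \<oplus>\<^bsub>Rh\<^esub> y) = dh x \<oplus>\<^bsub>Rh\<^esub> dh y \<ominus>\<^bsub>Rh\<^esub>
    (\<Oplus>\<^bsub>Rh\<^esub>i\<in>{1..p - 1}. [((p choose i) div p)] \<cdot>\<^bsub>Rh\<^esub> (x [^]\<^bsub>Rh\<^esub> i \<otimes>\<^bsub>Rh\<^esub> y [^]\<^bsub>Rh\<^esub> (p - i)))" (is "?l = ?r")
  proof (rule completion_eqI)
    fix n obtain a b where ab: "rep x (Suc n) a" "rep y (Suc n) b" using rep_ex x y by metis
    note ab' = ab(1)[THEN rep_down, OF x] ab(2)[THEN rep_down, OF y]
    have "rep ?l n (\<delta> (a \<oplus> b))"
      by (intro rep_delta rep_add ab)
    moreover have "rep ?r n (\<delta> a \<oplus> \<delta> b \<ominus>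
        (\<Oplus>i\<in>{1..p - 1}. [((p choose i) div p)] \<cdot> (a [^] i \<otimes> b [^] (p - i))))"
      using x y by (intro rep_minus rep_finsum rep_add rep_delta ab rep_add_pow rep_mult rep_pow ab'
          Rh.finsum_closed) auto
    ultimately show "\<exists>c. rep ?l n c \<and> rep ?r n c"
      using ab[THEN rep_carrier] by (auto simp: delta_add)
  qed
  show "dh (x \<otimes>\<^bsub>Rh\<^esub> y) = x [^]\<^bsub>Rh\<^esub> p \<otimes>\<^bsub>Rh\<^esub> dh y \<oplus>\<^bsub>Rh\<^esub> y [^]\<^bsub>Rh\<^esub> p \<otimes>\<^bsub>Rh\<^esub> dh x \<oplus>\<^bsub>Rh\<^esub>
      [p] \<cdot>\<^bsub>Rh\<^esub> (dh x \<otimes>\<^bsub>Rh\<^esub> dh y)" (is "?l = ?r")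
  proof (rule completion_eqI)
    fix n obtain a b where ab: "rep x (Suc n) a" "rep y (Suc n) b" using rep_ex x y by metis
    note ab' = ab(1)[THEN rep_down, OF x] ab(2)[THEN rep_down, OF y]
    have "rep ?l n (\<delta> (a \<otimes> b))"
      by (intro rep_delta rep_mult ab)
    moreover have "rep ?r n (a [^] p \<otimes> \<delta> b \<oplus> b [^] p \<otimes> \<delta> a \<oplus> [p] \<cdot> (\<delta> a \<otimes> \<delta> b))"
      by (intro rep_add rep_delta ab rep_add_pow rep_mult rep_pow ab')
    ultimately show "\<exists>c. rep ?l n c \<and> rep ?r n c"
      using ab[THEN rep_carrier] by (auto simp: delta_mult)
  qed
qed (rule prime_p)

sublocale Rh: prime_delta_ring Rh p dh
  by (rule completion_delta_ring)

lemma rep_frob: "\<lbrakk>rep x (Suc n) a; x \<in> carrier Rh\<rbrakk> \<Longrightarrow> rep (Rh.F x) n (F a)"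
  unfolding frob_def by (intro rep_add rep_pow rep_add_pow rep_delta) (auto intro: rep_down)

lemma iota_frob: "a \<in> carrier R \<Longrightarrow> \<iota> (F a) = Rh.F (\<iota> a)"
  by (rule completion_eqI) (meson rep_iota rep_frob iota_closed frob_in)

lemma iota_pi: "Rh.F (Vh \<one>\<^bsub>Rh\<^esub>) = \<iota> \<pi>"
  by (simp add: iota_frob iota_V)

lemma completion_V_inj: "inj_on Vh (carrier Rh)"
proof (rule inj_onI)
  fix x y assume xy: "x \<in> carrier Rh" "y \<in> carrier Rh" "Vh x = Vh y"
  show "x = y"
  proof (rule completion_eqI)
    fix n obtain a b where ab: "rep x n a" "rep y n b" using rep_ex xy by metis
    have "rep (Vh y) (Suc n) (V a)" "rep (Vh y) (Suc n) (V b)"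
      using rep_V_Suc[OF xy(1) ab(1)] rep_V_Suc[OF xy(2) ab(2)] xy(3) by auto
    then have "V a \<ominus> V b \<in> I (Suc n)" by (rule rep_unique)
    then have "a \<ominus> b \<in> I n"
      using ab[THEN rep_carrier] by (rule_tac V_in_V_idealD) (auto simp: V.hom_minus)
    then have "rep y n a" using rep_cong ab rep_carrier by blast
    then show "\<exists>c. rep x n c \<and> rep y n c" using ab by blast
  qed
qed

lemma completion_cartier: "cartier_ring Rh p dh Vh"
proof unfold_locales
  show "Vh \<in> hom (add_monoid Rh) (add_monoid Rh)"
  proof (rule homI)
    fix x y assume "x \<in> carrier (add_monoid Rh)" "y \<in> carrier (add_monoid Rh)"
    then have xy: "x \<in> carrier Rh" "y \<in> carrier Rh" by auto
    have "Vh (x \<oplus>\<^bsub>Rh\<^esub> y) = Vh x \<oplus>\<^bsub>Rh\<^esub> Vh y"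
    proof (rule completion_eqI)
      fix n obtain a b where ab: "rep x n a" "rep y n b" using rep_ex xy by metis
      show "\<exists>c. rep (Vh (x \<oplus>\<^bsub>Rh\<^esub> y)) n c \<and> rep (Vh x \<oplus>\<^bsub>Rh\<^esub> Vh y) n c"
        using rep_V[OF rep_add[OF ab]] rep_add[OF ab[THEN rep_V]] ab[THEN rep_carrier] by auto
    qed
    then show "Vh (x \<otimes>\<^bsub>add_monoid Rh\<^esub> y) = Vh x \<otimes>\<^bsub>add_monoid Rh\<^esub> Vh y" by simp
  qed auto
  show "inj_on Vh (carrier Rh)" by (rule completion_V_inj)
  show "Rh.F (Rh.F (Vh \<one>\<^bsub>Rh\<^esub>)) = [p] \<cdot>\<^bsub>Rh\<^esub> \<one>\<^bsub>Rh\<^esub>"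
    unfolding iota_pi by (simp add: iota_frob[symmetric] frob_frob_V_one iota.ring.hom_add_pow)
  fix x assume x: "x \<in> carrier Rh"
  show "Rh.F (Vh x) = Rh.F (Vh \<one>\<^bsub>Rh\<^esub>) \<otimes>\<^bsub>Rh\<^esub> x"
  proof (rule completion_eqI)
    fix n obtain a where a: "rep x (Suc n) a" using rep_ex x by blast
    have "rep (Rh.F (Vh x)) n (\<pi> \<otimes> a)"
      using rep_frob[OF rep_V[OF a]] x frob_V[OF rep_carrier[OF a]] by auto
    moreover have "rep (\<iota> \<pi> \<otimes>\<^bsub>Rh\<^esub> x) n (\<pi> \<otimes> a)"
      by (intro rep_mult rep_iota rep_down[OF a x]) auto
    ultimately show "\<exists>c. rep (Rh.F (Vh x)) n c \<and> rep (Rh.F (Vh \<one>\<^bsub>Rh\<^esub>) \<otimes>\<^bsub>Rh\<^esub> x) n c"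
      unfolding iota_pi by blast
  qed
  show "dh (Vh x) = (if p = 2 then \<ominus>\<^bsub>Rh\<^esub> x \<oplus>\<^bsub>Rh\<^esub> Vh (Rh.F (Vh \<one>\<^bsub>Rh\<^esub>) \<otimes>\<^bsub>Rh\<^esub> dh x)
       else x \<ominus>\<^bsub>Rh\<^esub> [(p ^ (p - 2))] \<cdot>\<^bsub>Rh\<^esub> Vh (x [^]\<^bsub>Rh\<^esub> p))" (is "?l = ?r")
  proof (rule completion_eqI)
    fix n obtain a where a: "rep x (Suc n) a" using rep_ex x by blast
    then have a': "rep x n a" using rep_down x by blast
    have "rep ?l n (\<delta> (V a))"
      by (intro rep_delta rep_V a)
    moreover have "rep ?r n (\<delta> (V a))"
    proof (cases "p = 2")
      case True
      have "rep (\<ominus>\<^bsub>Rh\<^esub> x \<oplus>\<^bsub>Rh\<^esub> Vh (Rh.F (Vh \<one>\<^bsub>Rh\<^esub>) \<otimes>\<^bsub>Rh\<^esub> dh x)) n (\<ominus> a \<oplus> V (\<pi> \<otimes> \<delta> a))"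
        unfolding iota_pi by (intro rep_add rep_inv rep_V rep_mult rep_iota rep_delta a a' x) auto
      then show ?thesis using True rep_carrier[OF a] by (simp add: delta_V)
    next
      case False
      have "rep (x \<ominus>\<^bsub>Rh\<^esub> [(p ^ (p - 2))] \<cdot>\<^bsub>Rh\<^esub> Vh (x [^]\<^bsub>Rh\<^esub> p)) n (a \<ominus> [(p ^ (p - 2))] \<cdot> V (a [^] p))"
        using x by (intro rep_minus rep_add_pow rep_V rep_pow a') auto
      then show ?thesis using False rep_carrier[OF a] by (simp add: delta_V)
    qed
    ultimately show "\<exists>c. rep ?l n c \<and> rep ?r n c" by blast
  qed
  fix y assume y: "y \<in> carrier Rh"
  show "x \<otimes>\<^bsub>Rh\<^esub> Vh y = Vh (Rh.F x \<otimes>\<^bsub>Rh\<^esub> y)" (is "?l = ?r")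
  proof (rule completion_eqI)
    fix n obtain a b where ab: "rep x (Suc n) a" "rep y n b" using rep_ex x y by metis
    have "rep ?l n (a \<otimes> V b)"
      by (intro rep_mult rep_V ab rep_down[OF ab(1) x])
    moreover have "rep ?r n (V (F a \<otimes> b))"
      by (intro rep_mult rep_V ab rep_frob x)
    ultimately show "\<exists>c. rep ?l n c \<and> rep ?r n c"
      using ab[THEN rep_carrier] V_linear by auto
  qed
qed

text \<open>Componentwise preimages under \<open>V\<close> are unique up to the right ideal because \<open>V\<close> is injective, so
  they form a compatible sequence.\<close>

lemma completion_V_image:
  assumes x: "x \<in> carrier Rh" and 1: "rep x 1 \<zero>"
  shows "\<exists>y\<in>carrier Rh. x = Vh y"
proof -
  have ex: "\<exists>b. b \<in> carrier R \<and> rep x (Suc n) (V b)" for n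
  proof -
    obtain c where c: "rep x (Suc n) c" using rep_ex x by blast
    have "rep x 1 c" using c by (induction n) (simp_all add: rep_down[OF _ x, of "Suc _"])
    then have "c \<in> I 1" using rep_unique[OF _ 1] rep_carrier[OF c] by (force simp: a_minus_def)
    then show ?thesis using c by (auto simp: V_ideal_def)
  qed
  define b where "b n = (SOME b. b \<in> carrier R \<and> rep x (Suc n) (V b))" for n
  have b: "b n \<in> carrier R" "rep x (Suc n) (V (b n))" for n
    using someI_ex[OF ex[of n]] by (auto simp: b_def)
  define y where "y n = I n +> b n" for n
  have y0: "rep y n (b n)" for n using b by (simp add: rep_def y_def)
  have y1: "rep y n (b (Suc n))" for n
  proof (rule rep_cong[OF y0 b(1)])
    have "V (b (Suc n)) \<ominus> V (b n) \<in> I (Suc n)"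
      by (rule rep_unique[OF rep_down[OF b(2) x] b(2)])
    then show "b (Suc n) \<ominus> b n \<in> I n"
      using b by (rule_tac V_in_V_idealD) (auto simp: V.hom_minus)
  qed
  have y: "y \<in> carrier Rh" by (rule completionI) (use y0 y1 in blast)
  moreover have "x = Vh y"
    by (rule completion_eqI) (use rep_V[OF y0] rep_down[OF b(2) x] in blast)
  ultimately show ?thesis by blast
qed

text \<open>The summand \<open>a\<close> represents \<open>x\<close> modulo the image of \<open>V\<close>.\<close>

lemma completion_decompose:
  assumes x: "x \<in> carrier Rh"
  shows "\<exists>a\<in>carrier R. \<exists>y\<in>carrier Rh. x = \<iota> a \<oplus>\<^bsub>Rh\<^esub> Vh y"
proof -
  obtain a where a: "rep x 1 a" using rep_ex x by blast
  have ac: "a \<in> carrier R" using rep_carrier[OF a] .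
  have "rep (x \<ominus>\<^bsub>Rh\<^esub> \<iota> a) 1 (a \<ominus> a)"
    by (intro rep_minus rep_iota a ac iota_closed)
  then obtain y where y: "y \<in> carrier Rh" "x \<ominus>\<^bsub>Rh\<^esub> \<iota> a = Vh y"
    using completion_V_image[of "x \<ominus>\<^bsub>Rh\<^esub> \<iota> a"] x ac by (auto simp: a_minus_def r_neg)
  have "x = \<iota> a \<oplus>\<^bsub>Rh\<^esub> (x \<ominus>\<^bsub>Rh\<^esub> \<iota> a)"
    using x ac by (simp add: a_minus_def Rh.a_ac Rh.r_neg)
  then show ?thesis using y ac by auto
qed

lemma completion_V_strict:
  assumes x: "x \<in> carrier Rh" and Vx: "Vh x \<in> \<iota> ` carrier R"
  shows "x \<in> \<iota> ` carrier R"
proof -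
  obtain a where a: "a \<in> carrier R" "Vh x = \<iota> a" using Vx by blast
  obtain b where b: "rep x 1 b" using rep_ex x by blast
  have "rep (Vh x) 1 (V b)" using rep_V[OF b] .
  then have "a \<ominus> V b \<in> I 1"
    using rep_unique[of "Vh x" 1 a "V b"] rep_iota[OF a(1)] a by simp
  then obtain c where c: "c \<in> carrier R" "a \<ominus> V b = V c" by (auto simp: V_ideal_def)
  have "a = V b \<oplus> V c"
    using c(2)[symmetric] rep_carrier[OF b] a by (simp add: a_minus_def a_ac r_neg)
  then have "a = V (b \<oplus> c)" using rep_carrier[OF b] c by simp
  then have "Vh x = \<iota> (V (b \<oplus> c))" by (simp only: a(2))
  also have "\<dots> = Vh (\<iota> (b \<oplus> c))"
    using rep_carrier[OF b] c by (intro iota_V) auto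
  finally have "x = \<iota> (b \<oplus> c)"
    by (rule inj_onD[OF completion_V_inj]) (use x rep_carrier[OF b] c in \<open>auto intro: iota_closed\<close>)
  then show ?thesis using rep_carrier[OF b] c by blast
qed

end

section \<open>Derived completeness\<close>

lemma derived_completeD_zero:
  assumes "derived_complete p M" "\<And>n::nat. x n \<in> carrier M"
    "\<And>n. x n \<ominus>\<^bsub>M\<^esub> [p] \<cdot>\<^bsub>M\<^esub> x (Suc n) = \<zero>\<^bsub>M\<^esub>"
  shows "x n = \<zero>\<^bsub>M\<^esub>"
  using assms unfolding derived_complete_def by (auto simp: Pi_iff)

lemma derived_completeD_ex:
  assumes "derived_complete p M" "\<And>n::nat. y n \<in> carrier M"
  obtains x where "\<And>n. x n \<in> carrier M" "\<And>n. x n \<ominus>\<^bsub>M\<^esub> [p] \<cdot>\<^bsub>M\<^esub> x (Suc n) = y n"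
proof -
  have "y \<in> UNIV \<rightarrow> carrier M" using assms(2) by auto
  then obtain x where "x \<in> UNIV \<rightarrow> carrier M" "\<forall>n. x n \<ominus>\<^bsub>M\<^esub> [p] \<cdot>\<^bsub>M\<^esub> x (Suc n) = y n"
    using assms(1) unfolding derived_complete_def by blast
  then show thesis using that by (auto simp: Pi_iff)
qed

text \<open>Solving \<open>b\<^sub>n - p b\<^sub>n\<^sub>+\<^sub>1 = a\<^sub>n\<close> in \<open>G\<close> and subtracting \<open>h b\<^sub>n\<close> from \<open>x\<^sub>n\<close> leaves a sequence in the
  kernel of the difference map on \<open>H\<close>, which is zero.\<close>

lemma (in abelian_group_hom) derived_complete_image:
  assumes G: "derived_complete p G" and H: "derived_complete p H"
    and x: "\<And>n::nat. x n \<in> carrier H"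
    and step: "\<And>n. x n \<ominus>\<^bsub>H\<^esub> [p] \<cdot>\<^bsub>H\<^esub> x (Suc n) \<in> h ` carrier G"
  shows "x n \<in> h ` carrier G"
proof -
  have "\<exists>a\<in>carrier G. x n \<ominus>\<^bsub>H\<^esub> [p] \<cdot>\<^bsub>H\<^esub> x (Suc n) = h a" for n
    using step[of n] by auto
  then obtain a where a: "\<And>n. a n \<in> carrier G" "\<And>n. x n \<ominus>\<^bsub>H\<^esub> [p] \<cdot>\<^bsub>H\<^esub> x (Suc n) = h (a n)"
    by metis
  obtain b where b: "\<And>n. b n \<in> carrier G" "\<And>n. b n \<ominus>\<^bsub>G\<^esub> [p] \<cdot>\<^bsub>G\<^esub> b (Suc n) = a n"
    using derived_completeD_ex[OF G, of a] a by metis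
  have eq: "(x n \<ominus>\<^bsub>H\<^esub> h (b n)) \<ominus>\<^bsub>H\<^esub> [p] \<cdot>\<^bsub>H\<^esub> (x (Suc n) \<ominus>\<^bsub>H\<^esub> h (b (Suc n))) = \<zero>\<^bsub>H\<^esub>" for n
  proof -
    have "h (b n) \<ominus>\<^bsub>H\<^esub> [p] \<cdot>\<^bsub>H\<^esub> h (b (Suc n)) = x n \<ominus>\<^bsub>H\<^esub> [p] \<cdot>\<^bsub>H\<^esub> x (Suc n)"
      using b a by (simp add: b(2)[symmetric] hom_minus hom_add_pow)
    moreover have "(u \<ominus>\<^bsub>H\<^esub> v) \<ominus>\<^bsub>H\<^esub> [p] \<cdot>\<^bsub>H\<^esub> (u' \<ominus>\<^bsub>H\<^esub> v') = (u \<ominus>\<^bsub>H\<^esub> [p] \<cdot>\<^bsub>H\<^esub> u') \<ominus>\<^bsub>H\<^esub> (v \<ominus>\<^bsub>H\<^esub> [p] \<cdot>\<^bsub>H\<^esub> v')"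
      if "u \<in> carrier H" "v \<in> carrier H" "u' \<in> carrier H" "v' \<in> carrier H" for u v u' v'
      using that
      by (simp add: a_minus_def H.add.nat_pow_distrib H.add.nat_pow_inv H.minus_add H.a_ac)
    ultimately show ?thesis
      using x b by (simp add: a_minus_def H.r_neg)
  qed
  have "x n \<ominus>\<^bsub>H\<^esub> h (b n) = \<zero>\<^bsub>H\<^esub>"
    by (rule derived_completeD_zero[where x = "\<lambda>n. x n \<ominus>\<^bsub>H\<^esub> h (b n)", OF H _ eq]) (use x b in auto)
  then have "x n = h (b n)"
    by (rule H.minus_eq_zeroD) (use x b in auto)
  then show ?thesis using b by blast
qed

text \<open>Injectivity of the difference map on the cokernel is the previous lemma; surjectivity lifts
  to \<open>H\<close>.\<close>

lemma derived_complete_cokernel: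
  assumes f: "abelian_group_hom G H f" and q: "abelian_group_hom H Q q"
    and surj: "q ` carrier H = carrier Q"
    and exact: "\<And>x. x \<in> carrier H \<Longrightarrow> q x = \<zero>\<^bsub>Q\<^esub> \<longleftrightarrow> x \<in> f ` carrier G"
    and G: "derived_complete p G" and H: "derived_complete p H"
  shows "derived_complete p Q"
proof -
  interpret f: abelian_group_hom G H f by fact
  interpret q: abelian_group_hom H Q q by fact
  show ?thesis
    unfolding derived_complete_def
  proof (intro conjI ballI impI)
    fix x :: "nat \<Rightarrow> _" assume x: "x \<in> UNIV \<rightarrow> carrier Q"
      and step: "\<forall>n. x n \<ominus>\<^bsub>Q\<^esub> [p] \<cdot>\<^bsub>Q\<^esub> x (Suc n) = \<zero>\<^bsub>Q\<^esub>"
    have "\<exists>y\<in>carrier H. x n = q y" for n using x surj by (auto simp: Pi_iff image_iff)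
    then obtain y where y: "\<And>n. y n \<in> carrier H" "\<And>n. x n = q (y n)" by metis
    have "y n \<ominus>\<^bsub>H\<^esub> [p] \<cdot>\<^bsub>H\<^esub> y (Suc n) \<in> f ` carrier G" for n
      using step y by (subst exact[symmetric]) (auto simp: q.hom_minus q.hom_add_pow)
    then have "y n \<in> f ` carrier G" for n
      by (rule f.derived_complete_image[OF G H y(1)])
    then show "\<forall>n. x n = \<zero>\<^bsub>Q\<^esub>"
      using exact[OF y(1)] by (simp add: y(2))
  next
    fix y :: "nat \<Rightarrow> _" assume "y \<in> UNIV \<rightarrow> carrier Q"
    then have "\<exists>z\<in>carrier H. y n = q z" for n using surj by (auto simp: Pi_iff image_iff)
    then obtain z where z: "\<And>n. z n \<in> carrier H" "\<And>n. y n = q (z n)" by metis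
    obtain x where x: "\<And>n. x n \<in> carrier H" "\<And>n. x n \<ominus>\<^bsub>H\<^esub> [p] \<cdot>\<^bsub>H\<^esub> x (Suc n) = z n"
      using derived_completeD_ex[OF H, of z] z by metis
    show "\<exists>x\<in>UNIV \<rightarrow> carrier Q. \<forall>n. x n \<ominus>\<^bsub>Q\<^esub> [p] \<cdot>\<^bsub>Q\<^esub> x (Suc n) = y n"
      using x z by (intro bexI[of _ "\<lambda>n. q (x n)"])
        (auto simp: x(2)[symmetric] q.hom_minus q.hom_add_pow)
  qed
qed

text \<open>Each quotient by \<open>V\<^sup>n\<close> is the cokernel of \<open>V\<^sup>n\<close>, so solutions of the difference equation exist and
  are unique there; uniqueness makes the solutions on all levels compatible.\<close>

lemma (in cartier_ring) derived_complete_completion: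
  assumes R: "derived_complete p R"
  shows "derived_complete p Rh"
proof -
  have mod_zero: "x k \<in> I n"
    if "\<And>k. x k \<in> carrier R" "\<And>k. x k \<ominus> [p] \<cdot> x (Suc k) \<in> I n" for x :: "nat \<Rightarrow> 'a" and n k
  proof -
    interpret Vn: abelian_group_hom R R "V ^^ n"
      by (intro abelian_group_homI_hom is_abelian_group funpow_V_hom)
    show ?thesis
      using Vn.derived_complete_image[OF R R] that unfolding V_ideal_def by blast
  qed
  show ?thesis
    unfolding derived_complete_def
  proof (intro conjI ballI impI allI)
    fix x :: "nat \<Rightarrow> _" and k assume x: "x \<in> UNIV \<rightarrow> carrier Rh"
      and step: "\<forall>k. x k \<ominus>\<^bsub>Rh\<^esub> [p] \<cdot>\<^bsub>Rh\<^esub> x (Suc k) = \<zero>\<^bsub>Rh\<^esub>"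
    have xc: "x k \<in> carrier Rh" for k using x by auto
    show "x k = \<zero>\<^bsub>Rh\<^esub>"
    proof (rule completion_eqI)
      fix n
      have "\<exists>a. rep (x k) n a" for k using rep_ex xc by blast
      then obtain a where a: "\<And>k. rep (x k) n (a k)" by metis
      have "rep \<zero>\<^bsub>Rh\<^esub> n (a k \<ominus> [p] \<cdot> a (Suc k))" for k
        unfolding step[rule_format, of k, symmetric] using xc by (intro rep_minus rep_add_pow a) auto
      then have "a k \<ominus> [p] \<cdot> a (Suc k) \<ominus> \<zero> \<in> I n" for k
        using rep_unique rep_zero by blast
      then have "a k \<ominus> [p] \<cdot> a (Suc k) \<in> I n" for k
        using rep_carrier[OF a] by (simp add: a_minus_def)
      then have "a k \<in> I n" by (rule mod_zero[OF rep_carrier[OF a]])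
      then have "rep \<zero>\<^bsub>Rh\<^esub> n (a k)"
        using rep_carrier[OF a] by (intro rep_cong[OF rep_zero]) (auto simp: a_minus_def)
      then show "\<exists>c. rep (x k) n c \<and> rep \<zero>\<^bsub>Rh\<^esub> n c" using a by blast
    qed
  next
    fix y :: "nat \<Rightarrow> _" assume "y \<in> UNIV \<rightarrow> carrier Rh"
    then have yc: "y k \<in> carrier Rh" for k by auto
    have "\<exists>b. rep (y k) n b" for n k using rep_ex[OF yc] by blast
    then have b: "rep (y k) n (SOME b. rep (y k) n b)" for n k by (rule someI_ex)
    define b where "b n k = (SOME b. rep (y k) n b)" for n k
    note b = b[folded b_def]
    have "\<exists>a. \<forall>k. a k \<in> carrier R \<and> a k \<ominus> [p] \<cdot> a (Suc k) = b n k" for n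
      using derived_completeD_ex[OF R, of "b n"] rep_carrier[OF b] by metis
    then obtain a where a: "\<And>n k. a n k \<in> carrier R" "\<And>n k. a n k \<ominus> [p] \<cdot> a n (Suc k) = b n k"
      by metis
    define x where "x k n = I n +> a n k" for k n
    have x0: "rep (x k) n (a n k)" for n k using a by (simp add: rep_def x_def)
    have x1: "rep (x k) n (a (Suc n) k)" for n k
    proof (rule rep_cong[OF x0 a(1)])
      have "(a (Suc n) k \<ominus> a n k) \<ominus> [p] \<cdot> (a (Suc n) (Suc k) \<ominus> a n (Suc k)) = b (Suc n) k \<ominus> b n k" for k
        unfolding a(2)[symmetric] using a(1)
        by (simp add: a_minus_def add.nat_pow_distrib add.nat_pow_inv minus_add a_ac)
      moreover have "b (Suc n) k \<ominus> b n k \<in> I n" for k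
        by (rule rep_unique[OF rep_down[OF b yc] b])
      ultimately show "a (Suc n) k \<ominus> a n k \<in> I n"
        using mod_zero[of "\<lambda>k. a (Suc n) k \<ominus> a n k" n k] a(1) by simp
    qed
    have xc: "x k \<in> carrier Rh" for k
      by (rule completionI) (use x0 x1 in blast)
    have "x k \<ominus>\<^bsub>Rh\<^esub> [p] \<cdot>\<^bsub>Rh\<^esub> x (Suc k) = y k" for k
    proof (rule completion_eqI)
      fix n
      have "rep (x k \<ominus>\<^bsub>Rh\<^esub> [p] \<cdot>\<^bsub>Rh\<^esub> x (Suc k)) n (a n k \<ominus> [p] \<cdot> a n (Suc k))"
        using xc by (intro rep_minus rep_add_pow x0) auto
      then show "\<exists>c. rep (x k \<ominus>\<^bsub>Rh\<^esub> [p] \<cdot>\<^bsub>Rh\<^esub> x (Suc k)) n c \<and> rep (y k) n c"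
        using b a by auto
    qed
    then show "\<exists>x\<in>UNIV \<rightarrow> carrier Rh. \<forall>k. x k \<ominus>\<^bsub>Rh\<^esub> [p] \<cdot>\<^bsub>Rh\<^esub> x (Suc k) = y k"
      using xc by blast
  qed
qed

section \<open>The cokernel of a dense extension of Cartier rings\<close>

text \<open>An abstract form of a Cartier ring \<open>A\<close>, its completion \<open>B\<close> and the cokernel \<open>C\<close> of \<open>\<iota>\<close>. The maps
  \<open>W\<close> and \<open>act\<close> are the operator \<open>V\<close> and the scalar multiplication by \<open>A\<close> on \<open>C\<close>. In general
  \<open>\<iota>\<close> is not injective, its kernel being the intersection of all \<open>V\<^sup>n A\<close>; elements of \<open>A\<close> that
  arise from decompositions are therefore compared after applying \<open>\<iota>\<close>.\<close>

locale cartier_cokernel =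
  A: cartier_ring A p \<delta>A VA + B: cartier_ring B p \<delta>B VB + C: abelian_group C
  for A B C p \<delta>A VA \<delta>B VB +
  fixes \<iota> d W act
  assumes iota_ring_hom: "\<iota> \<in> ring_hom A B"
    and iota_V: "a \<in> carrier A \<Longrightarrow> \<iota> (VA a) = VB (\<iota> a)"
    and iota_delta: "a \<in> carrier A \<Longrightarrow> \<iota> (\<delta>A a) = \<delta>B (\<iota> a)"
    and decompose: "x \<in> carrier B \<Longrightarrow> \<exists>a\<in>carrier A. \<exists>y\<in>carrier B. x = \<iota> a \<oplus>\<^bsub>B\<^esub> VB y"
    and strict: "\<lbrakk>x \<in> carrier B; VB x \<in> \<iota> ` carrier A\<rbrakk> \<Longrightarrow> x \<in> \<iota> ` carrier A"
    and d_hom: "d \<in> hom (add_monoid B) (add_monoid C)"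
    and d_surj: "d ` carrier B = carrier C"
    and d_kernel: "x \<in> carrier B \<Longrightarrow> d x = \<zero>\<^bsub>C\<^esub> \<longleftrightarrow> x \<in> \<iota> ` carrier A"
    and W_d: "x \<in> carrier B \<Longrightarrow> W (d x) = d (VB x)"
    and act_d: "\<lbrakk>a \<in> carrier A; x \<in> carrier B\<rbrakk> \<Longrightarrow> act a (d x) = d (\<iota> a \<otimes>\<^bsub>B\<^esub> x)"
    and complete_A: "derived_complete p A"
    and complete_B: "derived_complete p B"
begin

sublocale iota: ring_hom_cring A B \<iota>
  by unfold_locales (rule iota_ring_hom)

sublocale d: abelian_group_hom B C d
  by (intro abelian_group_homI_hom B.is_abelian_group C.abelian_group_axioms d_hom)

lemma complete_C: "derived_complete p C"
  by (rule derived_complete_cokernel[of A B \<iota> C d])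
     (simp_all add: iota.ring.abelian_group_hom_axioms d.abelian_group_hom_axioms d_surj d_kernel complete_A complete_B)

lemma d_ex:
  assumes "m \<in> carrier C" obtains x where "x \<in> carrier B" "m = d x"
  using assms d_surj by blast

lemma d_iota [simp]: "a \<in> carrier A \<Longrightarrow> d (\<iota> a) = \<zero>\<^bsub>C\<^esub>"
  by (simp add: d_kernel)

lemma iota_frob: "a \<in> carrier A \<Longrightarrow> \<iota> (A.F a) = B.F (\<iota> a)"
  by (simp add: frob_def iota_delta iota.ring.hom_add_pow iota.ring.hom_nat_pow)

lemma B_frob_V: "x \<in> carrier B \<Longrightarrow> B.F (VB x) = \<iota> A.frob_V_one \<otimes>\<^bsub>B\<^esub> x"
  using B.frob_V[of x] by (simp add: iota_frob iota_V)

subsection \<open>The operator and its inverse\<close>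

lemma W_closed [simp, intro]: "m \<in> carrier C \<Longrightarrow> W m \<in> carrier C"
  by (elim d_ex) (simp add: W_d)

lemma W_hom: "W \<in> hom (add_monoid C) (add_monoid C)"
proof (rule homI)
  fix m n assume "m \<in> carrier (add_monoid C)" "n \<in> carrier (add_monoid C)"
  then obtain x y where "x \<in> carrier B" "m = d x" "y \<in> carrier B" "n = d y"
    by (auto elim!: d_ex)
  then show "W (m \<otimes>\<^bsub>add_monoid C\<^esub> n) = W m \<otimes>\<^bsub>add_monoid C\<^esub> W n"
    by (simp add: W_d d.hom_add[symmetric] del: d.hom_add)
qed auto

sublocale W: abelian_group_hom C C W
  by (intro abelian_group_homI_hom C.abelian_group_axioms W_hom)

lemma W_bij: "bij_betw W (carrier C) (carrier C)"
  unfolding bij_betw_def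
proof
  show "inj_on W (carrier C)"
  proof (rule W.inj_onI_kernel)
    fix m assume m: "m \<in> carrier C" "W m = \<zero>\<^bsub>C\<^esub>"
    then obtain x where x: "x \<in> carrier B" "m = d x" by (auto elim: d_ex)
    with m have "VB x \<in> \<iota> ` carrier A" by (simp add: W_d d_kernel)
    then have "x \<in> \<iota> ` carrier A" by (rule strict[OF x(1)])
    with x show "m = \<zero>\<^bsub>C\<^esub>" by (simp add: d_kernel)
  qed
  show "W ` carrier C = carrier C"
  proof (intro equalityI subsetI)
    fix m assume "m \<in> carrier C"
    then obtain x where x: "x \<in> carrier B" "m = d x" by (auto elim: d_ex)
    obtain a y where "a \<in> carrier A" "y \<in> carrier B" "x = \<iota> a \<oplus>\<^bsub>B\<^esub> VB y"
      using decompose x by blast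
    then have "m = W (d y)" "d y \<in> carrier C" using x by (simp_all add: W_d)
    then show "m \<in> W ` carrier C" by blast
  qed auto
qed

abbreviation \<phi> where "\<phi> \<equiv> inv_into (carrier C) W"

lemma phi_closed [simp, intro]: "m \<in> carrier C \<Longrightarrow> \<phi> m \<in> carrier C"
  using W_bij by (metis bij_betw_def inv_into_into)

lemma W_phi [simp]: "m \<in> carrier C \<Longrightarrow> W (\<phi> m) = m"
  using W_bij by (metis bij_betw_def f_inv_into_f)

lemma phi_W [simp]: "m \<in> carrier C \<Longrightarrow> \<phi> (W m) = m"
  using W_bij by (metis bij_betw_def inv_into_f_f)

lemma phi_eqI: "\<lbrakk>n = W m; m \<in> carrier C\<rbrakk> \<Longrightarrow> \<phi> n = m"
  by simp

lemma phi_hom: "\<phi> \<in> hom (add_monoid C) (add_monoid C)"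
  by (rule homI) (auto intro!: phi_eqI)

sublocale phi: abelian_group_hom C C \<phi>
  by (intro abelian_group_homI_hom C.abelian_group_axioms phi_hom)

lemma phi_bij: "bij_betw \<phi> (carrier C) (carrier C)"
  using W_bij by (rule bij_betw_inv_into)

lemma d_decompose: "\<lbrakk>a \<in> carrier A; y \<in> carrier B\<rbrakk> \<Longrightarrow> d (\<iota> a \<oplus>\<^bsub>B\<^esub> VB y) = W (d y)"
  by (simp add: W_d)

subsection \<open>The action of the smaller ring\<close>

lemma act_closed [simp, intro]: "\<lbrakk>a \<in> carrier A; m \<in> carrier C\<rbrakk> \<Longrightarrow> act a m \<in> carrier C"
  by (elim d_ex) (simp add: act_d)

lemma act_hom_right:
  assumes a: "a \<in> carrier A"
  shows "abelian_group_hom C C (act a)"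
proof (intro abelian_group_homI_hom C.abelian_group_axioms homI)
  fix m n assume "m \<in> carrier (add_monoid C)" "n \<in> carrier (add_monoid C)"
  then obtain x y where "x \<in> carrier B" "m = d x" "y \<in> carrier B" "n = d y"
    by (auto elim!: d_ex)
  with a show "act a (m \<otimes>\<^bsub>add_monoid C\<^esub> n) = act a m \<otimes>\<^bsub>add_monoid C\<^esub> act a n"
    using act_d[OF a, of "x \<oplus>\<^bsub>B\<^esub> y"] by (simp add: act_d B.r_distr)
qed (use a in auto)

lemma act_hom_left:
  assumes m: "m \<in> carrier C"
  shows "abelian_group_hom A C (\<lambda>a. act a m)"
proof (intro abelian_group_homI_hom A.is_abelian_group C.abelian_group_axioms homI)
  fix a b assume "a \<in> carrier (add_monoid A)" "b \<in> carrier (add_monoid A)"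
  with m show "act (a \<otimes>\<^bsub>add_monoid A\<^esub> b) m = act a m \<otimes>\<^bsub>add_monoid C\<^esub> act b m"
    by (elim d_ex) (simp add: act_d B.l_distr)
qed (use m in auto)

lemmas act_add_right = abelian_group_hom.hom_add[OF act_hom_right]
lemmas act_add_pow_right = abelian_group_hom.hom_add_pow[OF act_hom_right]
lemmas act_add_left = abelian_group_hom.hom_add[OF act_hom_left]
lemmas act_add_pow_left = abelian_group_hom.hom_add_pow[OF act_hom_left]

lemma act_mult:
  "\<lbrakk>a \<in> carrier A; b \<in> carrier A; m \<in> carrier C\<rbrakk> \<Longrightarrow> act (a \<otimes>\<^bsub>A\<^esub> b) m = act a (act b m)"
  by (elim d_ex) (simp add: act_d B.m_assoc)

lemma act_one: "m \<in> carrier C \<Longrightarrow> act \<one>\<^bsub>A\<^esub> m = m"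
  by (elim d_ex) (simp add: act_d)

lemma act_cong:
  "\<lbrakk>\<iota> a = \<iota> b; a \<in> carrier A; b \<in> carrier A; m \<in> carrier C\<rbrakk> \<Longrightarrow> act a m = act b m"
  by (elim d_ex) (simp add: act_d)

lemma act_W:
  assumes "a \<in> carrier A" "m \<in> carrier C"
  shows "act a (W m) = W (act (A.F a) m)"
  using assms by (elim d_ex) (simp add: act_d W_d B.V_linear iota_frob)

lemma phi_act: "\<lbrakk>a \<in> carrier A; m \<in> carrier C\<rbrakk> \<Longrightarrow> \<phi> (act a m) = act (A.F a) (\<phi> m)"
  by (rule phi_eqI) (simp_all add: act_W[symmetric])

text \<open>Every element of \<open>C\<close> is of the form \<open>W m\<close>, and \<open>\<pi> V = V (F \<pi>) = V p\<close>.\<close>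

lemma act_pi:
  assumes m: "m \<in> carrier C"
  shows "act A.frob_V_one m = [p] \<cdot>\<^bsub>C\<^esub> m"
proof -
  have "act A.frob_V_one (W (\<phi> m)) = W ([p] \<cdot>\<^bsub>C\<^esub> \<phi> m)"
    using m by (subst act_W) (simp_all add: A.frob_frob_V_one act_add_pow_left act_one)
  then show ?thesis using m by (simp add: W.hom_add_pow)
qed

subsection \<open>Corecursion over the contraction\<close>

text \<open>Passing to the tail \<open>y\<close> of \<open>a + V y\<close> costs one application of \<open>T\<close>; it plays the role of a
  contraction.\<close>

definition T where "T m = [p] \<cdot>\<^bsub>C\<^esub> W m"

lemma T_hom: "T \<in> hom (add_monoid C) (add_monoid C)"
  by (rule homI) (auto simp: T_def C.add.nat_pow_distrib)

sublocale T: abelian_group_hom C C T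
  by (intro abelian_group_homI_hom C.abelian_group_axioms T_hom)

lemma T_alt: "m \<in> carrier C \<Longrightarrow> T m = W ([p] \<cdot>\<^bsub>C\<^esub> m)"
  by (simp add: T_def W.hom_add_pow)

lemma phi_T: "m \<in> carrier C \<Longrightarrow> \<phi> (T m) = [p] \<cdot>\<^bsub>C\<^esub> m"
  by (simp add: T_alt)

lemma act_T: "\<lbrakk>a \<in> carrier A; m \<in> carrier C\<rbrakk> \<Longrightarrow> act a (T m) = T (act (A.F a) m)"
  by (simp add: T_def act_add_pow_right act_W)

lemma act_V: "\<lbrakk>a \<in> carrier A; m \<in> carrier C\<rbrakk> \<Longrightarrow> act (VA a) m = T (act a (\<phi> m))"
proof -
  assume a: "a \<in> carrier A" and m: "m \<in> carrier C"
  have "act (VA a) (W (\<phi> m)) = W (act (A.frob_V_one \<otimes>\<^bsub>A\<^esub> a) (\<phi> m))"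
    using a m A.frob_V[OF a] by (simp only: act_W phi_closed A.V.hom_closed)
  then show ?thesis using a m by (simp add: act_mult act_pi T_alt)
qed

lemma funpow_W_hom: "abelian_group_hom C C (W ^^ n)"
  by (intro abelian_group_homI_hom C.abelian_group_axioms)
     (induction n, auto simp: hom_def Pi_iff)

text \<open>An element that is \<open>T\<close> of another such element, and so on forever, is the start of a sequence
  \<open>y\<^sub>n = W\<^sup>n e\<^sub>n\<close> with \<open>y\<^sub>n = p y\<^sub>n\<^sub>+\<^sub>1\<close>, which vanishes by derived completeness.\<close>

lemma contraction_zero:
  assumes E: "E \<subseteq> carrier C" and step: "\<And>e. e \<in> E \<Longrightarrow> \<exists>e'\<in>E. e = T e'" and e: "e \<in> E"
  shows "e = \<zero>\<^bsub>C\<^esub>"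
proof -
  obtain s where s: "\<And>e. e \<in> E \<Longrightarrow> s e \<in> E \<and> e = T (s e)"
    using step by metis
  define y where "y n = (W ^^ n) ((s ^^ n) e)" for n
  have sE: "(s ^^ n) e \<in> E" for n
    using e s by (induction n) auto
  then have sC: "(s ^^ n) e \<in> carrier C" for n using E by blast
  have "y n = [p] \<cdot>\<^bsub>C\<^esub> y (Suc n)" for n
  proof -
    interpret Wn: abelian_group_hom C C "W ^^ n" by (rule funpow_W_hom)
    have "y n = (W ^^ n) (T ((s ^^ Suc n) e))"
      unfolding y_def using s[OF sE[of n]] by simp
    also have "\<dots> = [p] \<cdot>\<^bsub>C\<^esub> (W ^^ n) (W ((s ^^ Suc n) e))"
      using sC[of "Suc n"] by (simp add: T_def Wn.hom_add_pow)
    finally show ?thesis by (simp add: y_def funpow_swap1)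
  qed
  moreover have yC: "y n \<in> carrier C" for n
    using abelian_group_hom.hom_closed[OF funpow_W_hom] sC by (simp add: y_def)
  ultimately have "y n \<ominus>\<^bsub>C\<^esub> [p] \<cdot>\<^bsub>C\<^esub> y (Suc n) = \<zero>\<^bsub>C\<^esub>" for n
    by (metis a_minus_def C.r_neg)
  then have "y 0 = \<zero>\<^bsub>C\<^esub>"
    by (rule derived_completeD_zero[where x = y, OF complete_C yC])
  then show ?thesis by (simp add: y_def)
qed

text \<open>The multiples of the differences \<open>u - v\<close> form a set to which the previous lemma applies; the
  factor \<open>k\<close> is absorbed because all multiples are included.\<close>

lemma bisimulation:
  assumes uv: "(u, v) \<in> S" and S: "S \<subseteq> carrier C \<times> carrier C"
    and step: "\<And>u v. (u, v) \<in> S \<Longrightarrow> \<exists>c\<in>carrier C. \<exists>(k::nat) u' v'. (u', v') \<in> S \<and>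
      u = c \<oplus>\<^bsub>C\<^esub> [k] \<cdot>\<^bsub>C\<^esub> T u' \<and> v = c \<oplus>\<^bsub>C\<^esub> [k] \<cdot>\<^bsub>C\<^esub> T v'"
  shows "u = v"
proof -
  define E where "E = {[k] \<cdot>\<^bsub>C\<^esub> (u \<ominus>\<^bsub>C\<^esub> v) | (k::nat) u v. (u, v) \<in> S}"
  have "u \<ominus>\<^bsub>C\<^esub> v = \<zero>\<^bsub>C\<^esub>"
  proof (rule contraction_zero[of E])
    show "E \<subseteq> carrier C" using S by (auto simp: E_def)
    have "u \<ominus>\<^bsub>C\<^esub> v = [(1::nat)] \<cdot>\<^bsub>C\<^esub> (u \<ominus>\<^bsub>C\<^esub> v)"
      using uv S by (auto simp: C.add.nat_pow_Suc)
    then show "u \<ominus>\<^bsub>C\<^esub> v \<in> E" unfolding E_def using uv by blast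
    fix e assume "e \<in> E"
    then obtain l u v where e: "e = [(l::nat)] \<cdot>\<^bsub>C\<^esub> (u \<ominus>\<^bsub>C\<^esub> v)" and uv: "(u, v) \<in> S"
      by (auto simp: E_def)
    obtain c k u' v' where c: "c \<in> carrier C" "(u', v') \<in> S"
      "u = c \<oplus>\<^bsub>C\<^esub> [(k::nat)] \<cdot>\<^bsub>C\<^esub> T u'" "v = c \<oplus>\<^bsub>C\<^esub> [k] \<cdot>\<^bsub>C\<^esub> T v'"
      using step[OF uv] by blast
    have C': "u' \<in> carrier C" "v' \<in> carrier C" using c S by auto
    have "u \<ominus>\<^bsub>C\<^esub> v = [k] \<cdot>\<^bsub>C\<^esub> T u' \<ominus>\<^bsub>C\<^esub> [k] \<cdot>\<^bsub>C\<^esub> T v'"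
    proof -
      have "c \<oplus>\<^bsub>C\<^esub> a \<ominus>\<^bsub>C\<^esub> (c \<oplus>\<^bsub>C\<^esub> b) = a \<ominus>\<^bsub>C\<^esub> b" if "a \<in> carrier C" "b \<in> carrier C" for a b
      proof -
        have "c \<oplus>\<^bsub>C\<^esub> a \<ominus>\<^bsub>C\<^esub> (c \<oplus>\<^bsub>C\<^esub> b) = (c \<ominus>\<^bsub>C\<^esub> c) \<oplus>\<^bsub>C\<^esub> (a \<ominus>\<^bsub>C\<^esub> b)"
          using that c(1) by (simp add: a_minus_def C.minus_add C.a_ac)
        then show ?thesis using that c(1) by (simp add: a_minus_def C.r_neg)
      qed
      then show ?thesis using c(3,4) C' by simp
    qed
    also have "\<dots> = T ([k] \<cdot>\<^bsub>C\<^esub> (u' \<ominus>\<^bsub>C\<^esub> v'))"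
      using C' by (simp add: T.hom_add_pow T.hom_minus a_minus_def C.add.nat_pow_distrib C.add.nat_pow_inv)
    finally have "e = T ([(k * l)] \<cdot>\<^bsub>C\<^esub> (u' \<ominus>\<^bsub>C\<^esub> v'))"
      using C' by (simp add: e T.hom_add_pow[symmetric] C.add.nat_pow_pow)
    then show "\<exists>e'\<in>E. e = T e'"
      unfolding E_def using c(2) by blast
  qed
  then show ?thesis using C.minus_eq_zeroD uv S by blast
qed

lemma bisimulation_family:
  assumes P: "P i" and C: "\<And>i. P i \<Longrightarrow> f i \<in> carrier C \<and> g i \<in> carrier C"
    and step: "\<And>i. P i \<Longrightarrow> \<exists>c\<in>carrier C. \<exists>(k::nat) j. P j \<and>
      f i = c \<oplus>\<^bsub>C\<^esub> [k] \<cdot>\<^bsub>C\<^esub> T (f j) \<and> g i = c \<oplus>\<^bsub>C\<^esub> [k] \<cdot>\<^bsub>C\<^esub> T (g j)"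
  shows "f i = g i"
proof (rule bisimulation[of _ _ "{(f i, g i) | i. P i}"])
  fix u v assume "(u, v) \<in> {(f i, g i) | i. P i}"
  then obtain i where i: "P i" "u = f i" "v = g i" by blast
  then show "\<exists>c\<in>carrier C. \<exists>(k::nat) u' v'. (u', v') \<in> {(f i, g i) | i. P i} \<and>
      u = c \<oplus>\<^bsub>C\<^esub> [k] \<cdot>\<^bsub>C\<^esub> T u' \<and> v = c \<oplus>\<^bsub>C\<^esub> [k] \<cdot>\<^bsub>C\<^esub> T v'"
    using step[OF i(1)] by blast
qed (use P C in blast)+

lemma bisimulation_family_one:
  assumes P: "P i" and C: "\<And>i. P i \<Longrightarrow> f i \<in> carrier C \<and> g i \<in> carrier C"
    and step: "\<And>i. P i \<Longrightarrow> \<exists>c\<in>carrier C. \<exists>j. P j \<and>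
      f i = c \<oplus>\<^bsub>C\<^esub> T (f j) \<and> g i = c \<oplus>\<^bsub>C\<^esub> T (g j)"
  shows "f i = g i"
proof (rule bisimulation_family[of P, OF P C])
  fix i assume "P i"
  then obtain c j where j: "c \<in> carrier C" "P j" "f i = c \<oplus>\<^bsub>C\<^esub> T (f j)" "g i = c \<oplus>\<^bsub>C\<^esub> T (g j)"
    using step by blast
  have "[(1::nat)] \<cdot>\<^bsub>C\<^esub> n = n" if "n \<in> carrier C" for n
    using that by simp
  then have "f i = c \<oplus>\<^bsub>C\<^esub> [(1::nat)] \<cdot>\<^bsub>C\<^esub> T (f j)" "g i = c \<oplus>\<^bsub>C\<^esub> [(1::nat)] \<cdot>\<^bsub>C\<^esub> T (g j)"
    using j C[OF j(2)] by simp_all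
  with j(1,2) show "\<exists>c\<in>carrier C. \<exists>(k::nat) j. P j \<and>
      f i = c \<oplus>\<^bsub>C\<^esub> [k] \<cdot>\<^bsub>C\<^esub> T (f j) \<and> g i = c \<oplus>\<^bsub>C\<^esub> [k] \<cdot>\<^bsub>C\<^esub> T (g j)"
    by blast
qed

text \<open>Unfolding the recursion formally gives \<open>h x = \<Sum>\<^sub>n p\<^sup>n W\<^sup>n (f (s\<^sup>n x))\<close>. The sum makes sense as the
  first entry of the unique sequence \<open>w\<close> with \<open>w\<^sub>n - p w\<^sub>n\<^sub>+\<^sub>1 = W\<^sup>n (f (s\<^sup>n x))\<close>; that \<open>h\<close> satisfies the
  recursion comes from comparing this sequence, shifted by one, with the one for \<open>s x\<close>.\<close>

lemma corecursion:
  assumes f: "\<And>x. x \<in> X \<Longrightarrow> f x \<in> carrier C" and s: "\<And>x. x \<in> X \<Longrightarrow> s x \<in> X"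
  obtains h where "\<And>x. x \<in> X \<Longrightarrow> h x \<in> carrier C"
    and "\<And>x. x \<in> X \<Longrightarrow> h x = f x \<oplus>\<^bsub>C\<^esub> T (h (s x))"
proof -
  have sX: "(s ^^ n) x \<in> X" if "x \<in> X" for x n
    using that s by (induction n) auto
  define y where "y x n = (W ^^ n) (f ((s ^^ n) x))" for x n
  have yC: "y x n \<in> carrier C" if "x \<in> X" for x n
    using abelian_group_hom.hom_closed[OF funpow_W_hom] f[OF sX[OF that]] by (simp add: y_def)
  define sol where "sol x z \<longleftrightarrow> (\<forall>n. z n \<in> carrier C) \<and> (\<forall>n. z n \<ominus>\<^bsub>C\<^esub> [p] \<cdot>\<^bsub>C\<^esub> z (Suc n) = y x n)" for x and z :: "nat \<Rightarrow> _"
  define w where "w x = (SOME z. sol x z)" for x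
  have sol_w: "sol x (w x)" if x: "x \<in> X" for x
  proof -
    obtain z where "\<And>n. z n \<in> carrier C" "\<And>n. z n \<ominus>\<^bsub>C\<^esub> [p] \<cdot>\<^bsub>C\<^esub> z (Suc n) = y x n"
      using derived_completeD_ex[OF complete_C, of "y x"] yC[OF x] by blast
    then have "sol x z" by (simp add: sol_def)
    then show ?thesis unfolding w_def by (rule someI[of "sol x"])
  qed
  then have wC: "w x n \<in> carrier C" and wy: "w x n \<ominus>\<^bsub>C\<^esub> [p] \<cdot>\<^bsub>C\<^esub> w x (Suc n) = y x n" if "x \<in> X" for x n
    using that by (auto simp: sol_def)
  have shift: "w x (Suc n) = W (w (s x) n)" if x: "x \<in> X" for x n
  proof -
    define z where "z n = w x (Suc n) \<ominus>\<^bsub>C\<^esub> W (w (s x) n)" for n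
    have zC: "z n \<in> carrier C" for n using x s by (simp add: z_def wC)
    have "z n \<ominus>\<^bsub>C\<^esub> [p] \<cdot>\<^bsub>C\<^esub> z (Suc n) = \<zero>\<^bsub>C\<^esub>" for n
    proof -
      have "z n \<ominus>\<^bsub>C\<^esub> [p] \<cdot>\<^bsub>C\<^esub> z (Suc n) =
        (w x (Suc n) \<ominus>\<^bsub>C\<^esub> [p] \<cdot>\<^bsub>C\<^esub> w x (Suc (Suc n))) \<ominus>\<^bsub>C\<^esub> W (w (s x) n \<ominus>\<^bsub>C\<^esub> [p] \<cdot>\<^bsub>C\<^esub> w (s x) (Suc n))"
        unfolding z_def using wC[OF x] wC[OF s[OF x]]
        by (simp add: W.hom_minus W.hom_add_pow a_minus_def C.add.nat_pow_distrib C.add.nat_pow_inv C.minus_add C.a_ac)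
      also have "\<dots> = y x (Suc n) \<ominus>\<^bsub>C\<^esub> W (y (s x) n)"
        by (simp add: wy x s)
      also have "y x (Suc n) = W (y (s x) n)"
        by (simp add: y_def funpow_swap1)
      finally show ?thesis using yC[OF s[OF x]] by (simp add: a_minus_def C.r_neg)
    qed
    then have "z n = \<zero>\<^bsub>C\<^esub>" by (rule derived_completeD_zero[where x = z, OF complete_C zC])
    then show ?thesis
      unfolding z_def by (rule C.minus_eq_zeroD) (use x s wC in auto)
  qed
  show thesis
  proof (rule that[of "\<lambda>x. w x 0"])
    fix x assume x: "x \<in> X"
    show "w x 0 \<in> carrier C" by (rule wC[OF x])
    have "w x 0 = (w x 0 \<ominus>\<^bsub>C\<^esub> [p] \<cdot>\<^bsub>C\<^esub> w x 1) \<oplus>\<^bsub>C\<^esub> [p] \<cdot>\<^bsub>C\<^esub> w x 1"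
      using wC[OF x] by (simp add: a_minus_def C.a_assoc C.l_neg)
    also have "\<dots> = f x \<oplus>\<^bsub>C\<^esub> T (w (s x) 0)"
      using wy[OF x, of 0] shift[OF x, of 0] by (simp add: y_def T_def)
    finally show "w x 0 = f x \<oplus>\<^bsub>C\<^esub> T (w (s x) 0)" .
  qed
qed

end

section \<open>Changing the scalar multiplication\<close>

text \<open>Different scalar multiplications on the same additive group. The fields other than \<open>smult\<close>
  are filled as in \<open>coker_module\<close>, so that the latter is an instance.\<close>

definition module_on :: "('c, 'm) ring_scheme \<Rightarrow> ('r \<Rightarrow> 'c \<Rightarrow> 'c) \<Rightarrow> ('r, 'c) module" where
  "module_on C sm = \<lparr>carrier = carrier C, mult = undefined, one = undefined,
     zero = zero C, add = add C, smult = sm\<rparr>"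

lemma module_on_simps [simp]:
  "carrier (module_on C sm) = carrier C" "zero (module_on C sm) = zero C"
  "add (module_on C sm) = add C" "smult (module_on C sm) = sm"
  by (simp_all add: module_on_def)

lemma a_inv_module_on [simp]: "a_inv (module_on C sm) = a_inv C"
  by (simp add: a_inv_def m_inv_def fun_eq_iff)

lemma a_minus_module_on [simp]: "a_minus (module_on C sm) = a_minus C"
  by (simp add: a_minus_def fun_eq_iff)

lemma add_pow_module_on [simp]:
  "add_pow (module_on C sm) = (add_pow C :: nat \<Rightarrow> _)"
  by (simp add: add_pow_def nat_pow_def fun_eq_iff)

lemma derived_complete_module_on [simp]:
  "derived_complete p (module_on C sm) \<longleftrightarrow> derived_complete p C"
  by (simp add: derived_complete_def)

lemma abelian_group_module_on: "abelian_group C \<Longrightarrow> abelian_group (module_on C sm)"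
  using abelian_groupE[of C] by (intro abelian_groupI) auto

context cartier_cokernel
begin

section \<open>The multiplication\<close>

text \<open>The tails of two decompositions differ by an element of \<open>\<iota> A\<close>, because an element of \<open>B\<close> whose image under
  \<open>V\<close> lies in \<open>\<iota> A\<close> lies in \<open>\<iota> A\<close> itself.\<close>

lemma decompose_unique:
  assumes "a \<in> carrier A" "b \<in> carrier A" "y \<in> carrier B" "z \<in> carrier B"
    and eq: "\<iota> a \<oplus>\<^bsub>B\<^esub> VB y = \<iota> b \<oplus>\<^bsub>B\<^esub> VB z"
  obtains u where "u \<in> carrier A" "z = y \<oplus>\<^bsub>B\<^esub> \<iota> u" "\<iota> a = \<iota> (b \<oplus>\<^bsub>A\<^esub> VA u)"
proof -
  have "VB (z \<ominus>\<^bsub>B\<^esub> y) = \<iota> (a \<ominus>\<^bsub>A\<^esub> b)"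
  proof -
    have "VB (z \<ominus>\<^bsub>B\<^esub> y) = (\<iota> b \<oplus>\<^bsub>B\<^esub> VB z) \<ominus>\<^bsub>B\<^esub> VB y \<ominus>\<^bsub>B\<^esub> \<iota> b"
      using assms(1-4) B.r_neg2[of "\<iota> b" "VB z \<ominus>\<^bsub>B\<^esub> VB y"]
      by (simp add: B.V.hom_minus a_minus_def B.a_ac)
    also have "\<dots> = (\<iota> a \<oplus>\<^bsub>B\<^esub> VB y) \<ominus>\<^bsub>B\<^esub> VB y \<ominus>\<^bsub>B\<^esub> \<iota> b"
      by (simp add: eq)
    also have "\<dots> = \<iota> (a \<ominus>\<^bsub>A\<^esub> b)"
      using assms(1-4) by (simp add: iota.ring.hom_minus a_minus_def B.a_assoc B.r_neg)
    finally show ?thesis .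
  qed
  then have "VB (z \<ominus>\<^bsub>B\<^esub> y) \<in> \<iota> ` carrier A"
    using assms(1,2) by auto
  then have "z \<ominus>\<^bsub>B\<^esub> y \<in> \<iota> ` carrier A"
    by (rule strict[rotated]) (use assms(3,4) in simp)
  then obtain u where u: "u \<in> carrier A" "z \<ominus>\<^bsub>B\<^esub> y = \<iota> u" by blast
  have z: "z = y \<oplus>\<^bsub>B\<^esub> \<iota> u"
    using assms(3,4) by (simp add: u(2)[symmetric] a_minus_def B.a_lcomm[of y z] B.r_neg)
  have "VB y \<oplus>\<^bsub>B\<^esub> \<iota> a = VB y \<oplus>\<^bsub>B\<^esub> \<iota> (b \<oplus>\<^bsub>A\<^esub> VA u)"
    using eq assms(1-4) u(1) by (simp add: z iota_V B.a_ac)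
  then have "\<iota> a = \<iota> (b \<oplus>\<^bsub>A\<^esub> VA u)"
    using assms(1-4) u(1) by (simp del: iota.hom_add iota.ring.hom_add)
  with u(1) z show thesis by (rule that)
qed

text \<open>Corecursion along a fixed choice of decompositions produces a map \<open>h\<close>. To see that \<open>h\<close> satisfies the
  recursion for all decompositions, one needs \<open>h (x + \<iota> t) m = h x m + t m\<close>, which is itself a
  bisimulation.\<close>

lemma mul_exists:
  "\<exists>h. (\<forall>x\<in>carrier B. \<forall>m\<in>carrier C. h x m \<in> carrier C) \<and>
    (\<forall>a\<in>carrier A. \<forall>y\<in>carrier B. \<forall>m\<in>carrier C.
      h (\<iota> a \<oplus>\<^bsub>B\<^esub> VB y) m = act a m \<oplus>\<^bsub>C\<^esub> T (h y (\<phi> m)))"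
proof -
  obtain r s where rs: "\<And>x. x \<in> carrier B \<Longrightarrow> r x \<in> carrier A \<and> s x \<in> carrier B \<and> x = \<iota> (r x) \<oplus>\<^bsub>B\<^esub> VB (s x)"
    using decompose by metis
  have rs_in: "r x \<in> carrier A" "s x \<in> carrier B" if "x \<in> carrier B" for x
    using rs[OF that] by blast+
  have rs_eq: "x = \<iota> (r x) \<oplus>\<^bsub>B\<^esub> VB (s x)" if "x \<in> carrier B" for x
    using rs[OF that] by blast
  have cancel: "b \<oplus>\<^bsub>C\<^esub> (c \<oplus>\<^bsub>C\<^esub> \<ominus>\<^bsub>C\<^esub> b) = c" if "b \<in> carrier C" "c \<in> carrier C" for b c
    using that by (simp add: C.a_lcomm[of b c] C.r_neg)
  obtain g where g: "\<And>x. x \<in> carrier B \<times> carrier C \<Longrightarrow> g x \<in> carrier C"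
    "\<And>x. x \<in> carrier B \<times> carrier C \<Longrightarrow>
       g x = (case x of (x, m) \<Rightarrow> act (r x) m) \<oplus>\<^bsub>C\<^esub> T (g (case x of (x, m) \<Rightarrow> (s x, \<phi> m)))"
  proof (rule corecursion[of "carrier B \<times> carrier C" "\<lambda>(x, m). act (r x) m" "\<lambda>(x, m). (s x, \<phi> m)"])
    fix z assume "z \<in> carrier B \<times> carrier C"
    then show "(case z of (x, m) \<Rightarrow> act (r x) m) \<in> carrier C"
      and "(case z of (x, m) \<Rightarrow> (s x, \<phi> m)) \<in> carrier B \<times> carrier C"
      by (auto simp: rs_in)
  qed (rule that)
  define h where "h x m = g (x, m)" for x m
  have hC [simp]: "h x m \<in> carrier C" if "x \<in> carrier B" "m \<in> carrier C" for x m
    using that g(1) by (simp add: h_def)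
  have h: "h x m = act (r x) m \<oplus>\<^bsub>C\<^esub> T (h (s x) (\<phi> m))" if "x \<in> carrier B" "m \<in> carrier C" for x m
    using that g(2)[of "(x, m)"] by (simp add: h_def)
  have "h (fst i \<oplus>\<^bsub>B\<^esub> \<iota> (fst (snd i))) (snd (snd i)) = h (fst i) (snd (snd i)) \<oplus>\<^bsub>C\<^esub> act (fst (snd i)) (snd (snd i))"
    if "i \<in> carrier B \<times> carrier A \<times> carrier C" for i
    using that
  proof (rule bisimulation_family_one[where P = "\<lambda>i. i \<in> carrier B \<times> carrier A \<times> carrier C"])
    fix i assume "i \<in> carrier B \<times> carrier A \<times> carrier C"
    then obtain x t m where i: "i = (x, t, m)"
      and [simp]: "x \<in> carrier B" "t \<in> carrier A" "m \<in> carrier C" by auto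
    define x' where "x' = x \<oplus>\<^bsub>B\<^esub> \<iota> t"
    have [simp]: "x' \<in> carrier B" by (simp add: x'_def)
    have [simp]: "r x \<in> carrier A" "s x \<in> carrier B" "r x' \<in> carrier A" "s x' \<in> carrier B"
      by (simp_all add: rs_in)
    have "\<iota> (r x \<oplus>\<^bsub>A\<^esub> t) \<oplus>\<^bsub>B\<^esub> VB (s x) = (\<iota> (r x) \<oplus>\<^bsub>B\<^esub> VB (s x)) \<oplus>\<^bsub>B\<^esub> \<iota> t"
      by (simp add: B.a_ac)
    also have "\<dots> = x'" by (simp add: x'_def rs_eq[of x, symmetric])
    also have "x' = \<iota> (r x') \<oplus>\<^bsub>B\<^esub> VB (s x')" by (rule rs_eq) simp
    finally obtain w where w: "w \<in> carrier A" "s x' = s x \<oplus>\<^bsub>B\<^esub> \<iota> w"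
      "\<iota> (r x \<oplus>\<^bsub>A\<^esub> t) = \<iota> (r x' \<oplus>\<^bsub>A\<^esub> VA w)"
      by (rule decompose_unique[rotated 4]) auto
    \<comment> \<open>Moving the difference \<open>w\<close> of the two tails to the other side lets both expressions start
      with the same \<open>c\<close>.\<close>
    define c where "c = act (r x) m \<oplus>\<^bsub>C\<^esub> act t m \<ominus>\<^bsub>C\<^esub> T (act w (\<phi> m))"
    have "act (r x) m \<oplus>\<^bsub>C\<^esub> act t m = act (r x') m \<oplus>\<^bsub>C\<^esub> T (act w (\<phi> m))"
      using act_cong[OF w(3), of m] w(1) by (simp add: act_add_left act_V)
    then have c: "act (r x') m = c"
      using w(1) by (simp add: c_def a_minus_def C.a_assoc C.r_neg)
    have "h x' m = c \<oplus>\<^bsub>C\<^esub> T (h (s x \<oplus>\<^bsub>B\<^esub> \<iota> w) (\<phi> m))"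
      by (subst h) (simp_all add: c w(2))
    moreover have "h x m \<oplus>\<^bsub>C\<^esub> act t m = c \<oplus>\<^bsub>C\<^esub> T (h (s x) (\<phi> m) \<oplus>\<^bsub>C\<^esub> act w (\<phi> m))"
      using w(1) by (subst h) (simp_all add: c_def a_minus_def C.a_ac cancel)
    moreover have "c \<in> carrier C" using w(1) by (simp add: c_def)
    ultimately show "\<exists>c\<in>carrier C. \<exists>j. j \<in> carrier B \<times> carrier A \<times> carrier C \<and>
        h (fst i \<oplus>\<^bsub>B\<^esub> \<iota> (fst (snd i))) (snd (snd i)) =
          c \<oplus>\<^bsub>C\<^esub> T (h (fst j \<oplus>\<^bsub>B\<^esub> \<iota> (fst (snd j))) (snd (snd j))) \<and>
        h (fst i) (snd (snd i)) \<oplus>\<^bsub>C\<^esub> act (fst (snd i)) (snd (snd i)) =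
          c \<oplus>\<^bsub>C\<^esub> T (h (fst j) (snd (snd j)) \<oplus>\<^bsub>C\<^esub> act (fst (snd j)) (snd (snd j)))"
      using w(1) by (intro bexI[of _ c] exI[of _ "(s x, w, \<phi> m)"]) (simp_all add: i x'_def del: T.hom_add)
  qed auto
  then have shift: "h (x \<oplus>\<^bsub>B\<^esub> \<iota> t) m = h x m \<oplus>\<^bsub>C\<^esub> act t m"
    if "x \<in> carrier B" "t \<in> carrier A" "m \<in> carrier C" for x t m
    using that by (metis SigmaI fst_conv snd_conv)
  have "h (\<iota> a \<oplus>\<^bsub>B\<^esub> VB y) m = act a m \<oplus>\<^bsub>C\<^esub> T (h y (\<phi> m))"
    if [simp]: "a \<in> carrier A" "y \<in> carrier B" "m \<in> carrier C" for a y m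
  proof -
    define x where "x = \<iota> a \<oplus>\<^bsub>B\<^esub> VB y"
    have [simp]: "x \<in> carrier B" by (simp add: x_def)
    have [simp]: "r x \<in> carrier A" "s x \<in> carrier B" by (simp_all add: rs_in)
    have "\<iota> a \<oplus>\<^bsub>B\<^esub> VB y = \<iota> (r x) \<oplus>\<^bsub>B\<^esub> VB (s x)"
      unfolding x_def[symmetric] by (rule rs_eq) simp
    then obtain w where w: "w \<in> carrier A" "s x = y \<oplus>\<^bsub>B\<^esub> \<iota> w" "\<iota> a = \<iota> (r x \<oplus>\<^bsub>A\<^esub> VA w)"
      by (rule decompose_unique[rotated 4]) auto
    have "h x m = act (r x) m \<oplus>\<^bsub>C\<^esub> T (h y (\<phi> m) \<oplus>\<^bsub>C\<^esub> act w (\<phi> m))"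
      using w(1) by (subst h) (simp_all add: w(2) shift)
    also have "\<dots> = act a m \<oplus>\<^bsub>C\<^esub> T (h y (\<phi> m))"
      using act_cong[OF w(3), of m] w(1) by (simp add: act_add_left act_V C.a_ac)
    finally show ?thesis by (simp add: x_def)
  qed
  then show ?thesis
    by (intro exI[of _ h]) simp
qed

definition mul where
  "mul = (SOME h. (\<forall>x\<in>carrier B. \<forall>m\<in>carrier C. h x m \<in> carrier C) \<and>
    (\<forall>a\<in>carrier A. \<forall>y\<in>carrier B. \<forall>m\<in>carrier C.
      h (\<iota> a \<oplus>\<^bsub>B\<^esub> VB y) m = act a m \<oplus>\<^bsub>C\<^esub> T (h y (\<phi> m))))"

lemma mul_closed [simp, intro]: "\<lbrakk>x \<in> carrier B; m \<in> carrier C\<rbrakk> \<Longrightarrow> mul x m \<in> carrier C"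
  and mul_rec: "\<lbrakk>a \<in> carrier A; y \<in> carrier B; m \<in> carrier C\<rbrakk> \<Longrightarrow>
      mul (\<iota> a \<oplus>\<^bsub>B\<^esub> VB y) m = act a m \<oplus>\<^bsub>C\<^esub> T (mul y (\<phi> m))"
  using someI_ex[OF mul_exists, folded mul_def] by blast+

lemma B_cases:
  assumes "x \<in> carrier B"
  obtains a y where "a \<in> carrier A" "y \<in> carrier B" "x = \<iota> a \<oplus>\<^bsub>B\<^esub> VB y"
  using decompose[OF assms] by blast

text \<open>Variants of the bisimulation principle for families indexed by three variables; the
  identities below involve at most three.\<close>

lemma bisimulation3:
  assumes P: "P x y m" and C: "\<And>x y m. P x y m \<Longrightarrow> f x y m \<in> carrier C \<and> g x y m \<in> carrier C"
    and step: "\<And>x y m. P x y m \<Longrightarrow> \<exists>c\<in>carrier C. \<exists>(k::nat) x' y' m'. P x' y' m' \<and>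
      f x y m = c \<oplus>\<^bsub>C\<^esub> [k] \<cdot>\<^bsub>C\<^esub> T (f x' y' m') \<and> g x y m = c \<oplus>\<^bsub>C\<^esub> [k] \<cdot>\<^bsub>C\<^esub> T (g x' y' m')"
  shows "f x y m = g x y m"
proof -
  have "(case (x, y, m) of (x, y, m) \<Rightarrow> f x y m) = (case (x, y, m) of (x, y, m) \<Rightarrow> g x y m)"
  proof (rule bisimulation_family[where P = "\<lambda>(x, y, m). P x y m"])
    fix i assume i: "case i of (x, y, m) \<Rightarrow> P x y m"
    obtain x y m where [simp]: "i = (x, y, m)" by (cases i)
    with i step[of x y m] show "\<exists>c\<in>carrier C. \<exists>(k::nat) j. (case j of (x, y, m) \<Rightarrow> P x y m) \<and>
        (case i of (x, y, m) \<Rightarrow> f x y m) = c \<oplus>\<^bsub>C\<^esub> [k] \<cdot>\<^bsub>C\<^esub> T (case j of (x, y, m) \<Rightarrow> f x y m) \<and>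
        (case i of (x, y, m) \<Rightarrow> g x y m) = c \<oplus>\<^bsub>C\<^esub> [k] \<cdot>\<^bsub>C\<^esub> T (case j of (x, y, m) \<Rightarrow> g x y m)"
      by fastforce
  qed (use P C in auto)
  then show ?thesis by simp
qed

lemma bisimulation3_one:
  assumes P: "P x y m" and C: "\<And>x y m. P x y m \<Longrightarrow> f x y m \<in> carrier C \<and> g x y m \<in> carrier C"
    and step: "\<And>x y m. P x y m \<Longrightarrow> \<exists>c\<in>carrier C. \<exists>x' y' m'. P x' y' m' \<and>
      f x y m = c \<oplus>\<^bsub>C\<^esub> T (f x' y' m') \<and> g x y m = c \<oplus>\<^bsub>C\<^esub> T (g x' y' m')"
  shows "f x y m = g x y m"
proof -
  have "(case (x, y, m) of (x, y, m) \<Rightarrow> f x y m) = (case (x, y, m) of (x, y, m) \<Rightarrow> g x y m)"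
  proof (rule bisimulation_family_one[where P = "\<lambda>(x, y, m). P x y m"])
    fix i assume i: "case i of (x, y, m) \<Rightarrow> P x y m"
    obtain x y m where [simp]: "i = (x, y, m)" by (cases i)
    with i step[of x y m] show "\<exists>c\<in>carrier C. \<exists>j. (case j of (x, y, m) \<Rightarrow> P x y m) \<and>
        (case i of (x, y, m) \<Rightarrow> f x y m) = c \<oplus>\<^bsub>C\<^esub> T (case j of (x, y, m) \<Rightarrow> f x y m) \<and>
        (case i of (x, y, m) \<Rightarrow> g x y m) = c \<oplus>\<^bsub>C\<^esub> T (case j of (x, y, m) \<Rightarrow> g x y m)"
      by fastforce
  qed (use P C in auto)
  then show ?thesis by simp
qed

lemma B_pi: "B.frob_V_one = \<iota> A.frob_V_one"
  by (simp add: iota_frob iota_V)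

lemma mult_decompose:
  assumes [simp]: "a \<in> carrier A" "b \<in> carrier A" "x \<in> carrier B" "y \<in> carrier B"
  shows "(\<iota> a \<oplus>\<^bsub>B\<^esub> VB x) \<otimes>\<^bsub>B\<^esub> (\<iota> b \<oplus>\<^bsub>B\<^esub> VB y) = \<iota> (a \<otimes>\<^bsub>A\<^esub> b) \<oplus>\<^bsub>B\<^esub>
    VB (\<iota> (A.F a) \<otimes>\<^bsub>B\<^esub> y \<oplus>\<^bsub>B\<^esub> \<iota> (A.F b) \<otimes>\<^bsub>B\<^esub> x \<oplus>\<^bsub>B\<^esub> \<iota> A.frob_V_one \<otimes>\<^bsub>B\<^esub> (x \<otimes>\<^bsub>B\<^esub> y))"
proof -
  have "\<iota> a \<otimes>\<^bsub>B\<^esub> VB y = VB (\<iota> (A.F a) \<otimes>\<^bsub>B\<^esub> y)"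
    by (simp add: B.V_linear iota_frob)
  moreover have "VB x \<otimes>\<^bsub>B\<^esub> \<iota> b = VB (\<iota> (A.F b) \<otimes>\<^bsub>B\<^esub> x)"
    by (simp add: B.V_linear iota_frob B.m_comm[of "VB x"])
  moreover have "VB x \<otimes>\<^bsub>B\<^esub> VB y = VB (\<iota> A.frob_V_one \<otimes>\<^bsub>B\<^esub> (x \<otimes>\<^bsub>B\<^esub> y))"
    using B.V_mult_V[of x y] by (simp add: B_pi)
  ultimately show ?thesis
    by (simp add: B.l_distr B.r_distr B.a_ac)
qed

lemma mul_add_left:
  assumes "x \<in> carrier B" "y \<in> carrier B" "m \<in> carrier C"
  shows "mul (x \<oplus>\<^bsub>B\<^esub> y) m = mul x m \<oplus>\<^bsub>C\<^esub> mul y m"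
proof (rule bisimulation3_one[where P = "\<lambda>x y m. x \<in> carrier B \<and> y \<in> carrier B \<and> m \<in> carrier C"
      and f = "\<lambda>x y m. mul (x \<oplus>\<^bsub>B\<^esub> y) m" and g = "\<lambda>x y m. mul x m \<oplus>\<^bsub>C\<^esub> mul y m"])
  fix x y m assume *: "x \<in> carrier B \<and> y \<in> carrier B \<and> m \<in> carrier C"
  then obtain a x' b y' where xy: "x = \<iota> a \<oplus>\<^bsub>B\<^esub> VB x'" "y = \<iota> b \<oplus>\<^bsub>B\<^esub> VB y'"
    and [simp]: "a \<in> carrier A" "x' \<in> carrier B" "b \<in> carrier A" "y' \<in> carrier B"
    by (metis B_cases)
  from * have [simp]: "m \<in> carrier C" by simp
  have "x \<oplus>\<^bsub>B\<^esub> y = \<iota> (a \<oplus>\<^bsub>A\<^esub> b) \<oplus>\<^bsub>B\<^esub> VB (x' \<oplus>\<^bsub>B\<^esub> y')"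
    by (simp add: xy B.a_ac)
  then have "mul (x \<oplus>\<^bsub>B\<^esub> y) m = (act a m \<oplus>\<^bsub>C\<^esub> act b m) \<oplus>\<^bsub>C\<^esub> T (mul (x' \<oplus>\<^bsub>B\<^esub> y') (\<phi> m))"
    by (simp add: mul_rec act_add_left del: iota.hom_add iota.ring.hom_add B.V.hom_add)
  moreover have "mul x m \<oplus>\<^bsub>C\<^esub> mul y m = (act a m \<oplus>\<^bsub>C\<^esub> act b m) \<oplus>\<^bsub>C\<^esub> T (mul x' (\<phi> m) \<oplus>\<^bsub>C\<^esub> mul y' (\<phi> m))"
    by (simp add: xy mul_rec C.a_ac)
  ultimately show "\<exists>c\<in>carrier C. \<exists>x' y' m'. (x' \<in> carrier B \<and> y' \<in> carrier B \<and> m' \<in> carrier C) \<and>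
      mul (x \<oplus>\<^bsub>B\<^esub> y) m = c \<oplus>\<^bsub>C\<^esub> T (mul (x' \<oplus>\<^bsub>B\<^esub> y') m') \<and>
      mul x m \<oplus>\<^bsub>C\<^esub> mul y m = c \<oplus>\<^bsub>C\<^esub> T (mul x' m' \<oplus>\<^bsub>C\<^esub> mul y' m')"
    by (intro bexI[of _ "act a m \<oplus>\<^bsub>C\<^esub> act b m"] exI[of _ x'] exI[of _ y'] exI[of _ "\<phi> m"]) simp_all
qed (use assms in auto)

lemma mul_add_right:
  assumes "x \<in> carrier B" "n \<in> carrier C" "m \<in> carrier C"
  shows "mul x (n \<oplus>\<^bsub>C\<^esub> m) = mul x n \<oplus>\<^bsub>C\<^esub> mul x m"
proof (rule bisimulation3_one[where P = "\<lambda>x n m. x \<in> carrier B \<and> n \<in> carrier C \<and> m \<in> carrier C"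
      and f = "\<lambda>x n m. mul x (n \<oplus>\<^bsub>C\<^esub> m)" and g = "\<lambda>x n m. mul x n \<oplus>\<^bsub>C\<^esub> mul x m"])
  fix x n m assume *: "x \<in> carrier B \<and> n \<in> carrier C \<and> m \<in> carrier C"
  then obtain a y where x: "x = \<iota> a \<oplus>\<^bsub>B\<^esub> VB y" and [simp]: "a \<in> carrier A" "y \<in> carrier B"
    by (metis B_cases)
  from * have [simp]: "m \<in> carrier C" "n \<in> carrier C" by simp_all
  have "mul x (n \<oplus>\<^bsub>C\<^esub> m) = (act a n \<oplus>\<^bsub>C\<^esub> act a m) \<oplus>\<^bsub>C\<^esub> T (mul y (\<phi> n \<oplus>\<^bsub>C\<^esub> \<phi> m))"
    by (simp add: x mul_rec act_add_right)
  moreover have "mul x n \<oplus>\<^bsub>C\<^esub> mul x m = (act a n \<oplus>\<^bsub>C\<^esub> act a m) \<oplus>\<^bsub>C\<^esub> T (mul y (\<phi> n) \<oplus>\<^bsub>C\<^esub> mul y (\<phi> m))"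
    by (simp add: x mul_rec C.a_ac)
  ultimately show "\<exists>c\<in>carrier C. \<exists>x' n' m'. (x' \<in> carrier B \<and> n' \<in> carrier C \<and> m' \<in> carrier C) \<and>
      mul x (n \<oplus>\<^bsub>C\<^esub> m) = c \<oplus>\<^bsub>C\<^esub> T (mul x' (n' \<oplus>\<^bsub>C\<^esub> m')) \<and>
      mul x n \<oplus>\<^bsub>C\<^esub> mul x m = c \<oplus>\<^bsub>C\<^esub> T (mul x' n' \<oplus>\<^bsub>C\<^esub> mul x' m')"
    by (intro bexI[of _ "act a n \<oplus>\<^bsub>C\<^esub> act a m"] exI[of _ y] exI[of _ "\<phi> n"] exI[of _ "\<phi> m"]) simp_all
qed (use assms in auto)

lemma mul_hom_left: "m \<in> carrier C \<Longrightarrow> abelian_group_hom B C (\<lambda>x. mul x m)"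
  by (intro abelian_group_homI_hom B.is_abelian_group C.abelian_group_axioms homI)
     (auto simp: mul_add_left)

lemma mul_hom_right: "x \<in> carrier B \<Longrightarrow> abelian_group_hom C C (mul x)"
  by (intro abelian_group_homI_hom C.abelian_group_axioms homI)
     (auto simp: mul_add_right)

lemmas mul_zero_left = abelian_group_hom.hom_zero[OF mul_hom_left]
lemmas mul_zero_right = abelian_group_hom.hom_zero[OF mul_hom_right]
lemmas mul_minus_left = abelian_group_hom.hom_minus[OF mul_hom_left]
lemmas mul_add_pow_right = abelian_group_hom.hom_add_pow[OF mul_hom_right]

lemma mul_iota: "\<lbrakk>a \<in> carrier A; m \<in> carrier C\<rbrakk> \<Longrightarrow> mul (\<iota> a) m = act a m"
  using mul_rec[of a "\<zero>\<^bsub>B\<^esub>" m] by (simp add: mul_zero_left)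

lemma mul_act_left:
  assumes "a \<in> carrier A" "x \<in> carrier B" "m \<in> carrier C"
  shows "mul (\<iota> a \<otimes>\<^bsub>B\<^esub> x) m = act a (mul x m)"
proof (rule bisimulation3_one[where P = "\<lambda>a x m. a \<in> carrier A \<and> x \<in> carrier B \<and> m \<in> carrier C"
      and f = "\<lambda>a x m. mul (\<iota> a \<otimes>\<^bsub>B\<^esub> x) m" and g = "\<lambda>a x m. act a (mul x m)"])
  fix a x m assume *: "a \<in> carrier A \<and> x \<in> carrier B \<and> m \<in> carrier C"
  then obtain b y where x: "x = \<iota> b \<oplus>\<^bsub>B\<^esub> VB y" and [simp]: "b \<in> carrier A" "y \<in> carrier B"
    by (metis B_cases)
  from * have [simp]: "m \<in> carrier C" "a \<in> carrier A" by simp_all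
  have "\<iota> a \<otimes>\<^bsub>B\<^esub> x = \<iota> (a \<otimes>\<^bsub>A\<^esub> b) \<oplus>\<^bsub>B\<^esub> VB (\<iota> (A.F a) \<otimes>\<^bsub>B\<^esub> y)"
    by (simp add: x B.r_distr B.V_linear iota_frob)
  then have "mul (\<iota> a \<otimes>\<^bsub>B\<^esub> x) m = act a (act b m) \<oplus>\<^bsub>C\<^esub> T (mul (\<iota> (A.F a) \<otimes>\<^bsub>B\<^esub> y) (\<phi> m))"
    by (simp add: mul_rec act_mult del: iota.hom_mult iota.ring.hom_mult)
  moreover have "act a (mul x m) = act a (act b m) \<oplus>\<^bsub>C\<^esub> T (act (A.F a) (mul y (\<phi> m)))"
    by (simp add: x mul_rec act_add_right act_T)
  ultimately show "\<exists>c\<in>carrier C. \<exists>a' x' m'. (a' \<in> carrier A \<and> x' \<in> carrier B \<and> m' \<in> carrier C) \<and>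
      mul (\<iota> a \<otimes>\<^bsub>B\<^esub> x) m = c \<oplus>\<^bsub>C\<^esub> T (mul (\<iota> a' \<otimes>\<^bsub>B\<^esub> x') m') \<and>
      act a (mul x m) = c \<oplus>\<^bsub>C\<^esub> T (act a' (mul x' m'))"
    by (intro bexI[of _ "act a (act b m)"] exI[of _ "A.F a"] exI[of _ y] exI[of _ "\<phi> m"]) simp_all
qed (use assms in auto)

lemma mul_act_right:
  assumes "a \<in> carrier A" "x \<in> carrier B" "m \<in> carrier C"
  shows "mul x (act a m) = act a (mul x m)"
proof (rule bisimulation3_one[where P = "\<lambda>a x m. a \<in> carrier A \<and> x \<in> carrier B \<and> m \<in> carrier C"
      and f = "\<lambda>a x m. mul x (act a m)" and g = "\<lambda>a x m. act a (mul x m)"])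
  fix a x m assume *: "a \<in> carrier A \<and> x \<in> carrier B \<and> m \<in> carrier C"
  then obtain b y where x: "x = \<iota> b \<oplus>\<^bsub>B\<^esub> VB y" and [simp]: "b \<in> carrier A" "y \<in> carrier B"
    by (metis B_cases)
  from * have [simp]: "m \<in> carrier C" "a \<in> carrier A" by simp_all
  have "mul x (act a m) = act a (act b m) \<oplus>\<^bsub>C\<^esub> T (mul y (act (A.F a) (\<phi> m)))"
    by (simp add: x mul_rec act_mult[symmetric] A.m_comm[of a b] phi_act)
  moreover have "act a (mul x m) = act a (act b m) \<oplus>\<^bsub>C\<^esub> T (act (A.F a) (mul y (\<phi> m)))"
    by (simp add: x mul_rec act_add_right act_T)
  ultimately show "\<exists>c\<in>carrier C. \<exists>a' x' m'. (a' \<in> carrier A \<and> x' \<in> carrier B \<and> m' \<in> carrier C) \<and>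
      mul x (act a m) = c \<oplus>\<^bsub>C\<^esub> T (mul x' (act a' m')) \<and>
      act a (mul x m) = c \<oplus>\<^bsub>C\<^esub> T (act a' (mul x' m'))"
    by (intro bexI[of _ "act a (act b m)"] exI[of _ "A.F a"] exI[of _ y] exI[of _ "\<phi> m"]) simp_all
qed (use assms in auto)

text \<open>Expanding both sides over the decompositions of \<open>x\<close> and \<open>y\<close>, the terms that are linear in a tail agree by
  \<open>A\<close>-linearity. The remaining term comes from the product of the two tails with the factor \<open>\<pi>\<close> on the
  left and from \<open>\<phi> T = p\<close> on the right, so the recursion has the multiplicity \<open>k = p\<close>.\<close>

lemma mul_assoc:
  assumes "x \<in> carrier B" "y \<in> carrier B" "m \<in> carrier C"
  shows "mul (x \<otimes>\<^bsub>B\<^esub> y) m = mul x (mul y m)"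
proof (rule bisimulation3[where P = "\<lambda>x y m. x \<in> carrier B \<and> y \<in> carrier B \<and> m \<in> carrier C"
      and f = "\<lambda>x y m. mul (x \<otimes>\<^bsub>B\<^esub> y) m" and g = "\<lambda>x y m. mul x (mul y m)"])
  fix x y m assume *: "x \<in> carrier B \<and> y \<in> carrier B \<and> m \<in> carrier C"
  then obtain a x' b y' where xy: "x = \<iota> a \<oplus>\<^bsub>B\<^esub> VB x'" "y = \<iota> b \<oplus>\<^bsub>B\<^esub> VB y'"
    and [simp]: "a \<in> carrier A" "x' \<in> carrier B" "b \<in> carrier A" "y' \<in> carrier B"
    by (metis B_cases)
  from * have [simp]: "m \<in> carrier C" by simp
  define c where "c = act a (act b m) \<oplus>\<^bsub>C\<^esub> (T (act (A.F a) (mul y' (\<phi> m))) \<oplus>\<^bsub>C\<^esub> T (act (A.F b) (mul x' (\<phi> m))))"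
  have [simp]: "c \<in> carrier C" by (simp add: c_def)
  have "mul (x \<otimes>\<^bsub>B\<^esub> y) m = act a (act b m) \<oplus>\<^bsub>C\<^esub>
      T (mul (\<iota> (A.F a) \<otimes>\<^bsub>B\<^esub> y' \<oplus>\<^bsub>B\<^esub> \<iota> (A.F b) \<otimes>\<^bsub>B\<^esub> x' \<oplus>\<^bsub>B\<^esub> \<iota> A.frob_V_one \<otimes>\<^bsub>B\<^esub> (x' \<otimes>\<^bsub>B\<^esub> y')) (\<phi> m))"
    unfolding xy mult_decompose[OF \<open>a \<in> carrier A\<close> \<open>b \<in> carrier A\<close> \<open>x' \<in> carrier B\<close> \<open>y' \<in> carrier B\<close>]
    by (subst mul_rec) (simp_all add: act_mult)
  also have "\<dots> = c \<oplus>\<^bsub>C\<^esub> [p] \<cdot>\<^bsub>C\<^esub> T (mul (x' \<otimes>\<^bsub>B\<^esub> y') (\<phi> m))"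
    by (simp add: c_def mul_add_left mul_act_left act_pi T.hom_add_pow C.a_assoc)
  finally have l: "mul (x \<otimes>\<^bsub>B\<^esub> y) m = c \<oplus>\<^bsub>C\<^esub> [p] \<cdot>\<^bsub>C\<^esub> T (mul (x' \<otimes>\<^bsub>B\<^esub> y') (\<phi> m))" .
  have "mul x (mul y m) = act a (act b m \<oplus>\<^bsub>C\<^esub> T (mul y' (\<phi> m))) \<oplus>\<^bsub>C\<^esub>
      T (mul x' (\<phi> (act b m \<oplus>\<^bsub>C\<^esub> T (mul y' (\<phi> m)))))"
    by (simp add: xy mul_rec)
  also have "\<phi> (act b m \<oplus>\<^bsub>C\<^esub> T (mul y' (\<phi> m))) = act (A.F b) (\<phi> m) \<oplus>\<^bsub>C\<^esub> [p] \<cdot>\<^bsub>C\<^esub> mul y' (\<phi> m)"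
    by (simp add: phi_act phi_T)
  also have "act a (act b m \<oplus>\<^bsub>C\<^esub> T (mul y' (\<phi> m))) \<oplus>\<^bsub>C\<^esub>
      T (mul x' (act (A.F b) (\<phi> m) \<oplus>\<^bsub>C\<^esub> [p] \<cdot>\<^bsub>C\<^esub> mul y' (\<phi> m))) = c \<oplus>\<^bsub>C\<^esub> [p] \<cdot>\<^bsub>C\<^esub> T (mul x' (mul y' (\<phi> m)))"
    by (simp add: c_def act_add_right act_T mul_add_right mul_act_right mul_add_pow_right T.hom_add_pow C.a_assoc)
  finally have r: "mul x (mul y m) = c \<oplus>\<^bsub>C\<^esub> [p] \<cdot>\<^bsub>C\<^esub> T (mul x' (mul y' (\<phi> m)))" .
  show "\<exists>c\<in>carrier C. \<exists>(k::nat) x' y' m'. (x' \<in> carrier B \<and> y' \<in> carrier B \<and> m' \<in> carrier C) \<and>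
      mul (x \<otimes>\<^bsub>B\<^esub> y) m = c \<oplus>\<^bsub>C\<^esub> [k] \<cdot>\<^bsub>C\<^esub> T (mul (x' \<otimes>\<^bsub>B\<^esub> y') m') \<and>
      mul x (mul y m) = c \<oplus>\<^bsub>C\<^esub> [k] \<cdot>\<^bsub>C\<^esub> T (mul x' (mul y' m'))"
    unfolding l r
    by (intro bexI[of _ c] exI[of _ p] exI[of _ x'] exI[of _ y'] exI[of _ "\<phi> m"]) simp_all
qed (use assms in auto)

lemma mul_one: "m \<in> carrier C \<Longrightarrow> mul \<one>\<^bsub>B\<^esub> m = m"
  using mul_iota[of "\<one>\<^bsub>A\<^esub>" m] by (simp add: act_one)

lemma phi_mul:
  assumes "x \<in> carrier B" and [simp]: "m \<in> carrier C"
  shows "\<phi> (mul x m) = mul (B.F x) (\<phi> m)"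
proof -
  obtain a y where x: "x = \<iota> a \<oplus>\<^bsub>B\<^esub> VB y" and [simp]: "a \<in> carrier A" "y \<in> carrier B"
    using assms by (metis B_cases)
  have "B.F x = \<iota> (A.F a) \<oplus>\<^bsub>B\<^esub> \<iota> A.frob_V_one \<otimes>\<^bsub>B\<^esub> y"
    by (simp add: x B.frob_add iota_frob[of a] B_frob_V)
  then have "mul (B.F x) (\<phi> m) = act (A.F a) (\<phi> m) \<oplus>\<^bsub>C\<^esub> [p] \<cdot>\<^bsub>C\<^esub> mul y (\<phi> m)"
    by (simp add: mul_add_left mul_iota mul_act_left act_pi)
  then show ?thesis
    by (simp add: x mul_rec phi_act phi_T)
qed

text \<open>Any such \<open>sm\<close> satisfies the recursion for \<open>mul\<close>: by semilinearity
  \<open>\<phi> (sm (V y) m) = sm (\<pi> y) (\<phi> m) = p (sm y (\<phi> m))\<close>, and applying \<open>W\<close> gives \<open>T (sm y (\<phi> m))\<close>.\<close>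

lemma mul_unique:
  assumes closed: "\<And>x m. \<lbrakk>x \<in> carrier B; m \<in> carrier C\<rbrakk> \<Longrightarrow> sm x m \<in> carrier C"
    and add: "\<And>x y m. \<lbrakk>x \<in> carrier B; y \<in> carrier B; m \<in> carrier C\<rbrakk> \<Longrightarrow> sm (x \<oplus>\<^bsub>B\<^esub> y) m = sm x m \<oplus>\<^bsub>C\<^esub> sm y m"
    and mult: "\<And>x y m. \<lbrakk>x \<in> carrier B; y \<in> carrier B; m \<in> carrier C\<rbrakk> \<Longrightarrow> sm (x \<otimes>\<^bsub>B\<^esub> y) m = sm x (sm y m)"
    and frob: "\<And>x m. \<lbrakk>x \<in> carrier B; m \<in> carrier C\<rbrakk> \<Longrightarrow> \<phi> (sm x m) = sm (B.F x) (\<phi> m)"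
    and iota: "\<And>a m. \<lbrakk>a \<in> carrier A; m \<in> carrier C\<rbrakk> \<Longrightarrow> sm (\<iota> a) m = act a m"
    and "x \<in> carrier B" "m \<in> carrier C"
  shows "sm x m = mul x m"
proof (rule bisimulation3_one[where P = "\<lambda>x (_::unit) m. x \<in> carrier B \<and> m \<in> carrier C"
      and f = "\<lambda>x _ m. sm x m" and g = "\<lambda>x _ m. mul x m"])
  fix x m assume *: "x \<in> carrier B \<and> m \<in> carrier C"
  then obtain a y where x: "x = \<iota> a \<oplus>\<^bsub>B\<^esub> VB y" and [simp]: "a \<in> carrier A" "y \<in> carrier B"
    by (metis B_cases)
  from * have [simp]: "m \<in> carrier C" by simp
  have "\<phi> (sm (VB y) m) = [p] \<cdot>\<^bsub>C\<^esub> sm y (\<phi> m)"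
    by (simp add: frob B_frob_V mult iota act_pi closed)
  then have "W (\<phi> (sm (VB y) m)) = W ([p] \<cdot>\<^bsub>C\<^esub> sm y (\<phi> m))"
    by (rule arg_cong)
  then have "sm (VB y) m = T (sm y (\<phi> m))"
    by (simp add: closed T_alt)
  then show "\<exists>c\<in>carrier C. \<exists>x' (_::unit) m'. (x' \<in> carrier B \<and> m' \<in> carrier C) \<and>
      sm x m = c \<oplus>\<^bsub>C\<^esub> T (sm x' m') \<and> mul x m = c \<oplus>\<^bsub>C\<^esub> T (mul x' m')"
    by (intro bexI[of _ "act a m"] exI[of _ y] exI[of _ "()"] exI[of _ "\<phi> m"]) (simp_all add: x mul_rec add iota)
qed (use assms in auto)

section \<open>The derivation\<close>

text \<open>The tail of \<open>x y\<close> consists of two terms linear in the tails of \<open>x\<close> and \<open>y\<close>, which match the leading terms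
  of \<open>x d y\<close> and \<open>y d x\<close>, and of \<open>\<pi>\<close> times the product of the tails, which gives \<open>T\<close> of the same
  problem.\<close>

lemma leibniz:
  assumes "x \<in> carrier B" "y \<in> carrier B"
  shows "d (x \<otimes>\<^bsub>B\<^esub> y) = mul x (d y) \<oplus>\<^bsub>C\<^esub> mul y (d x)"
proof (rule bisimulation3_one[where P = "\<lambda>x y (_::unit). x \<in> carrier B \<and> y \<in> carrier B"
      and f = "\<lambda>x y _. d (x \<otimes>\<^bsub>B\<^esub> y)" and g = "\<lambda>x y _. mul x (d y) \<oplus>\<^bsub>C\<^esub> mul y (d x)"])
  fix x y assume "x \<in> carrier B \<and> y \<in> carrier B"
  then obtain a x' b y' where xy: "x = \<iota> a \<oplus>\<^bsub>B\<^esub> VB x'" "y = \<iota> b \<oplus>\<^bsub>B\<^esub> VB y'"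
    and [simp]: "a \<in> carrier A" "x' \<in> carrier B" "b \<in> carrier A" "y' \<in> carrier B"
    by (metis B_cases)
  define c where "c = act a (W (d y')) \<oplus>\<^bsub>C\<^esub> act b (W (d x'))"
  have [simp]: "c \<in> carrier C" by (simp add: c_def)
  have "d (x \<otimes>\<^bsub>B\<^esub> y) = W (d (\<iota> (A.F a) \<otimes>\<^bsub>B\<^esub> y' \<oplus>\<^bsub>B\<^esub> \<iota> (A.F b) \<otimes>\<^bsub>B\<^esub> x' \<oplus>\<^bsub>B\<^esub> \<iota> A.frob_V_one \<otimes>\<^bsub>B\<^esub> (x' \<otimes>\<^bsub>B\<^esub> y')))"
    unfolding xy mult_decompose[OF \<open>a \<in> carrier A\<close> \<open>b \<in> carrier A\<close> \<open>x' \<in> carrier B\<close> \<open>y' \<in> carrier B\<close>]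
    by (subst d_decompose) simp_all
  also have "\<dots> = c \<oplus>\<^bsub>C\<^esub> T (d (x' \<otimes>\<^bsub>B\<^esub> y'))"
    by (simp add: c_def act_d[symmetric] act_W act_pi T_alt)
  finally have l: "d (x \<otimes>\<^bsub>B\<^esub> y) = c \<oplus>\<^bsub>C\<^esub> T (d (x' \<otimes>\<^bsub>B\<^esub> y'))" .
  have "d x = W (d x')" "d y = W (d y')" by (simp_all add: xy W_d)
  then have r: "mul x (d y) \<oplus>\<^bsub>C\<^esub> mul y (d x) = c \<oplus>\<^bsub>C\<^esub> T (mul x' (d y') \<oplus>\<^bsub>C\<^esub> mul y' (d x'))"
    unfolding xy by (simp add: c_def mul_rec C.a_ac del: W.hom_add)
  show "\<exists>c\<in>carrier C. \<exists>x' y' (_::unit). (x' \<in> carrier B \<and> y' \<in> carrier B) \<and>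
      d (x \<otimes>\<^bsub>B\<^esub> y) = c \<oplus>\<^bsub>C\<^esub> T (d (x' \<otimes>\<^bsub>B\<^esub> y')) \<and>
      mul x (d y) \<oplus>\<^bsub>C\<^esub> mul y (d x) = c \<oplus>\<^bsub>C\<^esub> T (mul x' (d y') \<oplus>\<^bsub>C\<^esub> mul y' (d x'))"
    unfolding l r by (intro bexI[of _ c] exI[of _ x'] exI[of _ y']) simp_all
qed (use assms in auto)

lemma module_mul: "module B (module_on C mul)"
  by (rule moduleI)
     (auto simp: B.is_cring abelian_group_module_on C.abelian_group_axioms
       mul_add_left mul_add_right mul_assoc mul_one)

lemma module_act: "module A (module_on C act)"
  by (rule moduleI)
     (auto simp: A.is_cring abelian_group_module_on C.abelian_group_axioms
       act_add_left act_add_right act_mult act_one)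

lemma derivation_d: "derivation B (module_on C mul) d"
  by (intro derivation.intro module_mul derivation_axioms.intro)
     (use d_hom in \<open>simp_all add: leibniz hom_def\<close>)

sublocale D: derivation B "module_on C mul" d
  rewrites "carrier (module_on C mul) = carrier C" and "zero (module_on C mul) = zero C"
    and "add (module_on C mul) = add C" and "smult (module_on C mul) = mul"
    and "a_minus (module_on C mul) = a_minus C"
    and "add_pow (module_on C mul) = (add_pow C :: nat \<Rightarrow> _)"
  by (rule derivation_d) simp_all

text \<open>The expression \<open>x\<^sup>p\<^sup>-\<^sup>1 d x\<close> fails to be additive by
  \<open>((x + y)\<^sup>p\<^sup>-\<^sup>1 - x\<^sup>p\<^sup>-\<^sup>1) d x + ((x + y)\<^sup>p\<^sup>-\<^sup>1 - y\<^sup>p\<^sup>-\<^sup>1) d y\<close>, which is the derivative of the polynomial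
  subtracted in the formula for \<open>\<delta> (x + y)\<close>.\<close>

lemma delta_defect_add:
  assumes [simp]: "x \<in> carrier B" "y \<in> carrier B"
  shows "d (\<delta>B (x \<oplus>\<^bsub>B\<^esub> y)) \<oplus>\<^bsub>C\<^esub> mul ((x \<oplus>\<^bsub>B\<^esub> y) [^]\<^bsub>B\<^esub> (p - 1)) (d (x \<oplus>\<^bsub>B\<^esub> y)) =
    (d (\<delta>B x) \<oplus>\<^bsub>C\<^esub> mul (x [^]\<^bsub>B\<^esub> (p - 1)) (d x)) \<oplus>\<^bsub>C\<^esub> (d (\<delta>B y) \<oplus>\<^bsub>C\<^esub> mul (y [^]\<^bsub>B\<^esub> (p - 1)) (d y))"
proof -
  let ?S = "\<Oplus>\<^bsub>B\<^esub>i\<in>{1..p - 1}. [((p choose i) div p)] \<cdot>\<^bsub>B\<^esub> (x [^]\<^bsub>B\<^esub> i \<otimes>\<^bsub>B\<^esub> y [^]\<^bsub>B\<^esub> (p - i))"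
  have [simp]: "?S \<in> carrier B" by (auto intro!: B.finsum_closed)
  let ?z = "(x \<oplus>\<^bsub>B\<^esub> y) [^]\<^bsub>B\<^esub> (p - 1)"
  have "d ?S = (mul ?z (d x) \<ominus>\<^bsub>C\<^esub> mul (x [^]\<^bsub>B\<^esub> (p - 1)) (d x)) \<oplus>\<^bsub>C\<^esub> (mul ?z (d y) \<ominus>\<^bsub>C\<^esub> mul (y [^]\<^bsub>B\<^esub> (p - 1)) (d y))"
    using D.d_addition_polynomial[OF B.prime_p, of x y] by (simp add: mul_minus_left del: One_nat_def)
  then have "d (\<delta>B (x \<oplus>\<^bsub>B\<^esub> y)) = d (\<delta>B x) \<oplus>\<^bsub>C\<^esub> d (\<delta>B y) \<ominus>\<^bsub>C\<^esub>
    ((mul ?z (d x) \<ominus>\<^bsub>C\<^esub> mul (x [^]\<^bsub>B\<^esub> (p - 1)) (d x)) \<oplus>\<^bsub>C\<^esub> (mul ?z (d y) \<ominus>\<^bsub>C\<^esub> mul (y [^]\<^bsub>B\<^esub> (p - 1)) (d y)))"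
    by (simp add: B.delta_add d.hom_minus)
  moreover have "(u \<oplus>\<^bsub>C\<^esub> v \<ominus>\<^bsub>C\<^esub> ((z \<ominus>\<^bsub>C\<^esub> u') \<oplus>\<^bsub>C\<^esub> (w \<ominus>\<^bsub>C\<^esub> v'))) \<oplus>\<^bsub>C\<^esub> (z \<oplus>\<^bsub>C\<^esub> w) = (u \<oplus>\<^bsub>C\<^esub> u') \<oplus>\<^bsub>C\<^esub> (v \<oplus>\<^bsub>C\<^esub> v')"
    if "u \<in> carrier C" "v \<in> carrier C" "w \<in> carrier C" "z \<in> carrier C" "u' \<in> carrier C" "v' \<in> carrier C" for u v w z u' v'
  proof -
    have "(u \<oplus>\<^bsub>C\<^esub> v \<ominus>\<^bsub>C\<^esub> ((z \<ominus>\<^bsub>C\<^esub> u') \<oplus>\<^bsub>C\<^esub> (w \<ominus>\<^bsub>C\<^esub> v'))) \<oplus>\<^bsub>C\<^esub> (z \<oplus>\<^bsub>C\<^esub> w) =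
      (u \<oplus>\<^bsub>C\<^esub> u') \<oplus>\<^bsub>C\<^esub> (v \<oplus>\<^bsub>C\<^esub> v') \<oplus>\<^bsub>C\<^esub> ((z \<ominus>\<^bsub>C\<^esub> z) \<oplus>\<^bsub>C\<^esub> (w \<ominus>\<^bsub>C\<^esub> w))"
      using that by (simp add: a_minus_def C.minus_add C.a_ac)
    then show ?thesis using that by (simp add: a_minus_def C.r_neg)
  qed
  ultimately show ?thesis
    by (simp add: mul_add_right)
qed

lemma mul_V: "\<lbrakk>y \<in> carrier B; m \<in> carrier C\<rbrakk> \<Longrightarrow> mul (VB y) m = T (mul y (\<phi> m))"
  using mul_rec[of "\<zero>\<^bsub>A\<^esub>" y m] by (simp add: mul_iota[symmetric] mul_zero_left)

lemma mul_V_pow_W: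
  assumes [simp]: "y \<in> carrier B"
  shows "m \<in> carrier C \<Longrightarrow> mul (VB y [^]\<^bsub>B\<^esub> (k::nat)) (W m) = [(p ^ k)] \<cdot>\<^bsub>C\<^esub> W (mul (y [^]\<^bsub>B\<^esub> k) m)"
proof (induction k arbitrary: m)
  case 0
  then show ?case by (simp add: mul_one)
next
  case (Suc k)
  then have [simp]: "m \<in> carrier C" by simp
  have "mul (VB y [^]\<^bsub>B\<^esub> Suc k) (W m) = mul (VB y [^]\<^bsub>B\<^esub> k) (W ([p] \<cdot>\<^bsub>C\<^esub> mul y m))"
    by (simp add: mul_assoc mul_V T_alt del: W.hom_add)
  also have "\<dots> = [(p ^ k)] \<cdot>\<^bsub>C\<^esub> W (mul (y [^]\<^bsub>B\<^esub> k) ([p] \<cdot>\<^bsub>C\<^esub> mul y m))"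
    by (rule Suc.IH) simp
  also have "\<dots> = [(p ^ Suc k)] \<cdot>\<^bsub>C\<^esub> W (mul (y [^]\<^bsub>B\<^esub> Suc k) m)"
    by (simp add: mul_add_pow_right W.hom_add_pow mul_assoc C.add.nat_pow_pow mult.commute)
  finally show ?case .
qed

text \<open>The value \<open>u (V y)\<close>. For odd \<open>p\<close> the term \<open>- p\<^sup>p\<^sup>-\<^sup>2 d (V (y\<^sup>p)) = - p\<^sup>p\<^sup>-\<^sup>1 W (y\<^sup>p\<^sup>-\<^sup>1 d y)\<close> from
  \<open>\<delta> (V y)\<close> cancels against \<open>(V y)\<^sup>p\<^sup>-\<^sup>1 d (V y)\<close>. For \<open>p = 2\<close> the two terms under \<open>T\<close> combine to
  \<open>u y\<close>.\<close>

lemma delta_defect_V: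
  assumes [simp]: "y \<in> carrier B"
  shows "d (\<delta>B (VB y)) \<oplus>\<^bsub>C\<^esub> mul (VB y [^]\<^bsub>B\<^esub> (p - 1)) (d (VB y)) =
    (if p = 2 then \<ominus>\<^bsub>C\<^esub> d y \<oplus>\<^bsub>C\<^esub> T (d (\<delta>B y) \<oplus>\<^bsub>C\<^esub> mul (y [^]\<^bsub>B\<^esub> (p - 1)) (d y)) else d y)"
proof -
  have V: "mul (VB y [^]\<^bsub>B\<^esub> (p - 1)) (d (VB y)) = [(p ^ (p - 1))] \<cdot>\<^bsub>C\<^esub> W (mul (y [^]\<^bsub>B\<^esub> (p - 1)) (d y))"
    by (simp add: W_d[symmetric] mul_V_pow_W)
  show ?thesis
  proof (cases "p = 2")
    case True
    have "\<delta>B (VB y) = \<ominus>\<^bsub>B\<^esub> y \<oplus>\<^bsub>B\<^esub> VB (\<iota> A.frob_V_one \<otimes>\<^bsub>B\<^esub> \<delta>B y)"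
      unfolding B_pi[symmetric] using B.delta_V[of y] by (simp add: True)
    then have "d (\<delta>B (VB y)) = \<ominus>\<^bsub>C\<^esub> d y \<oplus>\<^bsub>C\<^esub> T (d (\<delta>B y))"
      by (simp add: W_d[symmetric] act_d[symmetric] act_pi T_alt)
    moreover have "p ^ (p - 1) = p" using True by simp
    ultimately show ?thesis
      unfolding V if_P[OF True] by (simp add: T_def[symmetric] C.a_assoc del: One_nat_def)
  next
    case False
    then have "p - 1 = Suc (p - 2)"
      using B.prime_p prime_ge_2_nat[of p] by simp
    then have p: "p * p ^ (p - 2) = p ^ (p - 1)"
      by simp
    have "d (VB (y [^]\<^bsub>B\<^esub> p)) = [p] \<cdot>\<^bsub>C\<^esub> W (mul (y [^]\<^bsub>B\<^esub> (p - 1)) (d y))"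
      by (simp add: W_d[symmetric] D.d_pow W.hom_add_pow)
    then have "d (\<delta>B (VB y)) = d y \<ominus>\<^bsub>C\<^esub> [(p ^ (p - 1))] \<cdot>\<^bsub>C\<^esub> W (mul (y [^]\<^bsub>B\<^esub> (p - 1)) (d y))"
      using B.delta_V[of y] False
      by (simp add: d.hom_minus d.hom_add_pow C.add.nat_pow_pow mult.commute[of _ p] p del: One_nat_def)
    then show ?thesis
      unfolding V using False by (simp add: a_minus_def C.a_assoc C.l_neg)
  qed
qed

lemma d_delta:
  assumes x: "x \<in> carrier B"
  shows "d (\<delta>B x) = \<phi> (d x) \<ominus>\<^bsub>C\<^esub> mul (x [^]\<^bsub>B\<^esub> (p - 1)) (d x)"
proof -
  let ?u = "\<lambda>x. d (\<delta>B x) \<oplus>\<^bsub>C\<^esub> mul (x [^]\<^bsub>B\<^esub> (p - 1)) (d x)"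
  have u: "?u (\<iota> a \<oplus>\<^bsub>B\<^esub> VB y) = ?u (VB y)" if "a \<in> carrier A" "y \<in> carrier B" for a y
  proof -
    have "?u (\<iota> a \<oplus>\<^bsub>B\<^esub> VB y) = ?u (\<iota> a) \<oplus>\<^bsub>C\<^esub> ?u (VB y)"
      using that by (intro delta_defect_add) auto
    moreover have "?u (\<iota> a) = \<zero>\<^bsub>C\<^esub>"
      using that(1) by (simp add: iota_delta[symmetric] mul_zero_right)
    ultimately show ?thesis using that by simp
  qed
  have phi_d: "\<phi> (d (\<iota> a \<oplus>\<^bsub>B\<^esub> VB y)) = d y" if "a \<in> carrier A" "y \<in> carrier B" for a y
    using that by (simp add: W_d[symmetric])
  have "?u x = \<phi> (d x)"
  proof (cases "p = 2")
    case True
    show ?thesis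
    proof (rule bisimulation_family_one[where P = "\<lambda>x. x \<in> carrier B"])
      fix x assume "x \<in> carrier B"
      then obtain a y where xay: "x = \<iota> a \<oplus>\<^bsub>B\<^esub> VB y" and ay [simp]: "a \<in> carrier A" "y \<in> carrier B"
        by (metis B_cases)
      have "?u x = \<ominus>\<^bsub>C\<^esub> d y \<oplus>\<^bsub>C\<^esub> T (?u y)"
        unfolding xay u[OF ay] using delta_defect_V[of y] True by simp
      \<comment> \<open>The same recursion, since \<open>T (\<phi> (d y)) = 2 d y\<close>.\<close>
      moreover have "\<phi> (d x) = \<ominus>\<^bsub>C\<^esub> d y \<oplus>\<^bsub>C\<^esub> T (\<phi> (d y))"
        unfolding xay phi_d[OF ay] T_def by (simp add: True C.add_pow_two C.r_neg1)
      ultimately show "\<exists>c\<in>carrier C. \<exists>y. y \<in> carrier B \<and> ?u x = c \<oplus>\<^bsub>C\<^esub> T (?u y) \<and> \<phi> (d x) = c \<oplus>\<^bsub>C\<^esub> T (\<phi> (d y))"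
        by (intro bexI[of _ "\<ominus>\<^bsub>C\<^esub> d y"] exI[of _ y]) simp_all
    qed (use x in auto)
  next
    case False
    obtain a y where xay: "x = \<iota> a \<oplus>\<^bsub>B\<^esub> VB y" and ay: "a \<in> carrier A" "y \<in> carrier B"
      using x by (metis B_cases)
    show ?thesis
      unfolding xay u[OF ay] phi_d[OF ay] using delta_defect_V[OF ay(2)] False by simp
  qed
  then have "\<phi> (d x) = mul (x [^]\<^bsub>B\<^esub> (p - 1)) (d x) \<oplus>\<^bsub>C\<^esub> d (\<delta>B x)"
    using x by (simp add: C.a_comm)
  then show ?thesis
    by (rule C.eq_minusI) (use x in auto)
qed

lemma frobenius_module_act: "frobenius_module A p \<delta>A (module_on C act) \<phi>"
  by (intro frobenius_module.intro A.delta_ring_axioms module_act frobenius_module_axioms.intro)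
     (simp_all add: phi_act phi_hom[unfolded hom_def] hom_def)

lemma taut_derivation_d:
  assumes sm: "\<And>x m. \<lbrakk>x \<in> carrier B; m \<in> carrier C\<rbrakk> \<Longrightarrow> sm x m = mul x m"
  shows "taut_derivation B p \<delta>B (module_on C sm) \<phi> d"
proof -
  have "module B (module_on C sm)"
    by (rule moduleI)
       (auto simp: B.is_cring abelian_group_module_on C.abelian_group_axioms sm
         mul_add_left mul_add_right mul_assoc mul_one)
  then have "frobenius_module B p \<delta>B (module_on C sm) \<phi>"
    by (intro frobenius_module.intro B.delta_ring_axioms frobenius_module_axioms.intro)
       (use phi_hom in \<open>simp_all add: phi_mul sm hom_def\<close>)
  then show ?thesis
    by (intro taut_derivation.intro delta_derivation.intro delta_derivation_axioms.intro taut_derivation_axioms.intro)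
       (use d_hom in \<open>simp_all add: sm leibniz d_delta phi_bij complete_C hom_def\<close>)
qed

lemma frobenius_module_unique:
  assumes sm: "frobenius_module B p \<delta>B (module_on C sm) \<phi>"
    and ext: "\<And>a m. \<lbrakk>a \<in> carrier A; m \<in> carrier C\<rbrakk> \<Longrightarrow> sm (\<iota> a) m = act a m"
    and "x \<in> carrier B" "m \<in> carrier C"
  shows "sm x m = mul x m"
proof -
  interpret S: frobenius_module B p \<delta>B "module_on C sm" \<phi> by (rule sm)
  show ?thesis
    using S.smult_closed S.smult_l_distr S.smult_assoc1 S.phi_semilinear ext assms(3,4)
    by (intro mul_unique) simp_all
qed

end

section \<open>The cokernel of the completion map\<close>

context cartier_ring
begin

abbreviation Ck where "Ck \<equiv> coker_module R V (coker_smult R V)"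
abbreviation dk where "dk \<equiv> coker_proj R V"

lemma image_subgroup: "abelian_subgroup (completion_image R V) Rh"
proof (rule abelian_subgroupI3)
  show "additive_subgroup (completion_image R V) Rh"
    using group_hom.img_is_subgroup[OF iota.ring.a_group_hom]
    by (intro additive_subgroupI) (simp add: completion_image_def)
qed (rule Rh.is_abelian_group)

sublocale im: abelian_subgroup "completion_image R V" Rh
  by (rule image_subgroup)

lemma coker_simps:
  "carrier Ck = a_rcosets\<^bsub>Rh\<^esub> completion_image R V" "zero Ck = completion_image R V"
  "X \<oplus>\<^bsub>Ck\<^esub> Y = X <+>\<^bsub>Rh\<^esub> Y"
  by (simp_all add: coker_module_def)

lemma coker_module_module_on: "coker_module R V sm = module_on Ck sm"
  by (simp add: coker_module_def module_on_def)

lemma coker_carrier: "carrier Ck = dk ` carrier Rh"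
  by (auto simp: coker_simps A_RCOSETS_def' coker_proj_def)

lemma coker_proj_add:
  "\<lbrakk>x \<in> carrier Rh; y \<in> carrier Rh\<rbrakk> \<Longrightarrow> dk x \<oplus>\<^bsub>Ck\<^esub> dk y = dk (x \<oplus>\<^bsub>Rh\<^esub> y)"
  by (simp add: coker_simps coker_proj_def im.a_rcos_sum)

lemma coker_proj_zero: "\<zero>\<^bsub>Ck\<^esub> = dk \<zero>\<^bsub>Rh\<^esub>"
  by (simp add: coker_simps coker_proj_def im.a_subset)

lemma coker_proj_kernel:
  "x \<in> carrier Rh \<Longrightarrow> dk x = \<zero>\<^bsub>Ck\<^esub> \<longleftrightarrow> x \<in> \<iota> ` carrier R"
  using im.a_rcos_self[of x] im.a_rcos_const[of x]
  by (auto simp: coker_simps coker_proj_def completion_image_def)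

lemma coker_abelian_group: "abelian_group Ck"
proof (rule abelian_groupI)
  fix X assume "X \<in> carrier Ck"
  then obtain x where x: "x \<in> carrier Rh" "X = dk x" by (auto simp: coker_carrier)
  show "\<zero>\<^bsub>Ck\<^esub> \<oplus>\<^bsub>Ck\<^esub> X = X"
    using x by (simp add: coker_proj_zero coker_proj_add)
  show "\<exists>Y\<in>carrier Ck. Y \<oplus>\<^bsub>Ck\<^esub> X = \<zero>\<^bsub>Ck\<^esub>"
    using x by (intro bexI[of _ "dk (\<ominus>\<^bsub>Rh\<^esub> x)"])
      (simp_all add: coker_carrier coker_proj_zero coker_proj_add Rh.l_neg)
  fix Y assume "Y \<in> carrier Ck"
  then obtain y where y: "y \<in> carrier Rh" "Y = dk y" by (auto simp: coker_carrier)
  show "X \<oplus>\<^bsub>Ck\<^esub> Y \<in> carrier Ck"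
    using x y by (simp add: coker_carrier coker_proj_add)
  show "X \<oplus>\<^bsub>Ck\<^esub> Y = Y \<oplus>\<^bsub>Ck\<^esub> X"
    using x y by (simp add: coker_proj_add Rh.a_comm)
  fix Z assume "Z \<in> carrier Ck"
  then obtain z where z: "z \<in> carrier Rh" "Z = dk z" by (auto simp: coker_carrier)
  show "X \<oplus>\<^bsub>Ck\<^esub> Y \<oplus>\<^bsub>Ck\<^esub> Z = X \<oplus>\<^bsub>Ck\<^esub> (Y \<oplus>\<^bsub>Ck\<^esub> Z)"
    using x y z by (simp add: coker_proj_add Rh.a_assoc)
qed (simp add: coker_carrier coker_proj_zero)

text \<open>The maps on the cokernel are defined as unions over all elements of a coset; for an additive
  map that preserves the image of \<open>\<iota>\<close> all members of the union coincide.\<close>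

lemma coker_UN:
  assumes x: "x \<in> carrier Rh"
    and g: "g \<in> hom (add_monoid Rh) (add_monoid Rh)" "\<And>a. a \<in> carrier R \<Longrightarrow> g (\<iota> a) \<in> \<iota> ` carrier R"
  shows "(\<Union>y\<in>dk x. dk (g y)) = dk (g x)"
proof -
  have dk_x: "dk x = (\<lambda>a. \<iota> a \<oplus>\<^bsub>Rh\<^esub> x) ` carrier R"
    by (auto simp: coker_proj_def a_r_coset_def' completion_image_def)
  have gc: "g y \<in> carrier Rh" if "y \<in> carrier Rh" for y
    using g(1) that by (auto simp: hom_def)
  have "dk (g (\<iota> a \<oplus>\<^bsub>Rh\<^esub> x)) = dk (g x)" if a: "a \<in> carrier R" for a
  proof -
    have "g (\<iota> a \<oplus>\<^bsub>Rh\<^esub> x) = g (\<iota> a) \<oplus>\<^bsub>Rh\<^esub> g x"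
      using g(1) a x by (simp add: hom_def)
    then have "dk (g (\<iota> a \<oplus>\<^bsub>Rh\<^esub> x)) = dk (g (\<iota> a)) \<oplus>\<^bsub>Ck\<^esub> dk (g x)"
      using a x gc by (simp add: coker_proj_add)
    also have "dk (g (\<iota> a)) = \<zero>\<^bsub>Ck\<^esub>"
      using a g(2) gc by (simp add: coker_proj_kernel)
    also have "\<zero>\<^bsub>Ck\<^esub> \<oplus>\<^bsub>Ck\<^esub> dk (g x) = dk (g x)"
      using x gc by (simp add: coker_proj_zero coker_proj_add)
    finally show ?thesis .
  qed
  then show ?thesis
    unfolding dk_x by auto
qed

lemma coker_V_proj: "x \<in> carrier Rh \<Longrightarrow> coker_V R V (dk x) = dk (Vh x)"
  unfolding coker_V_def
  using cartier_ring.V_hom[OF completion_cartier]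
  by (intro coker_UN) (auto simp: iota_V[symmetric])

lemma coker_smult_proj:
  "\<lbrakk>a \<in> carrier R; x \<in> carrier Rh\<rbrakk> \<Longrightarrow> coker_smult R V a (dk x) = dk (\<iota> a \<otimes>\<^bsub>Rh\<^esub> x)"
  unfolding coker_smult_def
  by (rule coker_UN[where g = "\<lambda>x. \<iota> a \<otimes>\<^bsub>Rh\<^esub> x"])
     (auto simp: hom_def Rh.r_distr iota.hom_mult[symmetric] simp del: iota.hom_mult iota.ring.hom_mult)

lemma cartier_cokernel_completion:
  assumes "derived_complete p R"
  shows "cartier_cokernel R Rh Ck p \<delta> V dh Vh \<iota> dk (coker_V R V) (coker_smult R V)"
proof (intro cartier_cokernel.intro cartier_cokernel_axioms.intro)
  show "dk \<in> hom (add_monoid Rh) (add_monoid Ck)"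
    by (auto simp: hom_def coker_carrier coker_proj_add)
qed (use assms in \<open>auto simp: cartier_ring_axioms completion_cartier coker_abelian_group iota_hom iota_V iota_delta
    completion_decompose coker_carrier coker_proj_kernel coker_V_proj coker_smult_proj
    derived_complete_completion intro: completion_V_strict\<close>)

theorem coker_taut_derivation:
  assumes complete: "derived_complete p R"
  shows "coker_V R V \<in> iso (add_monoid Ck) (add_monoid Ck)"
    and "frobenius_module R p \<delta> Ck (coker_frob R V)"
    and "\<exists>!sm. extends_coker_structure R p \<delta> V sm"
    and "\<And>sm. extends_coker_structure R p \<delta> V sm \<Longrightarrow>
       taut_derivation Rh p dh (coker_module R V sm) (coker_frob R V) dk"
proof -
  interpret X: cartier_cokernel R Rh Ck p \<delta> V dh Vh \<iota> dk "coker_V R V" "coker_smult R V"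
    by (rule cartier_cokernel_completion[OF complete])
  have car: "coker_carrier R V = carrier Ck"
    by (simp add: coker_simps)
  have frob: "coker_frob R V = X.\<phi>"
    by (simp add: coker_frob_def car)
  show "coker_V R V \<in> iso (add_monoid Ck) (add_monoid Ck)"
    using X.W_hom X.W_bij by (simp add: iso_def)
  show "frobenius_module R p \<delta> Ck (coker_frob R V)"
    using X.frobenius_module_act unfolding frob coker_module_module_on[symmetric] .
  have mul: "sm x m = X.mul x m"
    if "extends_coker_structure R p \<delta> V sm" "x \<in> carrier Rh" "m \<in> carrier Ck" for sm x m
    using that unfolding extends_coker_structure_def car frob coker_module_module_on[of sm]
    by (intro X.frobenius_module_unique) auto
  show taut: "taut_derivation Rh p dh (coker_module R V sm) (coker_frob R V) dk"
    if "extends_coker_structure R p \<delta> V sm" for sm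
    unfolding coker_module_module_on[of sm] frob
    by (rule X.taut_derivation_d) (rule mul[OF that])
  show "\<exists>!sm. extends_coker_structure R p \<delta> V sm"
  proof (rule ex1I)
    let ?sm = "restrict (\<lambda>x. restrict (X.mul x) (carrier Ck)) (carrier Rh)"
    have "taut_derivation Rh p dh (module_on Ck ?sm) X.\<phi> dk"
      by (rule X.taut_derivation_d) simp
    then have "frobenius_module Rh p dh (module_on Ck ?sm) X.\<phi>"
      by (intro delta_derivation.axioms(1) taut_derivation.axioms(1))
    then show "extends_coker_structure R p \<delta> V ?sm"
      unfolding extends_coker_structure_def car frob coker_module_module_on[of ?sm]
      by (auto simp: X.mul_iota)
    fix sm assume sm: "extends_coker_structure R p \<delta> V sm"
    then have ext: "sm \<in> carrier Rh \<rightarrow>\<^sub>E (carrier Ck \<rightarrow>\<^sub>E carrier Ck)"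
      unfolding extends_coker_structure_def car by blast
    show "sm = ?sm"
    proof (rule extensionalityI[of _ "carrier Rh"])
      fix x assume x: "x \<in> carrier Rh"
      have "sm x = restrict (X.mul x) (carrier Ck)"
        by (rule extensionalityI[of _ "carrier Ck"]) (use ext x mul[OF sm x] in \<open>auto simp: PiE_iff\<close>)
      then show "sm x = ?sm x" using x by simp
    qed (use ext in \<open>auto simp: PiE_iff\<close>)
  qed
qed

end

theorem proposition5p55:
  fixes A :: "('a, 'm) ring_scheme" and p :: nat and \<delta> V :: "'a \<Rightarrow> 'a"
  assumes "Factorial_Ring.prime p"
    and "p > 2 \<Longrightarrow> delta_cartier_ring A p \<delta> V"
    and "p = 2 \<Longrightarrow> delta_tilde_cartier_ring A \<delta> V"
    and "derived_complete p A"
  shows "coker_V A V \<in> iso (add_monoid (coker_module A V (coker_smult A V)))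
                         (add_monoid (coker_module A V (coker_smult A V))) \<and>
    frobenius_module A p \<delta> (coker_module A V (coker_smult A V)) (coker_frob A V) \<and>
    (\<exists>!sm. extends_coker_structure A p \<delta> V sm) \<and>
    (\<forall>sm. extends_coker_structure A p \<delta> V sm \<longrightarrow>
       taut_derivation (completion A V) p (completion_delta A V \<delta>)
         (coker_module A V sm) (coker_frob A V) (coker_proj A V))"
proof -
  have "p = 2 \<or> p > 2"
    using prime_ge_2_nat[OF assms(1)] by auto
  then have "cartier_ring A p \<delta> V"
    using delta_cartier_ring.cartier_ring[OF assms(2) assms(1)]
      delta_tilde_cartier_ring.cartier_ring[OF assms(3)] by auto
  from cartier_ring.coker_taut_derivation[OF this assms(4)] show ?thesis
    by blast
qed

end
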